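(* Let $N\ge1$, let $I:\mathbb{R}\to\mathbb{R}$ be $C^\infty$, $\lambda>0$ and $\eta>0$. For $\epsilon>0$ consider the system on $\mathbb{R}^{3N+1}$ with variables $(\omega_i,\Omega_i,\alpha_i)_{1\le i\le N}$ and $\theta$ $$\epsilon\dot\omega_i=-\sin(\Omega_i+\omega_i)\Bigl(I(\theta)-\sum_{j=1}^N\alpha_j\cos(\Omega_j+\omega_j)\Bigr),\qquad \dot\Omega_i=\lambda\omega_i,$$ $$\dot\alpha_i=\eta\cos(\Omega_i+\omega_i)\Bigl(I(\theta)-\sum_{j=1}^N\alpha_j\cos(\Omega_j+\omega_j)\Bigr),\qquad \dot\theta=1 .$$ For all sufficiently small $\epsilon>0$ this system has infinitely many slow locally invariant manifolds, which are simply connected compact subsets of $\mathbb{R}^{3N+1}$. More precisely, let $k_1,\dots,k_N\in\mathbb{Z}$ and let $D\subset\mathbb{R}^{2N+1}$ (coordinates $x=((\Omega_i)_i,(\alpha_i)_i,\theta)$) be a compact, simply connected $(2N+1)$-dimensional smooth submanifold with boundary on which $I(\theta)\neq\sum_{j=1}^N(-1)^{k_j}\alpha_j$. Then there is $\epsilon_0>0$ such that for all $0<\epsilon<\epsilon_0$ there is a $C^1$ function $h_\epsilon=(h_{\epsilon,1},\dots,h_{\epsilon,N}):D\to\mathbb{R}^N$ whose graph $M_\pi=\{\omega_i=h_{\epsilon,i}(x)\ \forall i,\ x\in D\}$ is locally invariant for the system, and for all $i\in\{1,\dots,N\}$ $$h_{\epsilon,i}=(k_i\pi-\Omega_i)\left(1+\frac{\epsilon\lambda(-1)^{k_i}}{I(\theta)-\sum_{j=1}^N(-1)^{k_j}\alpha_j}\right)+O(\epsilon^2)$$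 uniformly on $D$ as $\epsilon\to0$. Such an invariant manifold is attracting if on $D$ $$\alpha_i<(-1)^{k_i}I(\theta)-\sum_{j\neq i}\alpha_j(-1)^{k_j+k_i}\quad\text{for all } i,$$ repelling if on $D$ $$\alpha_i>(-1)^{k_i}I(\theta)-\sum_{j\neq i}\alpha_j(-1)^{k_j+k_i}\quad\text{for all } i,$$ and of saddle type otherwise.
   Context: Dots denote $d/dt$; the fast time is $\tau=t/\epsilon$. Write $\omega=(\omega_1,\dots,\omega_N)$. For the graph of $h_\epsilon:D\to\mathbb{R}^N$ over the slow variables $x=((\Omega_i)_i,(\alpha_i)_i,\theta)$: - Locally invariant: a solution starting on the graph stays on it on every time interval (forward or backward, containing the initial time) during which $x$ remains in $D$. - Attracting: there are constants $C,\gamma,\delta>0$ independent of $\epsilon$ such that for every solution with $|\omega-h_\epsilon(x)|<\delta$ at fast time $0$ and $x\in D$ on the fast time interval $[0,\tau]$, one has $|\omega-h_\epsilon(x)|(\tau)\le Ce^{-\gamma\tau}|\omega-h_\epsilon(x)|(0)$. - Repelling: the same property holds in backward time. - Saddle type: at every point of the graph, the $N\times N$ Jacobian with respect to $\omega$ of the map $\omega\mapsto\bigl(-\sin(\Omega_i+\omega_i)(I(\theta)-\sum_j\alpha_j\cos(\Omega_j+\omega_j))\bigr)_{i}$ has no eigenvalue on the imaginary axis and has eigenvalues both with negative and with positive real part. Since $D$ is connected and $I(\theta)\neq\sum_j(-1)^{k_j}\alpha_j$ on $D$, for each $i$ exactly one of the two strict inequalities holds throughout $D$. *)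

theory Defs
  imports "HOL-Analysis.Analysis"
begin

section \<open>Smoothness and submanifolds of full dimension\<close>

text \<open>For open \<^term>\<open>S\<close> and finite-dimensional domain this is the usual class $C^n$: a map is
  $C^{n+1}$ iff it is differentiable and all its directional derivatives are $C^n$.\<close>

primrec Ck_on :: "nat \<Rightarrow> 'a::real_normed_vector set \<Rightarrow> ('a \<Rightarrow> 'b::real_normed_vector) \<Rightarrow> bool" where
  "Ck_on 0 S f \<longleftrightarrow> continuous_on S f"
| "Ck_on (Suc n) S f \<longleftrightarrow>
     (\<forall>x\<in>S. f differentiable (at x)) \<and>
     (\<forall>v. Ck_on n S (\<lambda>x. frechet_derivative f (at x) v))"

definition smooth_on :: "'a::real_normed_vector set \<Rightarrow> ('a \<Rightarrow> 'b::real_normed_vector) \<Rightarrow> bool" where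
  "smooth_on S f \<longleftrightarrow> (\<forall>n. Ck_on n S f)"

text \<open>$C^1$ on a set that need not be open. On a submanifold of full dimension the derivative
  within \<^term>\<open>S\<close> is unique, also at boundary points.\<close>

definition C1_within :: "'a::euclidean_space set \<Rightarrow> ('a \<Rightarrow> 'b::euclidean_space) \<Rightarrow> bool" where
  "C1_within S f \<longleftrightarrow>
     (\<exists>f'. (\<forall>x\<in>S. (f has_derivative f' x) (at x within S)) \<and>
           (\<forall>v. continuous_on S (\<lambda>x. f' x v)))"

text \<open>Submanifolds with boundary of full dimension \<open>DIM('a)\<close>: near each point a smooth chart of
  the ambient space straightens the set to a closed half space. At interior points the chart domain
  can be chosen so that its image lies inside the half space.\<close>

definition full_dim_submanifold_with_boundary :: "'a::euclidean_space set \<Rightarrow> bool" where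
  "full_dim_submanifold_with_boundary D \<longleftrightarrow>
     (\<forall>p\<in>D. \<exists>U V (\<phi> :: 'a \<Rightarrow> 'a) \<psi>. \<exists>b\<in>Basis.
        open U \<and> open V \<and> p \<in> U \<and> homeomorphism U V \<phi> \<psi> \<and>
        smooth_on U \<phi> \<and> smooth_on V \<psi> \<and>
        \<phi> ` (U \<inter> D) = V \<inter> {y. 0 \<le> y \<bullet> b})"

section \<open>The slow-fast system\<close>

text \<open>A point of the space of slow variables is $x = (\Omega, \alpha, \theta)$; a point of the full
  phase space is $(\omega, x)$. The number $N$ of oscillators is \<open>CARD('n)\<close>.\<close>

type_synonym 'n slow = "(real^'n) \<times> (real^'n) \<times> real"

definition fast_field :: "(real \<Rightarrow> real) \<Rightarrow> real^'n::finite \<Rightarrow> 'n slow \<Rightarrow> real^'n" where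
  "fast_field I \<omega> = (\<lambda>(\<Omega>, \<alpha>, \<theta>).
     \<chi> i. - sin (\<Omega>$i + \<omega>$i) * (I \<theta> - (\<Sum>j\<in>UNIV. \<alpha>$j * cos (\<Omega>$j + \<omega>$j))))"

definition slow_field ::
  "(real \<Rightarrow> real) \<Rightarrow> real \<Rightarrow> real \<Rightarrow> real^'n::finite \<Rightarrow> 'n slow \<Rightarrow> 'n slow" where
  "slow_field I lam \<eta> \<omega> = (\<lambda>(\<Omega>, \<alpha>, \<theta>).
     (lam *\<^sub>R \<omega>,
      \<chi> i. \<eta> * cos (\<Omega>$i + \<omega>$i) * (I \<theta> - (\<Sum>j\<in>UNIV. \<alpha>$j * cos (\<Omega>$j + \<omega>$j))),
      1))"

definition solution_on ::
  "(real \<Rightarrow> real) \<Rightarrow> real \<Rightarrow> real \<Rightarrow> real \<Rightarrow> real set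
    \<Rightarrow> (real \<Rightarrow> real^'n::finite) \<Rightarrow> (real \<Rightarrow> 'n slow) \<Rightarrow> bool" where
  "solution_on I lam \<eta> \<epsilon> J \<omega> x \<longleftrightarrow>
     (\<forall>t\<in>J. (\<exists>\<omega>'. (\<omega> has_vector_derivative \<omega>') (at t within J) \<and>
                  \<epsilon> *\<^sub>R \<omega>' = fast_field I (\<omega> t) (x t)) \<and>
            (x has_vector_derivative slow_field I lam \<eta> (\<omega> t) (x t)) (at t within J))"

section \<open>Invariant graphs and their stability\<close>

definition graph_over :: "'n slow set \<Rightarrow> ('n slow \<Rightarrow> real^'n::finite) \<Rightarrow> ((real^'n) \<times> 'n slow) set" where
  "graph_over D h = (\<lambda>x. (h x, x)) ` D"

definition locally_invariant ::
  "(real \<Rightarrow> real) \<Rightarrow> real \<Rightarrow> real \<Rightarrow> real \<Rightarrow> 'n slow set \<Rightarrow> ('n slow \<Rightarrow> real^'n::finite) \<Rightarrow> bool" where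
  "locally_invariant I lam \<eta> \<epsilon> D h \<longleftrightarrow>
     (\<forall>J t0 \<omega> x. is_interval J \<and> t0 \<in> J \<and> solution_on I lam \<eta> \<epsilon> J \<omega> x \<and>
        (\<forall>t\<in>J. x t \<in> D) \<and> (\<omega> t0, x t0) \<in> graph_over D h
        \<longrightarrow> (\<forall>t\<in>J. (\<omega> t, x t) \<in> graph_over D h))"

text \<open>Stability concerns a family $(h_\epsilon)_{0 < \epsilon < \epsilon_0}$, since the constants must
  not depend on $\epsilon$. Solutions are parametrised by $t = \epsilon\tau$.\<close>

definition attracting ::
  "(real \<Rightarrow> real) \<Rightarrow> real \<Rightarrow> real \<Rightarrow> 'n slow set \<Rightarrow> real
    \<Rightarrow> (real \<Rightarrow> 'n slow \<Rightarrow> real^'n::finite) \<Rightarrow> bool" where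
  "attracting I lam \<eta> D \<epsilon>0 h \<longleftrightarrow>
     (\<exists>C>0. \<exists>\<gamma>>0. \<exists>\<delta>>0. \<forall>\<epsilon> \<tau> \<omega> x.
        0 < \<epsilon> \<and> \<epsilon> < \<epsilon>0 \<and> 0 \<le> \<tau> \<and>
        solution_on I lam \<eta> \<epsilon> {0..\<epsilon> * \<tau>} \<omega> x \<and> (\<forall>t\<in>{0..\<epsilon> * \<tau>}. x t \<in> D) \<and>
        norm (\<omega> 0 - h \<epsilon> (x 0)) < \<delta>
        \<longrightarrow> norm (\<omega> (\<epsilon> * \<tau>) - h \<epsilon> (x (\<epsilon> * \<tau>))) \<le> C * exp (- \<gamma> * \<tau>) * norm (\<omega> 0 - h \<epsilon> (x 0)))"

definition repelling ::
  "(real \<Rightarrow> real) \<Rightarrow> real \<Rightarrow> real \<Rightarrow> 'n slow set \<Rightarrow> real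
    \<Rightarrow> (real \<Rightarrow> 'n slow \<Rightarrow> real^'n::finite) \<Rightarrow> bool" where
  "repelling I lam \<eta> D \<epsilon>0 h \<longleftrightarrow>
     (\<exists>C>0. \<exists>\<gamma>>0. \<exists>\<delta>>0. \<forall>\<epsilon> \<tau> \<omega> x.
        0 < \<epsilon> \<and> \<epsilon> < \<epsilon>0 \<and> 0 \<le> \<tau> \<and>
        solution_on I lam \<eta> \<epsilon> {- (\<epsilon> * \<tau>)..0} \<omega> x \<and> (\<forall>t\<in>{- (\<epsilon> * \<tau>)..0}. x t \<in> D) \<and>
        norm (\<omega> 0 - h \<epsilon> (x 0)) < \<delta>
        \<longrightarrow> norm (\<omega> (- (\<epsilon> * \<tau>)) - h \<epsilon> (x (- (\<epsilon> * \<tau>))))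
              \<le> C * exp (- \<gamma> * \<tau>) * norm (\<omega> 0 - h \<epsilon> (x 0)))"

definition complex_eigenvalue :: "real^'n^'n::finite \<Rightarrow> complex \<Rightarrow> bool" where
  "complex_eigenvalue A z \<longleftrightarrow> (\<exists>v. v \<noteq> 0 \<and> map_matrix complex_of_real A *v v = z *s v)"

definition saddle_type ::
  "(real \<Rightarrow> real) \<Rightarrow> 'n slow set \<Rightarrow> ('n slow \<Rightarrow> real^'n::finite) \<Rightarrow> bool" where
  "saddle_type I D h \<longleftrightarrow>
     (\<forall>x\<in>D. let A = jacobian (\<lambda>\<omega>. fast_field I \<omega> x) (at (h x)) in
        (\<forall>z. complex_eigenvalue A z \<longrightarrow> Re z \<noteq> 0) \<and>
        (\<exists>z. complex_eigenvalue A z \<and> Re z < 0) \<and>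
        (\<exists>z. complex_eigenvalue A z \<and> Re z > 0))"

section \<open>Domains and slow manifolds\<close>

definition admissible_domain :: "(real \<Rightarrow> real) \<Rightarrow> ('n::finite \<Rightarrow> int) \<Rightarrow> 'n slow set \<Rightarrow> bool" where
  "admissible_domain I k D \<longleftrightarrow>
     compact D \<and> simply_connected D \<and> full_dim_submanifold_with_boundary D \<and>
     (\<forall>(\<Omega>, \<alpha>, \<theta>)\<in>D. I \<theta> \<noteq> (\<Sum>j\<in>UNIV. (-1) powi k j * \<alpha>$j))"

definition slow_manifold_approx ::
  "(real \<Rightarrow> real) \<Rightarrow> real \<Rightarrow> ('n::finite \<Rightarrow> int) \<Rightarrow> real \<Rightarrow> 'n slow \<Rightarrow> 'n \<Rightarrow> real" where
  "slow_manifold_approx I lam k \<epsilon> = (\<lambda>(\<Omega>, \<alpha>, \<theta>) i.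
     (of_int (k i) * pi - \<Omega>$i) *
     (1 + \<epsilon> * lam * (-1) powi k i / (I \<theta> - (\<Sum>j\<in>UNIV. (-1) powi k j * \<alpha>$j))))"

definition slow_invariant_family ::
  "(real \<Rightarrow> real) \<Rightarrow> real \<Rightarrow> real \<Rightarrow> ('n::finite \<Rightarrow> int) \<Rightarrow> 'n slow set \<Rightarrow> real
    \<Rightarrow> (real \<Rightarrow> 'n slow \<Rightarrow> real^'n) \<Rightarrow> bool" where
  "slow_invariant_family I lam \<eta> k D \<epsilon>0 h \<longleftrightarrow>
     (\<forall>\<epsilon>. 0 < \<epsilon> \<and> \<epsilon> < \<epsilon>0 \<longrightarrow>
        C1_within D (h \<epsilon>) \<and> locally_invariant I lam \<eta> \<epsilon> D (h \<epsilon>) \<and>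
        compact (graph_over D (h \<epsilon>)) \<and> simply_connected (graph_over D (h \<epsilon>))) \<and>
     (\<forall>i. \<exists>C. \<forall>\<^sub>F \<epsilon> in at_right 0. \<forall>x\<in>D.
        \<bar>h \<epsilon> x $ i - slow_manifold_approx I lam k \<epsilon> x i\<bar> \<le> C * \<epsilon>\<^sup>2)"

definition attracting_condition :: "(real \<Rightarrow> real) \<Rightarrow> ('n::finite \<Rightarrow> int) \<Rightarrow> 'n slow set \<Rightarrow> bool" where
  "attracting_condition I k D \<longleftrightarrow>
     (\<forall>(\<Omega>, \<alpha>, \<theta>)\<in>D. \<forall>i.
        \<alpha>$i < (-1) powi k i * I \<theta> - (\<Sum>j\<in>UNIV - {i}. \<alpha>$j * (-1) powi (k j + k i)))"

definition repelling_condition :: "(real \<Rightarrow> real) \<Rightarrow> ('n::finite \<Rightarrow> int) \<Rightarrow> 'n slow set \<Rightarrow> bool" where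
  "repelling_condition I k D \<longleftrightarrow>
     (\<forall>(\<Omega>, \<alpha>, \<theta>)\<in>D. \<forall>i.
        \<alpha>$i > (-1) powi k i * I \<theta> - (\<Sum>j\<in>UNIV - {i}. \<alpha>$j * (-1) powi (k j + k i)))"

end

theory Submission
  imports Defs "HOL-Computational_Algebra.Fundamental_Theorem_Algebra"
begin

text \<open>Since $\dot\theta = 1$, orbits over a bounded domain live for a bounded slow time, and the manifold
  need not be found as a fixed point of a graph transform: it is the union of the orbits of a boundary
  value problem. In the coordinates $u_i = \Omega_i + \omega_i - k_i\pi$ the fast equation linearises at
  $u = 0$ to a diagonal system whose entries are $\pm$ the same non-vanishing function of $x$. After a truncation
  outside $D$ one prescribes $u_i = \epsilon q_i(x)$, the first order term of the expansion, at the initial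
  value of $\theta$ for the contracting components and at the final value for the expanding ones.

  All estimates come from one componentwise maximum principle: where $|u_i(t)|$ is maximal over all components and
  times, the sign of the derivative forces $t$ to be the end at which the data of component $i$ are given. Applied to
  the difference of two orbits it shows that the boundary defect expands in $u$; hence (invariance of domain)
  exactly one orbit passes through each slow point, and the graph is $C^1$ and Lipschitz. Applied to $u$ and to
  $u - \epsilon q$ it gives the bounds $O(\epsilon)$ and $O(\epsilon^2)$, and with an exponential weight the
  attraction rate; repulsion is attraction under time reversal. In the mixed case the Jacobian is close to
  a multiple of a reflection, so that Gershgorin discs and an invariant cone locate its eigenvalues. The symmetry
  $\Omega_i \mapsto \Omega_i + 2\pi m_i$ reduces all $k$ to $2^N$ cases, which makes one
  $\epsilon_1$ sufficient for all of them.\<close>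

section \<open>Differential equations with Lipschitz right-hand side\<close>


text \<open>Orbits over \<open>D\<close> may leave \<open>D\<close>, so data cannot be imposed on
  its boundary. The fields are extended to globally Lipschitz ones, whose orbits exist between
  \<open>\<theta> = - R\<close> and \<open>\<theta> = R\<close>, where \<open>R\<close> bounds
  \<open>D\<close>, and the data are given on these two slices. Slow time between them is at most
  \<open>2 * R\<close>, and the slow Lipschitz constant \<open>L\<close> does not depend on
  \<epsilon>, so slow deviations grow by a factor \<open>E\<close> independent of \<epsilon>. Hence,
  once the fast deviation dominates, a pair of orbits stays in a cone
  \<open>norm (x - y) \<le> K * \<bar>u$i - v$i\<bar>\<close>, and there the fast equation has a
  definite sign with rate of order \<open>1 / \<epsilon>\<close>. Fast deviations are measured in
  the maximum norm because then only the equation of the largest component matters. The data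
  \<open>\<epsilon> * q\<close> are forced by the second order error, uniform up to the end slices,
  which \<open>D\<close> may touch: data 0 would be wrong by order \<epsilon> there. A solution of
  the original system obeys the truncated one only while \<open>u\<close> is small, which has to be
  proved along the way.\<close>

lemma gronwall_two_sided:
  fixes y y' :: "real \<Rightarrow> 'a::real_inner"
  assumes der: "\<And>s. s \<in> {a..b} \<Longrightarrow> (y has_vector_derivative y' s) (at s within {a..b})"
    and bd: "\<And>s. s \<in> {a..b} \<Longrightarrow> norm (y' s) \<le> L * norm (y s) + M"
    and L: "L \<ge> 0" and M: "M \<ge> 0" and s: "s \<in> {a..b}" and t: "t \<in> {a..b}"
  shows "norm (y s) \<le> exp ((2*L+1) * \<bar>s - t\<bar> / 2) * (norm (y t) + M)"
proof -
  define c where "c = 2*L+1"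
  \<comment> \<open>The squared norm is differentiable even where \<open>y\<close> vanishes, and
    adding the square of \<open>M\<close> makes the estimate homogeneous:
    \<open>2 * norm (y r) * M\<close> is at most the sum of the two squares. This is where the
    \<open>+ 1\<close> in \<open>c\<close> comes from, and it bounds the derivative by
    \<open>c * \<phi>\<close> with either sign.\<close>
  define \<phi> where "\<phi> r = y r \<bullet> y r + M\<^sup>2" for r
  have c: "c \<ge> 1" using L by (simp add: c_def)
  have d\<phi>: "(\<phi> has_real_derivative 2 * (y r \<bullet> y' r)) (at r within {a..b})" if "r \<in> {a..b}" for r
    unfolding \<phi>_def has_field_derivative_def
    by (rule has_derivative_eq_rhs[OF has_derivative_add_const[OF has_derivative_inner[OF
          der[OF that, unfolded has_vector_derivative_def] der[OF that, unfolded has_vector_derivative_def]]]])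
       (auto simp: inner_commute algebra_simps)
  have b\<phi>: "\<bar>2 * (y r \<bullet> y' r)\<bar> \<le> c * \<phi> r" if "r \<in> {a..b}" for r
  proof -
    let ?n = "norm (y r)"
    have "\<bar>y r \<bullet> y' r\<bar> \<le> ?n * norm (y' r)" by (rule Cauchy_Schwarz_ineq2)
    also have "\<dots> \<le> ?n * (L * ?n + M)" using bd[OF that] by (intro mult_left_mono) auto
    finally have "\<bar>2 * (y r \<bullet> y' r)\<bar> \<le> 2 * L * ?n\<^sup>2 + 2 * ?n * M"
      by (simp add: power2_eq_square algebra_simps)
    moreover have "2 * ?n * M \<le> ?n\<^sup>2 + M\<^sup>2" using sum_squares_bound[of ?n M] by simp
    moreover have "M\<^sup>2 \<le> c * M\<^sup>2" using c by (simp add: mult_right_le_one_le mult_le_cancel_right1)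
    ultimately show ?thesis by (simp add: \<phi>_def c_def dot_square_norm algebra_simps)
  qed
  \<comment> \<open>\<open>\<sigma> = 1\<close> is the forward and \<open>\<sigma> = -1\<close> the
    backward estimate; the outer factor \<open>\<sigma>\<close> in \<open>?f\<close> makes it
    nonincreasing in both cases.\<close>
  have mono: "exp (- \<sigma> * c * v) * \<phi> v \<le> exp (- \<sigma> * c * u) * \<phi> u"
    if "\<sigma> = 1 \<and> u \<le> v \<or> \<sigma> = -1 \<and> v \<le> u" "u \<in> {a..b}" "v \<in> {a..b}" for u v \<sigma>
  proof -
    let ?f = "\<lambda>r. \<sigma> * (exp (- \<sigma> * c * r) * \<phi> r)"
    have D: "(?f has_real_derivative \<sigma> * (exp (- \<sigma> * c * r) * (2 * (y r \<bullet> y' r) - \<sigma> * c * \<phi> r)))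
        (at r within {a..b})" if "r \<in> {a..b}" for r
      using d\<phi>[OF that] by (auto intro!: derivative_eq_intros simp: algebra_simps)
    have N: "\<sigma> * (exp (- \<sigma> * c * r) * (2 * (y r \<bullet> y' r) - \<sigma> * c * \<phi> r)) \<le> 0" if "r \<in> {a..b}" for r
    proof -
      have "\<sigma> * (2 * (y r \<bullet> y' r) - \<sigma> * c * \<phi> r) \<le> 0"
        using b\<phi>[OF that] \<open>\<sigma> = 1 \<and> u \<le> v \<or> \<sigma> = -1 \<and> v \<le> u\<close> by (auto simp: abs_le_iff)
      then have "exp (- \<sigma> * c * r) * (\<sigma> * (2 * (y r \<bullet> y' r) - \<sigma> * c * \<phi> r)) \<le> 0"
        by (rule mult_nonneg_nonpos[OF exp_ge_zero])
      then show ?thesis by (subst mult.left_commute)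
    qed
    define p q where "p = min u v" and "q = max u v"
    have pq: "p \<le> q" "{p..q} \<subseteq> {a..b}" "a \<le> p" "q \<le> b" using that by (auto simp: p_def q_def)
    have "?f q \<le> ?f p"
    proof (rule DERIV_nonpos_imp_decreasing_open[OF pq(1)])
      fix r assume r: "p < r" "r < q"
      then have r': "r \<in> {a<..<b}" using pq by simp
      then have "at r within {a..b} = at r" by (simp add: at_within_Icc_at)
      then show "\<exists>z. (?f has_real_derivative z) (at r) \<and> z \<le> 0"
        using D[of r] N[of r] r' by (intro exI conjI) auto
    next
      show "continuous_on {p..q} ?f"
        by (rule continuous_on_subset[OF DERIV_continuous_on[OF D] pq(2)])
    qed
    then show ?thesis using that(1) by (auto simp: p_def q_def)
  qed
  have "\<phi> s \<le> exp (c * \<bar>s - t\<bar>) * \<phi> t"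
  proof (cases "t \<le> s")
    case True
    have "exp (c * s) * (exp (- c * s) * \<phi> s) \<le> exp (c * s) * (exp (-c * t) * \<phi> t)"
      using mono[of 1 t s] True s t by simp
    then show ?thesis using True by (simp add: exp_diff exp_minus field_simps)
  next
    case False
    have "exp (- c * s) * (exp (c * s) * \<phi> s) \<le> exp (- c * s) * (exp (c * t) * \<phi> t)"
      using mono[of "-1" t s] False s t by simp
    then show ?thesis using False by (simp add: exp_diff exp_minus field_simps)
  qed
  also have "\<phi> t \<le> (norm (y t) + M)\<^sup>2"
    using M by (simp add: \<phi>_def dot_square_norm power2_sum)
  also have "exp (c * \<bar>s - t\<bar>) = (exp (c * \<bar>s-t\<bar> / 2))\<^sup>2"
    by (simp add: exp_double[symmetric])
  finally have "\<phi> s \<le> (exp (c * \<bar>s-t\<bar> / 2) * (norm (y t) + M))\<^sup>2"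
    by (simp add: power_mult_distrib)
  moreover have "(norm (y s))\<^sup>2 \<le> \<phi> s" by (simp add: \<phi>_def dot_square_norm)
  ultimately have "(norm (y s))\<^sup>2 \<le> (exp (c * \<bar>s-t\<bar> / 2) * (norm (y t) + M))\<^sup>2" by linarith
  then show ?thesis unfolding c_def by (rule power2_le_imp_le) (use M in auto)
qed

text \<open>The square of the largest component is maximal at \<open>t\<close>. If \<open>i\<close>
  is contracting and \<open>t\<close> is not \<open>a\<close>, times just before \<open>t\<close>
  are available, and a negative derivative of the square would give larger values there; for
  expanding \<open>i\<close> the same holds just after \<open>t\<close>. Only the end that carries
  the data of component \<open>i\<close> escapes the sign condition; the opposite end behaves like
  an interior point.\<close>

lemma global_max_sign:
  fixes y y' :: "'n::finite \<Rightarrow> real \<Rightarrow> real" and st :: "'n \<Rightarrow> bool"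
  assumes ab: "a \<le> b"
    and der: "\<And>i t. t \<in> {a..b} \<Longrightarrow> (y i has_real_derivative y' i t) (at t within {a..b})"
  obtains i t where "t \<in> {a..b}" "\<And>j s. s \<in> {a..b} \<Longrightarrow> \<bar>y j s\<bar> \<le> \<bar>y i t\<bar>"
    "t = (if st i then a else b) \<or> 0 \<le> (if st i then 1 else -1) * (y i t * y' i t)"
proof -
  have cont: "continuous_on {a..b} (\<lambda>t. \<bar>y j t\<bar>)" for j
    using DERIV_continuous_on[OF der] by (intro continuous_intros)
  have "\<exists>t\<in>{a..b}. \<forall>s\<in>{a..b}. \<bar>y j s\<bar> \<le> \<bar>y j t\<bar>" for j
    using continuous_attains_sup[OF _ _ cont] ab by auto
  then obtain T where T: "\<And>j. T j \<in> {a..b}" "\<And>j s. s \<in> {a..b} \<Longrightarrow> \<bar>y j s\<bar> \<le> \<bar>y j (T j)\<bar>" by metis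
  let ?V = "range (\<lambda>j. \<bar>y j (T j)\<bar>)"
  have "Max ?V \<in> ?V" by (intro Max_in) auto
  then obtain i where i: "Max ?V = \<bar>y i (T i)\<bar>" by (rule rangeE)
  have mx: "\<bar>y j s\<bar> \<le> \<bar>y i (T i)\<bar>" if "s \<in> {a..b}" for j s
    using T(2)[OF that, of j] Max_ge[of ?V "\<bar>y j (T j)\<bar>"] i by auto
  let ?t = "T i" and ?\<sigma> = "if st i then 1 else (-1::real)"
  have "0 \<le> ?\<sigma> * (y i ?t * y' i ?t)" if ne: "?t \<noteq> (if st i then a else b)"
  proof (rule ccontr)
    assume neg: "\<not> ?thesis"
    define f where "f s = ?\<sigma> * (y i s)\<^sup>2" for s
    have D: "(f has_real_derivative ?\<sigma> * (2 * (y i ?t * y' i ?t))) (at ?t within {a..b})"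
      unfolding f_def using der[OF T(1)[of i], of i] by (auto intro!: derivative_eq_intros simp: power2_eq_square)
    have neg': "?\<sigma> * (2 * (y i ?t * y' i ?t)) < 0" using neg by auto
    have le: "(y i s)\<^sup>2 \<le> (y i ?t)\<^sup>2" if "s \<in> {a..b}" for s
      using mx[OF that, of i] by (simp add: abs_le_square_iff)
    show False
    proof (cases "st i")
      case True
      obtain d where d: "d > 0" "\<And>h. 0 < h \<Longrightarrow> ?t - h \<in> {a..b} \<Longrightarrow> h < d \<Longrightarrow> f ?t < f (?t - h)"
        using has_real_derivative_neg_dec_left[OF D neg'] by auto
      define h where "h = min (d/2) (?t - a)"
      have "0 < h" "?t - h \<in> {a..b}" "h < d" using d T(1)[of i] ne True by (auto simp: h_def min_def)
      from d(2)[OF this] le[OF this(2)] True show False by (simp add: f_def)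
    next
      case False
      obtain d where d: "d > 0" "\<And>h. 0 < h \<Longrightarrow> ?t + h \<in> {a..b} \<Longrightarrow> h < d \<Longrightarrow> f ?t > f (?t + h)"
        using has_real_derivative_neg_dec_right[OF D neg'] by auto
      define h where "h = min (d/2) (b - ?t)"
      have "0 < h" "?t + h \<in> {a..b}" "h < d" using d T(1)[of i] ne False by (auto simp: h_def min_def)
      from d(2)[OF this] le[OF this(2)] False show False by (simp add: f_def)
    qed
  qed
  then show thesis using that[OF T(1)[of i] mx] by blast
qed


text \<open>Integrals live on compact intervals, so a primitive on the whole line is glued from
  integrals that start at \<open>-T\<close> and are normalised at 0. The normalisation makes the
  value at \<open>r\<close> independent of \<open>T\<close> once \<open>T\<close> is at least
  \<open>\<bar>r\<bar>\<close>, hence the pieces agree.\<close>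

lemma antiderivative_on_UNIV:
  fixes c :: "real \<Rightarrow> 'a::euclidean_space"
  assumes "continuous_on UNIV c"
  obtains P where "P 0 = 0" "\<And>s. (P has_vector_derivative c s) (at s)"
proof -
  define Q where "Q T r = integral {-T..r} c - integral {-T..0} c" for T r
  have int: "c integrable_on {p..q}" for p q
    using assms by (intro integrable_continuous_real continuous_on_subset[OF assms]) auto
  have Q: "Q T r = Q S r" if "-S \<le> r" "0 \<le> S" "S \<le> T" for S T r
  proof -
    have "integral {-T..-S} c + integral {-S..r} c = integral {-T..r} c"
         "integral {-T..-S} c + integral {-S..0} c = integral {-T..0} c"
      using that by (auto intro!: Henstock_Kurzweil_Integration.integral_combine int)
    then show ?thesis unfolding Q_def by (metis add_diff_cancel_left)
  qed
  define P where "P r = Q (\<bar>r\<bar> + 1) r" for r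
  have "(P has_vector_derivative c s) (at s)" for s
  proof -
    define T where "T = \<bar>s\<bar> + 1"
    have "((\<lambda>r. integral {-T..r} c) has_vector_derivative c s) (at s within {-T..T})"
      using assms by (intro integral_has_vector_derivative continuous_on_subset[OF assms]) (auto simp: T_def)
    then have "(Q T has_vector_derivative c s) (at s within {-T..T})"
      unfolding Q_def has_vector_derivative_def by (auto intro!: derivative_eq_intros)
    then have *: "(Q T has_vector_derivative c s) (at s)"
      by (subst (asm) at_within_Icc_at) (auto simp: T_def)
    show ?thesis
    proof (rule has_vector_derivative_transform_within_open[OF *])
      show "open {-T<..<T}" "s \<in> {-T<..<T}" by (auto simp: T_def)
      fix r assume r: "r \<in> {-T<..<T}"
      then have "Q T r = Q \<bar>r\<bar> r" "Q (\<bar>r\<bar> + 1) r = Q \<bar>r\<bar> r" by (intro Q; auto)+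
      then show "Q T r = P r" by (simp add: P_def)
    qed
  qed
  moreover have "P 0 = 0" by (simp add: P_def Q_def)
  ultimately show thesis using that by blast
qed

text \<open>Integrating the weight \<open>exp (K * \<bar>s\<bar>)\<close> gains a factor
  \<open>1 / K\<close>. With \<open>K = 2 * L\<close> the Picard map of an
  \<open>L\<close>-Lipschitz field therefore halves weighted distances, on time intervals of any
  length.\<close>

lemma exp_weighted_bound:
  fixes y y' :: "real \<Rightarrow> 'a::real_normed_vector"
  assumes der: "\<And>s. (y has_vector_derivative y' s) (at s)"
    and bd: "\<And>s. \<bar>s\<bar> \<le> T \<Longrightarrow> norm (y' s) \<le> C * exp (K * \<bar>s\<bar>)"
    and y0: "y 0 = 0" and K: "K > 0" and C: "C \<ge> 0" and s: "\<bar>s\<bar> \<le> T"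
  shows "norm (y s) \<le> C / K * exp (K * \<bar>s\<bar>)"
proof -
  have cont: "continuous_on S y" for S
    by (meson continuous_at_imp_continuous_on der has_vector_derivative_continuous)
  have "norm (y s) \<le> C / K * exp (K * \<bar>s\<bar>) - C / K"
  proof (cases s "0::real" rule: linorder_cases)
    case greater
    have "norm (y s - y 0) \<le> C / K * exp (K * s) - C / K * exp (K * 0)"
    proof (rule differentiable_bound_general[OF greater cont, where \<phi>="\<lambda>s. C / K * exp (K * s)"])
      show "((\<lambda>s. C / K * exp (K * s)) has_vector_derivative C * exp (K * x)) (at x)" for x
        using K by (auto intro!: derivative_eq_intros simp: has_real_derivative_iff_has_vector_derivative[symmetric])
      show "norm (y' x) \<le> C * exp (K * x)" if "0 < x" "x < s" for x
        using bd[of x] that s by auto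
    qed (use der K in \<open>auto intro!: continuous_intros\<close>)
    then show ?thesis using y0 greater by simp
  next
    case less
    have "norm (y 0 - y s) \<le> - (C / K * exp (-K * 0)) - (- (C / K * exp (- K * s)))"
    proof (rule differentiable_bound_general[OF less cont, where \<phi>="\<lambda>s. - (C / K * exp (- K * s))"])
      show "((\<lambda>s. - (C / K * exp (- K * s))) has_vector_derivative C * exp (- K * x)) (at x)" for x
        using K by (auto intro!: derivative_eq_intros simp: has_real_derivative_iff_has_vector_derivative[symmetric])
      show "norm (y' x) \<le> C * exp (- K * x)" if "s < x" "x < 0" for x
        using bd[of x] that s by auto
    qed (use der K in \<open>auto intro!: continuous_intros\<close>)
    then show ?thesis using y0 less by simp
  qed (use y0 in simp)
  moreover have "C / K \<ge> 0" using K C by simp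
  ultimately show ?thesis by linarith
qed

text \<open>The weighted increments of the Picard iterates shrink by one half per step, so they are
  summable on every compact time interval at once and local solutions need not be continued.\<close>

theorem picard_global:
  fixes F :: "real \<Rightarrow> 'a::euclidean_space \<Rightarrow> 'a"
  assumes cont: "continuous_on UNIV (\<lambda>(s, y). F s y)"
    and lip: "\<And>s y z. norm (F s y - F s z) \<le> L * norm (y - z)" and L: "L > 0"
  shows "\<exists>y. y 0 = z \<and> (\<forall>s. (y has_vector_derivative F s (y s)) (at s))"
proof -
  have contF: "continuous_on UNIV (\<lambda>s. F s (y s))" if "continuous_on UNIV y" for y
    using continuous_on_compose2[OF cont, of UNIV "\<lambda>s. (s, y s)"] 
      continuous_on_Pair[OF continuous_on_id that] by simp
  define N where "N y = (SOME w. w 0 = z \<and> (\<forall>s. (w has_vector_derivative F s (y s)) (at s)))" for y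
  have N: "N y 0 = z" "(N y has_vector_derivative F s (y s)) (at s)" if cy: "continuous_on UNIV y" for y s
  proof -
    obtain P where P: "P 0 = 0" "\<And>s. (P has_vector_derivative F s (y s)) (at s)"
      using antiderivative_on_UNIV[OF contF[OF cy]] by metis
    have "\<exists>w. w 0 = z \<and> (\<forall>s. (w has_vector_derivative F s (y s)) (at s))"
      by (rule exI[of _ "\<lambda>s. z + P s"]) (use P in \<open>auto simp: has_vector_derivative_def intro!: derivative_eq_intros\<close>)
    from someI_ex[OF this] show "N y 0 = z" "(N y has_vector_derivative F s (y s)) (at s)"
      unfolding N_def by auto
  qed
  define Y where "Y n = (N ^^ n) (\<lambda>_. z)" for n
  have Y0: "Y 0 = (\<lambda>_. z)" and YS: "Y (Suc n) = N (Y n)" for n by (auto simp: Y_def)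
  have contY: "continuous_on UNIV (Y n)" for n
  proof (induction n)
    case (Suc n)
    then show ?case unfolding YS
      by (meson N(2) continuous_at_imp_continuous_on has_vector_derivative_continuous)
  qed (simp add: Y0)
  note YD = N(2)[OF contY, folded YS] and YI = N(1)[OF contY, folded YS]
  have diff: "\<exists>C\<ge>0. \<forall>n s. \<bar>s\<bar> \<le> T \<longrightarrow> norm (Y (Suc n) s - Y n s) \<le> C * (1/2)^n * exp (2*L * \<bar>s\<bar>)" for T
  proof -
    have "compact ((\<lambda>s. Y 1 s - Y 0 s) ` {-T..T})"
      by (intro compact_continuous_image continuous_intros continuous_on_subset[OF contY]) auto
    then obtain C where C: "\<And>s. s \<in> {-T..T} \<Longrightarrow> norm (Y 1 s - Y 0 s) \<le> C"
      unfolding bounded_iff by (metis (no_types, lifting) compact_imp_bounded bounded_iff image_eqI)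
    define C' where "C' = max C 0"
    have "norm (Y (Suc n) s - Y n s) \<le> C' * (1/2)^n * exp (2*L * \<bar>s\<bar>)" if "\<bar>s\<bar> \<le> T" for n s
      using that
    proof (induction n arbitrary: s)
      case 0
      have "norm (Y 1 s - Y 0 s) \<le> C'" using C[of s] 0 by (simp add: C'_def abs_le_iff minus_le_iff max.coboundedI1)
      also have "\<dots> \<le> C' * exp (2*L*\<bar>s\<bar>)" using L by (simp add: C'_def mult_le_cancel_left1)
      finally show ?case by simp
    next
      case (Suc n)
      have "norm (Y (Suc (Suc n)) s - Y (Suc n) s) \<le> (L * (C' * (1/2)^n)) / (2*L) * exp (2*L * \<bar>s\<bar>)"
      proof (rule exp_weighted_bound[where T=T])
        show "((\<lambda>s. Y (Suc (Suc n)) s - Y (Suc n) s) has_vector_derivative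
            F r (Y (Suc n) r) - F r (Y n r)) (at r)" for r
          by (intro has_vector_derivative_diff YD)
        show "norm (F r (Y (Suc n) r) - F r (Y n r)) \<le> L * (C' * (1/2)^n) * exp (2*L * \<bar>r\<bar>)"
          if "\<bar>r\<bar> \<le> T" for r
          using order_trans[OF lip mult_left_mono[OF Suc.IH[OF that]]] L by (auto simp: algebra_simps)
      qed (use L Suc.prems in \<open>auto simp: YI C'_def\<close>)
      then show ?case using L by simp
    qed
    then show ?thesis by (intro exI[of _ C']) (auto simp: C'_def)
  qed
  define y where "y s = lim (\<lambda>n. Y n s)" for s
  have unif: "uniform_limit {-T..T} Y y sequentially" for T
  proof -
    obtain C where C: "C \<ge> 0" "\<And>n s. \<bar>s\<bar> \<le> T \<Longrightarrow> norm (Y (Suc n) s - Y n s) \<le> C * (1/2)^n * exp (2*L * \<bar>s\<bar>)"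
      using diff by metis
    have "uniformly_convergent_on {-T..T} (\<lambda>n s. \<Sum>i<n. Y (Suc i) s - Y i s)"
    proof (rule Weierstrass_m_test'[where M="\<lambda>n. C * exp (2*L*T) * (1/2)^n"])
      fix n s assume "s \<in> {-T..T}"
      then have "\<bar>s\<bar> \<le> T" by auto
      then show "norm (Y (Suc n) s - Y n s) \<le> C * exp (2*L*T) * (1/2)^n"
        using L by (intro order_trans[OF C(2)]) (auto simp: mult_ac intro!: mult_left_mono C(1))
    qed (auto intro!: summable_mult summable_geometric)
    then obtain l where l: "uniform_limit {-T..T} (\<lambda>n s. \<Sum>i<n. Y (Suc i) s - Y i s) l sequentially"
      by (auto simp: uniformly_convergent_on_def)
    have "uniform_limit {-T..T} (\<lambda>n s. z + (\<Sum>i<n. Y (Suc i) s - Y i s)) (\<lambda>s. z + l s) sequentially"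
      by (intro uniform_limit_intros l)
    moreover have "z + (\<Sum>i<n. Y (Suc i) s - Y i s) = Y n s" for n s
      by (subst sum_lessThan_telescope) (simp add: Y0)
    ultimately have u: "uniform_limit {-T..T} Y (\<lambda>s. z + l s) sequentially" by simp
    then have "z + l s = y s" if "s \<in> {-T..T}" for s
      using tendsto_uniform_limitI[OF u that] by (simp add: y_def limI)
    then show ?thesis using u by (subst uniform_limit_cong'[of _ _ Y _ "\<lambda>s. z + l s"]) auto
  qed
  have "(y has_vector_derivative F s (y s)) (at s)" for s
  proof -
    define T where "T = \<bar>s\<bar> + 1"
    \<comment> \<open>The Lipschitz condition turns uniform convergence of the iterates into uniform
      convergence of their derivatives, so the limit may be differentiated termwise.\<close>
    have "\<exists>g. \<forall>x\<in>{-T..T}. (\<lambda>n. Y (Suc n) x) \<longlonglongrightarrow> g x \<and>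
        (g has_derivative (\<lambda>h. h *\<^sub>R F x (y x))) (at x within {-T..T})"
    proof (rule has_derivative_sequence[where ?x0.0=0 and l=z])
      show "(Y (Suc n) has_derivative (\<lambda>h. h *\<^sub>R F x (Y n x))) (at x within {-T..T})" for n x
        using YD[of n x] unfolding has_vector_derivative_def by (rule has_derivative_at_withinI)
      fix e :: real assume e: "e > 0"
      have "\<forall>\<^sub>F n in sequentially. \<forall>x\<in>{-T..T}. dist (Y n x) (y x) < e / L"
        using unif[of T] e L by (auto simp: uniform_limit_iff)
      then show "\<forall>\<^sub>F n in sequentially. \<forall>x\<in>{-T..T}. \<forall>h. norm (h *\<^sub>R F x (Y n x) - h *\<^sub>R F x (y x)) \<le> e * norm h"
      proof eventually_elim
        case (elim n)
        have "norm (F x (Y n x) - F x (y x)) \<le> e" if "x \<in> {-T..T}" for x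
          using lip[of x "Y n x" "y x"] elim[rule_format, OF that] L
          by (auto simp: dist_norm field_simps)
        then show ?case
          by (auto simp: scaleR_diff_right[symmetric] mult.commute[of e] intro!: mult_left_mono)
      qed
    qed (use YI in \<open>auto simp: T_def\<close>)
    then obtain g where g: "\<And>x. x \<in> {-T..T} \<Longrightarrow> (\<lambda>n. Y (Suc n) x) \<longlonglongrightarrow> g x"
       "\<And>x. x \<in> {-T..T} \<Longrightarrow> (g has_derivative (\<lambda>h. h *\<^sub>R F x (y x))) (at x within {-T..T})" by blast
    have gy: "g x = y x" if "x \<in> {-T..T}" for x
      using LIMSEQ_Suc[OF tendsto_uniform_limitI[OF unif that]] g(1)[OF that] LIMSEQ_unique by blast
    have sT: "s \<in> {-T..T}" by (auto simp: T_def)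
    have "(y has_vector_derivative F s (y s)) (at s within {-T..T})"
      using has_derivative_transform[OF sT gy[symmetric] g(2)[OF sT]] by (simp add: has_vector_derivative_def)
    then show ?thesis by (subst (asm) at_within_Icc_at) (auto simp: T_def)
  qed
  moreover have "y 0 = z"
  proof -
    have "(\<lambda>n. Y (Suc n) 0) \<longlonglongrightarrow> y 0"
      using LIMSEQ_Suc[OF tendsto_uniform_limitI[OF unif[of 1], of 0]] by simp
    then show ?thesis by (simp add: YI LIMSEQ_const_iff)
  qed
  ultimately show ?thesis by blast
qed


section \<open>Flows of globally Lipschitz fields and their derivatives in the initial value\<close>

lemma uniformly_continuous_near_compact:
  fixes g :: "'a::euclidean_space \<Rightarrow> 'b::metric_space"
  assumes "continuous_on UNIV g" "compact K" "e > 0"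
  obtains d where "d > 0" "\<And>k y. k \<in> K \<Longrightarrow> norm (y - k) < d \<Longrightarrow> dist (g y) (g k) < e"
proof -
  \<comment> \<open>The closed unit neighbourhood of \<open>K\<close> is compact as well, so uniform
    continuity on it also reaches points \<open>y\<close> off \<open>K\<close>.\<close>
  define K' where "K' = {x + y | x y. x \<in> K \<and> y \<in> cball 0 1}"
  have "compact K'" unfolding K'_def by (intro compact_sums assms(2) compact_cball)
  then have "uniformly_continuous_on K' g"
    by (intro compact_uniformly_continuous continuous_on_subset[OF assms(1)]) auto
  then obtain d where d: "d > 0" "\<And>x y. x \<in> K' \<Longrightarrow> y \<in> K' \<Longrightarrow> dist y x < d \<Longrightarrow> dist (g y) (g x) < e"
    using assms(3) unfolding uniformly_continuous_on_def by blast
  show thesis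
  proof (rule that[of "min d 1"])
    fix k y assume ky: "k \<in> K" "norm (y - k) < min d 1"
    have "\<exists>x w. k + v = x + w \<and> x \<in> K \<and> w \<in> cball 0 1" if "norm v \<le> 1" for v
      using ky that by (intro exI[of _ k] exI[of _ v]) simp
    from this[of 0] this[of "y - k"] have "k \<in> K'" "y \<in> K'" using ky by (auto simp: K'_def)
    then show "dist (g y) (g k) < e" using d(2)[of k y] ky by (auto simp: dist_norm)
  qed (use d in auto)
qed

lemma has_derivative_norm_le_lipschitz:
  fixes f :: "'a::real_normed_vector \<Rightarrow> 'b::real_normed_vector"
  assumes der: "(f has_derivative D) (at z)"
    and lip: "\<And>y. norm (f y - f z) \<le> L * norm (y - z)"
  shows "norm (D v) \<le> L * norm v"
proof -
  interpret bounded_linear D using der by (rule has_derivative_bounded_linear)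
  have "norm (D v) \<le> L * norm v + e" if e: "e > 0" for e
  proof (cases "v = 0")
    case False
    then have nv: "norm v > 0" by simp
    obtain d where d: "d > 0" "\<And>y. norm (y - z) < d \<Longrightarrow> norm (f y - f z - D (y - z)) \<le> e / norm v * norm (y - z)"
      using der e nv unfolding has_derivative_at_alt by (metis divide_pos_pos)
    define h where "h = d / 2 / norm v"
    have h: "h > 0" "h * norm v < d" using d nv by (auto simp: h_def)
    have "norm (D (h *\<^sub>R v)) \<le> norm (f (z + h *\<^sub>R v) - f z) + norm (f (z + h *\<^sub>R v) - f z - D (h *\<^sub>R v))"
      by (metis norm_triangle_sub norm_minus_commute)
    also have "\<dots> \<le> L * (h * norm v) + e / norm v * (h * norm v)"
      using lip[of "z + h *\<^sub>R v"] d(2)[of "z + h *\<^sub>R v"] h by (intro add_mono) auto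
    finally have "h * norm (D v) \<le> h * (L * norm v + e)"
      using h nv by (simp add: scaleR algebra_simps)
    then show ?thesis using h by simp
  qed (use e in \<open>simp add: zero\<close>)
  then show ?thesis by (rule field_le_epsilon)
qed

lemma abs_interval_mem: "s \<in> {-\<bar>s\<bar>..\<bar>s\<bar>}" "0 \<in> {-\<bar>s\<bar>..\<bar>s\<bar>}" for s :: real
  by (auto simp: abs_if)

lemma has_vector_derivative_imp_continuous_on:
  assumes "\<And>s. s \<in> S \<Longrightarrow> (y has_vector_derivative y' s) (at s within S)"
  shows "continuous_on S y"
  using assms by (meson continuous_on_eq_continuous_within has_vector_derivative_continuous)

text \<open>The derivative is a \<open>blinfun\<close>-valued map, so that its continuity refers to
  the operator norm, as the linearisation error along an orbit requires.\<close>

locale c1_flow =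
  fixes f :: "'a::euclidean_space \<Rightarrow> 'a" and f' :: "'a \<Rightarrow> 'a \<Rightarrow>\<^sub>L 'a" and L :: real
  assumes lip: "\<And>y z. norm (f y - f z) \<le> L * norm (y - z)" and L: "L > 0"
    and der: "\<And>z. (f has_derivative blinfun_apply (f' z)) (at z)"
    and cont: "continuous_on UNIV f'"
begin

lemma f'_le: "norm (f' z v) \<le> L * norm v"
  by (rule has_derivative_norm_le_lipschitz[OF der lip])

lemma cont_f: "continuous_on S f"
  by (meson continuous_at_imp_continuous_on der has_derivative_continuous)

definition fl :: "real \<Rightarrow> 'a \<Rightarrow> 'a" where
  "fl s z = (SOME y. y 0 = z \<and> (\<forall>s. (y has_vector_derivative f (y s)) (at s))) s"

lemma fl_0 [simp]: "fl 0 z = z"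
  and fl_D: "((\<lambda>s. fl s z) has_vector_derivative f (fl s z)) (at s within S)"
proof -
  have "continuous_on UNIV (\<lambda>(s::real, y). f y)"
    unfolding case_prod_unfold by (intro continuous_on_compose2[OF cont_f[of UNIV]] continuous_intros) auto
  then have "\<exists>y. y 0 = z \<and> (\<forall>s. (y has_vector_derivative f (y s)) (at s))"
    by (rule picard_global) (use lip L in auto)
  from someI_ex[OF this] show "fl 0 z = z" "((\<lambda>s. fl s z) has_vector_derivative f (fl s z)) (at s within S)"
    unfolding fl_def by (auto intro: has_vector_derivative_at_within)
qed

lemma cont_fl_time: "continuous_on S (\<lambda>s. fl s z)"
  by (rule has_vector_derivative_imp_continuous_on) (rule fl_D)

lemma sol_close:
  assumes y: "\<And>s. s \<in> {a..b} \<Longrightarrow> (y has_vector_derivative f (y s)) (at s within {a..b})"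
    and w: "\<And>s. s \<in> {a..b} \<Longrightarrow> (w has_vector_derivative f (w s)) (at s within {a..b})"
    and st: "s \<in> {a..b}" "t \<in> {a..b}"
  shows "norm (y s - w s) \<le> exp ((2*L+1) * \<bar>s - t\<bar> / 2) * norm (y t - w t)"
  using gronwall_two_sided[of a b "\<lambda>s. y s - w s" "\<lambda>s. f (y s) - f (w s)" L 0 s t]
    y w st lip L by (auto intro!: has_vector_derivative_diff)

lemma sol_unique:
  assumes y: "\<And>s. s \<in> {a..b} \<Longrightarrow> (y has_vector_derivative f (y s)) (at s within {a..b})"
    and w: "\<And>s. s \<in> {a..b} \<Longrightarrow> (w has_vector_derivative f (w s)) (at s within {a..b})"
    and st: "s \<in> {a..b}" "t \<in> {a..b}" and eq: "y t = w t"
  shows "y s = w s"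
  using sol_close[OF y w st] eq by simp

lemma fl_shift_D: "((\<lambda>s. fl (s - t) z) has_vector_derivative f (fl (s - t) z)) (at s within S)"
proof -
  have "((\<lambda>s. s - t) has_vector_derivative 1) (at s within S)"
    by (auto intro!: derivative_eq_intros simp: has_vector_derivative_def)
  then show ?thesis
    using vector_diff_chain_within[of "\<lambda>s. s - t" 1 s S "\<lambda>s. fl s z", OF _ fl_D] by (simp add: o_def)
qed

lemma sol_eq_fl:
  assumes y: "\<And>s. s \<in> {a..b} \<Longrightarrow> (y has_vector_derivative f (y s)) (at s within {a..b})"
    and st: "s \<in> {a..b}" "t \<in> {a..b}"
  shows "y s = fl (s - t) (y t)"
  by (rule sol_unique[OF y fl_shift_D st]) auto

lemma fl_add: "fl s (fl t z) = fl (s + t) z"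
  using sol_eq_fl[of "min t (s + t)" "max t (s + t)" "\<lambda>s. fl s z" "s + t" t] fl_D by auto

text \<open>Solution of the variational equation along the orbit of \<open>z\<close>. It is linear
  with coefficients of norm at most \<open>L\<close>, so \<open>picard_global\<close> applies
  although it depends on time.\<close>

definition W0 :: "'a \<Rightarrow> 'a \<Rightarrow> real \<Rightarrow> 'a" where
  "W0 z v = (SOME w. w 0 = v \<and> (\<forall>s. (w has_vector_derivative f' (fl s z) (w s)) (at s)))"

lemma W0_0 [simp]: "W0 z v 0 = v"
  and W0_D: "(W0 z v has_vector_derivative f' (fl s z) (W0 z v s)) (at s within S)"
proof -
  have "continuous_on UNIV (\<lambda>s. f' (fl s z))"
    by (rule continuous_on_compose2[OF cont cont_fl_time]) auto
  then have "continuous_on UNIV (\<lambda>(s, y). blinfun_apply (f' (fl s z)) y)"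
    unfolding case_prod_unfold
    by (intro continuous_intros continuous_on_compose2[of UNIV "\<lambda>s. f' (fl s z)" UNIV fst]) auto
  then have "\<exists>w. w 0 = v \<and> (\<forall>s. (w has_vector_derivative f' (fl s z) (w s)) (at s))"
    by (rule picard_global) (use f'_le L in \<open>auto simp: blinfun.diff_right[symmetric]\<close>)
  from someI_ex[OF this] show "W0 z v 0 = v" "(W0 z v has_vector_derivative f' (fl s z) (W0 z v s)) (at s within S)"
    unfolding W0_def by (auto intro: has_vector_derivative_at_within)
qed

lemma f'_diff_le: "norm (f' z v - f' z w) \<le> L * norm (v - w)"
  using f'_le[of z "v - w"] by (simp add: blinfun.diff_right)

lemma W0_unique:
  assumes w: "\<And>s. (w has_vector_derivative f' (fl s z) (w s)) (at s)"
  shows "w s = W0 z (w 0) s"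
proof -
  have "norm (w s - W0 z (w 0) s) \<le> exp ((2*L+1) * \<bar>s - 0\<bar> / 2) * (norm (w 0 - W0 z (w 0) 0) + 0)"
    by (rule gronwall_two_sided[where a="-\<bar>s\<bar>" and b="\<bar>s\<bar>"
           and y'="\<lambda>s. f' (fl s z) (w s) - f' (fl s z) (W0 z (w 0) s)" and L=L])
       (use L f'_diff_le abs_interval_mem[of s] in \<open>auto intro: has_vector_derivative_diff W0_D has_vector_derivative_at_within[OF w]
          \<close>)
  then show ?thesis by simp
qed

lemma W0_le: "norm (W0 z v s) \<le> exp ((2*L+1) * \<bar>s\<bar> / 2) * norm v"
proof -
  have "norm (W0 z v s) \<le> exp ((2*L+1) * \<bar>s - 0\<bar> / 2) * (norm (W0 z v 0) + 0)"
    by (rule gronwall_two_sided[where a="-\<bar>s\<bar>" and b="\<bar>s\<bar>", OF W0_D])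
       (use f'_le L abs_interval_mem[of s] in auto)
  then show ?thesis by simp
qed

lemma W0_linear: "bounded_linear (\<lambda>v. W0 z v s)"
proof (rule bounded_linear_intro)
  show "W0 z (u + v) s = W0 z u s + W0 z v s" for u v
    by (rule W0_unique[of "\<lambda>s. W0 z u s + W0 z v s" z s, unfolded W0_0, symmetric])
       (auto simp: blinfun.add_right intro!: has_vector_derivative_add W0_D)
  show "W0 z (r *\<^sub>R v) s = r *\<^sub>R W0 z v s" for r v
    by (rule W0_unique[of "\<lambda>s. r *\<^sub>R W0 z v s" z s, unfolded W0_0, symmetric])
       (auto simp: blinfun.scaleR_right intro!: bounded_linear.has_vector_derivative[OF bounded_linear_scaleR_right W0_D])
  show "norm (W0 z v s) \<le> norm v * exp ((2*L+1) * \<bar>s\<bar> / 2)" for v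
    using W0_le by (simp add: mult.commute)
qed

definition W :: "real \<Rightarrow> 'a \<Rightarrow> 'a \<Rightarrow>\<^sub>L 'a" where "W s z = Blinfun (\<lambda>v. W0 z v s)"

lemma W_apply: "W s z v = W0 z v s"
  by (simp add: W_def bounded_linear_Blinfun_apply W0_linear)

lemma fl_close: "norm (fl s y - fl s z) \<le> exp ((2*L+1) * \<bar>s\<bar> / 2) * norm (y - z)"
  using sol_close[of "-\<bar>s\<bar>" "\<bar>s\<bar>" "\<lambda>s. fl s y" "\<lambda>s. fl s z" s 0, OF fl_D fl_D abs_interval_mem] by simp

lemma compact_orbit: "compact ((\<lambda>s. fl s z) ` {-T..T})"
  by (intro compact_continuous_image cont_fl_time) simp

lemma orbit_nearby:
  assumes "d > 0"
  obtains d' where "d' > 0" "\<And>s y. \<bar>s\<bar> \<le> T \<Longrightarrow> norm (y - z) < d' \<Longrightarrow> norm (fl s y - fl s z) < d"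
proof (rule that[of "d / exp ((2*L+1) * \<bar>T\<bar> / 2)"])
  fix s y assume s: "\<bar>s\<bar> \<le> T" and y: "norm (y - z) < d / exp ((2*L+1) * \<bar>T\<bar> / 2)"
  have "norm (fl s y - fl s z) \<le> exp ((2*L+1) * \<bar>s\<bar> / 2) * norm (y - z)" by (rule fl_close)
  also have "\<dots> \<le> exp ((2*L+1) * \<bar>T\<bar> / 2) * norm (y - z)"
    using s L by (intro mult_right_mono) (auto intro!: mult_left_mono)
  also have "\<dots> < d" using y by (simp add: field_simps)
  finally show "norm (fl s y - fl s z) < d" .
qed (use assms in simp)

lemma fl_has_derivative: "(fl s has_derivative blinfun_apply (W s z)) (at z)"
proof -
  define T where "T = \<bar>s\<bar>"
  define A where "A = exp ((2*L+1) * T / 2)"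
  have A: "A > 0" by (simp add: A_def)
  have "\<exists>d>0. \<forall>y. norm (y - z) < d \<longrightarrow> norm (fl s y - fl s z - W s z (y - z)) \<le> e * norm (y - z)"
    if e: "e > 0" for e
  proof -
    \<comment> \<open>One factor \<open>A\<close> bounds the separation of the two orbits, the other
      is the Gronwall factor of the linearisation error; dividing by both leaves exactly
      \<open>e\<close>.\<close>
    define e1 where "e1 = e / A / A"
    have e1: "e1 > 0" using e A by (simp add: e1_def)
    obtain d1 where d1: "d1 > 0" "\<And>k y. k \<in> (\<lambda>s. fl s z) ` {-T..T} \<Longrightarrow> norm (y - k) < d1 \<Longrightarrow> dist (f' y) (f' k) < e1"
      using uniformly_continuous_near_compact[OF cont compact_orbit e1] by metis
    obtain d where d: "d > 0" "\<And>s y. \<bar>s\<bar> \<le> T \<Longrightarrow> norm (y - z) < d \<Longrightarrow> norm (fl s y - fl s z) < d1"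
      using orbit_nearby[OF d1(1)] by metis
    have "norm (fl s y - fl s z - W s z (y - z)) \<le> e * norm (y - z)" if y: "norm (y - z) < d" for y
    proof -
      define r where "r t = fl t y - fl t z - W0 z (y - z) t" for t
      define r' where "r' t = f (fl t y) - f (fl t z) - f' (fl t z) (W0 z (y - z) t)" for t
      have "norm (r s) \<le> exp ((2*L+1) * \<bar>s - 0\<bar> / 2) * (norm (r 0) + e1 * (A * norm (y - z)))"
      proof (rule gronwall_two_sided[where a="-T" and b=T and y'=r'])
        show "(r has_vector_derivative r' t) (at t within {-T..T})" for t
          unfolding r_def r'_def by (intro has_vector_derivative_diff fl_D W0_D)
        show "norm (r' t) \<le> L * norm (r t) + e1 * (A * norm (y - z))" if t: "t \<in> {-T..T}" for t
        proof -
          let ?a = "fl t z" and ?b = "fl t y"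
          have ab: "norm (?b - ?a) < d1" using d(2)[of t y] t y by auto
          have "norm (f ?b - f ?a - f' ?a (?b - ?a)) \<le> norm (?b - ?a) * e1"
          proof (rule differentiable_bound_linearization[where S="ball ?a d1" and f'="\<lambda>x. blinfun_apply (f' x)" and ?x0.0="?a"])
            show "?a + u *\<^sub>R (?b - ?a) \<in> ball ?a d1" if "u \<in> {0..1}" for u
              using ab that mult_left_le_one_le[of "norm (?b - ?a)" u] by (auto simp: dist_norm)
            show "(f has_derivative blinfun_apply (f' x)) (at x within ball ?a d1)" for x
              by (rule has_derivative_at_withinI[OF der])
            fix x assume "x \<in> ball ?a d1"
            then have "norm (f' x - f' ?a) \<le> e1"
              using d1(2)[of ?a x] t by (auto simp: dist_norm norm_minus_commute less_imp_le)
            then show "onorm (blinfun_apply (f' x) - blinfun_apply (f' ?a)) \<le> e1"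
              by (simp add: norm_blinfun.rep_eq minus_blinfun.rep_eq fun_diff_def)
          qed (use d1 in auto)
          also have "\<dots> \<le> e1 * (A * norm (y - z))"
          proof -
            have "norm (?b - ?a) \<le> exp ((2*L+1) * \<bar>t\<bar> / 2) * norm (y - z)" by (rule fl_close)
            also have "\<dots> \<le> A * norm (y - z)"
              unfolding A_def using t L by (intro mult_right_mono) (auto intro!: mult_left_mono)
            finally show ?thesis using e1 by (simp add: mult.commute)
          qed
          finally have 1: "norm (f ?b - f ?a - f' ?a (?b - ?a)) \<le> e1 * (A * norm (y - z))" .
          have "r' t = (f ?b - f ?a - f' ?a (?b - ?a)) + f' ?a (r t)"
            by (simp add: r'_def r_def blinfun.bilinear_simps)
          then have "norm (r' t) \<le> norm (f ?b - f ?a - f' ?a (?b - ?a)) + norm (f' ?a (r t))"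
            by (metis norm_triangle_ineq)
          then show ?thesis using 1 f'_le[of ?a "r t"] by linarith
        qed
      qed (use L e1 A in \<open>auto simp: T_def\<close>)
      also have "\<dots> = e * norm (y - z)" using A by (simp add: r_def e1_def A_def T_def)
      finally show ?thesis by (simp add: r_def W_apply)
    qed
    with d show ?thesis by blast
  qed
  then show ?thesis
    unfolding has_derivative_at_alt by (simp add: blinfun.bounded_linear_right)
qed

lemma W_apply_continuous: "continuous_on UNIV (\<lambda>(s, z). W s z v)"
proof (rule continuous_on_iff[THEN iffD2], safe)
  fix s :: real and z and e :: real assume e: "e > 0"
  define T where "T = \<bar>s\<bar> + 1"
  define A where "A = exp ((2*L+1) * T / 2)"
  have A: "A > 0" by (simp add: A_def)
  define e1 where "e1 = e / 4 / A / (A * norm v + 1)"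
  have e1: "e1 > 0" using e A unfolding e1_def by (intro divide_pos_pos) (auto intro: add_nonneg_pos)
  obtain d1 where d1: "d1 > 0" "\<And>k y. k \<in> (\<lambda>s. fl s z) ` {-T..T} \<Longrightarrow> norm (y - k) < d1 \<Longrightarrow> dist (f' y) (f' k) < e1"
    using uniformly_continuous_near_compact[OF cont compact_orbit e1] by metis
  obtain d where d: "d > 0" "\<And>s y. \<bar>s\<bar> \<le> T \<Longrightarrow> norm (y - z) < d \<Longrightarrow> norm (fl s y - fl s z) < d1"
    using orbit_nearby[OF d1(1)] by metis
  have 1: "norm (W0 y v t - W0 z v t) < e/2" if y: "norm (y - z) < d" and t: "\<bar>t\<bar> \<le> T" for y t
  proof -
    have "norm (W0 y v t - W0 z v t) \<le> exp ((2*L+1) * \<bar>t - 0\<bar> / 2) * (norm (W0 y v 0 - W0 z v 0) + e1 * (A * norm v))"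
    proof (rule gronwall_two_sided[where a="-T" and b=T and y'="\<lambda>t. f' (fl t y) (W0 y v t) - f' (fl t z) (W0 z v t)"])
      show "((\<lambda>t. W0 y v t - W0 z v t) has_vector_derivative f' (fl t y) (W0 y v t) - f' (fl t z) (W0 z v t)) (at t within {-T..T})" for t
        by (intro has_vector_derivative_diff W0_D)
      fix t assume t: "t \<in> {-T..T}"
      have "norm (f' (fl t y) - f' (fl t z)) \<le> e1"
        using d1(2)[of "fl t z" "fl t y"] d(2)[of t y] t y by (auto simp: dist_norm less_imp_le)
      moreover have "norm (W0 z v t) \<le> A * norm v"
      proof -
        have "norm (W0 z v t) \<le> exp ((2*L+1) * \<bar>t\<bar> / 2) * norm v" by (rule W0_le)
        also have "\<dots> \<le> A * norm v"
          unfolding A_def using t L by (intro mult_right_mono) (auto intro!: mult_left_mono)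
        finally show ?thesis .
      qed
      ultimately have "norm ((f' (fl t y) - f' (fl t z)) (W0 z v t)) \<le> e1 * (A * norm v)"
        using e1 by (intro order_trans[OF norm_blinfun] mult_mono) auto
      moreover have "f' (fl t y) (W0 y v t) - f' (fl t z) (W0 z v t) =
          f' (fl t y) (W0 y v t - W0 z v t) + (f' (fl t y) - f' (fl t z)) (W0 z v t)"
        by (simp add: blinfun.bilinear_simps)
      ultimately show "norm (f' (fl t y) (W0 y v t) - f' (fl t z) (W0 z v t)) \<le>
          L * norm (W0 y v t - W0 z v t) + e1 * (A * norm v)"
        using f'_le[of "fl t y" "W0 y v t - W0 z v t"] norm_triangle_ineq[of "f' (fl t y) (W0 y v t - W0 z v t)" "(f' (fl t y) - f' (fl t z)) (W0 z v t)"]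
        by (smt (verit))
    qed (use L e1 A t in \<open>auto simp: T_def\<close>)
    also have "\<dots> \<le> A * (e1 * (A * norm v))"
      unfolding A_def using t L e1 by (auto intro!: mult_right_mono mult_left_mono)
    also have "\<dots> \<le> A * (e1 * (A * norm v + 1))" using A e1 by simp
    also have "\<dots> = e / 4"
    proof -
      have "A * norm v + 1 > 0" using A by (intro add_nonneg_pos) auto
      then show ?thesis using A by (simp add: e1_def)
    qed
    finally show ?thesis using e by linarith
  qed
  have "continuous_on UNIV (W0 z v)"
    by (rule has_vector_derivative_imp_continuous_on) (rule W0_D)
  then obtain d2 where d2: "d2 > 0" "\<And>t. dist t s < d2 \<Longrightarrow> dist (W0 z v t) (W0 z v s) < e/2"
    using e by (metis UNIV_I continuous_on_iff half_gt_zero)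
  show "\<exists>d>0. \<forall>x'\<in>UNIV. dist x' (s, z) < d \<longrightarrow> dist (case x' of (s, z) \<Rightarrow> W s z v) (W s z v) < e"
  proof (intro exI[of _ "min (min d d2) 1"] conjI ballI impI)
    fix x' assume x': "dist x' (s, z) < min (min d d2) 1"
    obtain t y where ty: "x' = (t, y)" by (cases x')
    have t: "dist t s < d2" "\<bar>t\<bar> \<le> T" "norm (y - z) < d"
      using x' dist_fst_le[of x' "(s, z)"] dist_snd_le[of x' "(s, z)"] by (auto simp: ty T_def dist_norm)
    have "dist (W0 y v t) (W0 z v s) \<le> dist (W0 y v t) (W0 z v t) + dist (W0 z v t) (W0 z v s)"
      by (rule dist_triangle)
    also have "\<dots> < e" using 1[OF t(3,2)] d2(2)[OF t(1)] by (simp add: dist_norm)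
    finally show "dist (case x' of (s, z) \<Rightarrow> W s z v) (W s z v) < e" by (simp add: ty W_apply)
  qed (use d d2 in auto)
qed

lemma W_continuous: "continuous_on UNIV (\<lambda>(s, z). W s z)"
proof (rule continuous_at_imp_continuous_on, safe)
  fix s z
  show "isCont (\<lambda>(s, z). W s z) (s, z)"
  proof (rule continuous_blinfun_componentwiseI1)
    fix v :: 'a
    show "isCont (\<lambda>x. (case x of (s, z) \<Rightarrow> W s z) v) (s, z)"
      using W_apply_continuous[of v] by (simp add: continuous_on_eq_continuous_at case_prod_unfold)
  qed
qed

text \<open>Continuity of the partial derivative in \<open>z\<close>, jointly in time and point,
  yields the total derivative. It is needed because a boundary slice is reached after a time that
  depends on the initial point.\<close>

lemma fl_has_derivative2:
  "((\<lambda>(s, z). fl s z) has_derivative (\<lambda>(ds, dz). ds *\<^sub>R f (fl s z) + W s z dz)) (at (s, z))"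
  using has_derivative_partialsI[of "\<lambda>s z. fl s z" z "\<lambda>ds. ds *\<^sub>R f (fl s z)" s UNIV UNIV W]
    fl_D[of z s UNIV, unfolded has_vector_derivative_def] fl_has_derivative W_continuous
  by (auto simp: continuous_on_eq_continuous_at)

end


section \<open>Invariant graphs from boundary value problems\<close>

lemma has_derivative_norm_ge_expanding:
  fixes f :: "'a::real_normed_vector \<Rightarrow> 'b::real_normed_vector"
  assumes der: "(f has_derivative D) (at z)"
    and ex: "\<And>y. c * norm (y - z) \<le> norm (f y - f z)"
  shows "c * norm v \<le> norm (D v)"
proof -
  interpret bounded_linear D using der by (rule has_derivative_bounded_linear)
  have "c * norm v \<le> norm (D v) + e" if e: "e > 0" for e
  proof (cases "v = 0")
    case False
    then have nv: "norm v > 0" by simp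
    obtain d where d: "d > 0" "\<And>y. norm (y - z) < d \<Longrightarrow> norm (f y - f z - D (y - z)) \<le> e / norm v * norm (y - z)"
      using der e nv unfolding has_derivative_at_alt by (metis divide_pos_pos)
    define h where "h = d / 2 / norm v"
    have h: "h > 0" "h * norm v < d" using d nv by (auto simp: h_def)
    have "c * (h * norm v) \<le> norm (f (z + h *\<^sub>R v) - f z)" using ex[of "z + h *\<^sub>R v"] h by simp
    also have "\<dots> \<le> norm (D (h *\<^sub>R v)) + norm (f (z + h *\<^sub>R v) - f z - D (h *\<^sub>R v))"
      by (rule norm_triangle_sub)
    also have "\<dots> \<le> norm (D (h *\<^sub>R v)) + e / norm v * (h * norm v)"
      using d(2)[of "z + h *\<^sub>R v"] h by (intro add_mono) auto
    finally have "h * (c * norm v) \<le> h * (norm (D v) + e)"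
      using h nv by (simp add: scaleR algebra_simps)
    then show ?thesis using h by simp
  qed (use e in \<open>simp add: zero\<close>)
  then show ?thesis by (rule field_le_epsilon)
qed

text \<open>The uniform expansion of \<^term>\<open>\<lambda>u. G u x\<close> replaces the
  invertibility of the partial derivative and yields the continuity of the solution.\<close>

lemma implicit_function_expanding:
  fixes G :: "'u::euclidean_space \<Rightarrow> 'x::euclidean_space \<Rightarrow> 'u"
  assumes der: "\<And>u x. ((\<lambda>(u, x). G u x) has_derivative blinfun_apply (G' (u, x))) (at (u, x))"
    and cont: "continuous_on UNIV G'"
    and ex: "\<And>x u v. x \<in> S \<Longrightarrow> c * norm (u - v) \<le> norm (G u x - G v x)" and c: "c > 0"
    and z: "\<And>x. x \<in> S \<Longrightarrow> G (h x) x = 0"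
  obtains h' where "\<And>x. x \<in> S \<Longrightarrow> (h has_derivative h' x) (at x within S)"
    "\<And>v. continuous_on S (\<lambda>x. h' x v)"
proof -
  define D where "D x = G' (h x, x)" for x
  have lower: "c * norm v \<le> norm (D x (v, 0))" if "x \<in> S" for x v
  proof -
    have "((\<lambda>u. (u, x)) has_derivative (\<lambda>v. (v, 0))) (at (h x))" by (auto intro!: derivative_eq_intros)
    then have "((\<lambda>u. (\<lambda>(u, x). G u x) (u, x)) has_derivative (\<lambda>v. G' (h x, x) (v, 0))) (at (h x))"
      by (rule has_derivative_compose) (rule der)
    then have "((\<lambda>u. G u x) has_derivative (\<lambda>v. D x (v, 0))) (at (h x))" by (simp add: D_def)
    then show ?thesis by (rule has_derivative_norm_ge_expanding) (use ex that in auto)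
  qed
  have "\<exists>k. bounded_linear k \<and> (\<forall>w. D x (k w, w) = 0)" if x: "x \<in> S" for x
  proof -
    \<comment> \<open>The lower bound makes the partial derivative in \<open>u\<close> injective,
      hence invertible in finite dimension; \<open>h'\<close> is then the solution of the
      differentiated equation \<open>D x (h' x w, w) = 0\<close>.\<close>
    have lin: "linear (\<lambda>v. D x (v, 0))"
      by (intro linearI) (simp_all flip: blinfun.add_right blinfun.scaleR_right)
    moreover have "inj (\<lambda>v. D x (v, 0))"
      using lower[OF x] c unfolding linear_injective_0[OF lin]
      by (metis mult_le_0_iff norm_le_zero_iff norm_zero not_less)
    ultimately obtain k where k: "linear k" "\<And>v. D x (k v, 0) = v"
      using linear_injective_isomorphism by (metis (no_types, lifting))
    have "linear (\<lambda>w. k (- D x (0, w)))"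
    proof (intro linearI)
      fix u v :: 'x and r :: real
      have "(0, u + v) = ((0::'u), u) + (0, v)" "(0, r *\<^sub>R v) = r *\<^sub>R ((0::'u), v)" by auto
      then show "k (- D x (0, u + v)) = k (- D x (0, u)) + k (- D x (0, v))"
         "k (- D x (0, r *\<^sub>R v)) = r *\<^sub>R k (- D x (0, v))"
        using linear_add[OF k(1)] linear_scale[OF k(1)]
        by (metis blinfun.add_right minus_add_distrib, metis blinfun.scaleR_right scaleR_minus_right)
    qed
    moreover have "D x (k (- D x (0, w)), w) = 0" for w
      using k(2)[of "- D x (0, w)"] blinfun.add_right[of "D x" "(k (- D x (0, w)), 0)" "(0, w)"] by simp
    ultimately show ?thesis by (auto simp: linear_conv_bounded_linear)
  qed
  then obtain h' where h': "\<And>x. x \<in> S \<Longrightarrow> bounded_linear (h' x)"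
     "\<And>x w. x \<in> S \<Longrightarrow> D x (h' x w, w) = 0" by metis
  have contG: "continuous_on UNIV (\<lambda>(u, x). G u x)"
    by (rule continuous_at_imp_continuous_on) (auto intro: has_derivative_continuous[OF der])
  have hcont: "continuous_on S h"
    unfolding continuous_on_iff
  proof safe
    fix x and e :: real assume x: "x \<in> S" and e: "e > 0"
    have "continuous_on UNIV (\<lambda>y. G (h x) y)"
      using continuous_on_compose2[OF contG continuous_on_Pair[OF continuous_on_const continuous_on_id], of "h x"] by simp
    moreover have "c * e > 0" using c e by simp
    ultimately obtain d where d: "d > 0" "\<And>y. dist y x < d \<Longrightarrow> dist (G (h x) y) (G (h x) x) < c * e"
      unfolding continuous_on_iff by blast
    have "dist (h y) (h x) < e" if y: "y \<in> S" "dist y x < d" for y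
    proof -
      have "c * norm (h y - h x) \<le> norm (G (h y) y - G (h x) y)" by (rule ex[OF y(1)])
      also have "\<dots> < c * e" using d(2)[OF y(2)] z[OF y(1)] z[OF x] by (simp add: dist_norm)
      finally show ?thesis using c by (simp add: dist_norm)
    qed
    with d show "\<exists>d>0. \<forall>x'\<in>S. dist x' x < d \<longrightarrow> dist (h x') (h x) < e" by blast
  qed
  have "(h has_derivative h' x) (at x within S)" if x: "x \<in> S" for x
    unfolding has_derivative_within_alt
  proof (intro conjI allI impI)
    show "bounded_linear (h' x)" by (rule h'(1)[OF x])
    fix e :: real assume e: "e > 0"
    obtain H where H: "\<And>w. norm (h' x w) \<le> norm w * H" "H \<ge> 0"
      using bounded_linear.nonneg_bounded[OF h'(1)[OF x]] by blast
    \<comment> \<open>The first entry lets half of \<open>c\<close> absorb the error proportional to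
      \<open>norm w\<close>; the second turns the rest into \<open>e * norm q\<close> after division
      by the remaining half.\<close>
    define e' where "e' = min (c / 2) (e * c / (2 * (1 + H)))"
    have e': "e' > 0" "e' \<le> c / 2" "2 * e' * (1 + H) \<le> e * c"
    proof -
      show "e' > 0" using c e H(2) by (auto simp: e'_def)
      have "e' \<le> e * c / (2 * (1 + H))" by (simp add: e'_def)
      then show "2 * e' * (1 + H) \<le> e * c" using H(2) by (simp add: le_divide_eq mult_ac)
    qed (simp only: e'_def min.cobounded1)
    obtain d where d: "d > 0" "\<And>y. norm (y - (h x, x)) < d \<Longrightarrow>
        norm ((case y of (u, x) \<Rightarrow> G u x) - (case (h x, x) of (u, x) \<Rightarrow> G u x) - G' (h x, x) (y - (h x, x))) \<le> e' * norm (y - (h x, x))"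
      using der[of "h x" x] e'(1) unfolding has_derivative_at_alt by blast
    obtain d1 where d1: "d1 > 0" "\<And>y. y \<in> S \<Longrightarrow> dist y x < d1 \<Longrightarrow> dist (h y) (h x) < d / 2"
      using hcont x d(1) unfolding continuous_on_iff by (metis half_gt_zero)
    show "\<exists>d>0. \<forall>y\<in>S. norm (y - x) < d \<longrightarrow> norm (h y - h x - h' x (y - x)) \<le> e * norm (y - x)"
    proof (intro exI[of _ "min d1 (d/2)"] conjI ballI impI)
      fix y assume y: "y \<in> S" "norm (y - x) < min d1 (d/2)"
      define p q where "p = h y - h x" and "q = y - x"
      define w where "w = p - h' x q"
      have pq: "norm (p, q) \<le> norm p + norm q" by (rule norm_Pair_le)
      have "norm (p, q) < d" using y d1(2)[of y] pq by (auto simp: p_def q_def dist_norm)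
      then have "norm (D x (p, q)) \<le> e' * norm (p, q)"
        using d(2)[of "(h y, y)"] z[OF x] z[OF y(1)] by (simp add: p_def q_def D_def)
      moreover have "D x (p, q) = D x (w, 0)"
        using h'(2)[OF x, of q] blinfun.add_right[of "D x" "(w, 0)" "(h' x q, q)"] by (simp add: w_def)
      ultimately have "c * norm w \<le> e' * norm (p, q)" using lower[OF x, of w] by simp
      also have "\<dots> \<le> e' * (norm p + norm q)" using pq e' by simp
      also have "norm p \<le> norm w + norm (h' x q)" 
          using norm_triangle_ineq[of w "h' x q"] by (simp add: w_def)
      also have "norm (h' x q) \<le> norm q * H" by (rule H(1))
      finally have "c * norm w \<le> e' * norm w + e' * (1 + H) * norm q" using e' by (simp add: algebra_simps)
      moreover have "e' * norm w \<le> c / 2 * norm w" using e'(2) by (rule mult_right_mono) simp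
      moreover have "2 * (e' * (1 + H) * norm q) \<le> e * c * norm q"
        using mult_right_mono[OF e'(3), of "norm q"] by (simp add: mult_ac)
      ultimately have "c * norm w \<le> c * (e * norm q)" by (simp add: field_simps)
      then show "norm (h y - h x - h' x (y - x)) \<le> e * norm (y - x)" using c by (simp add: w_def p_def q_def)
    qed (use d d1 in auto)
  qed
  moreover have "continuous_on S (\<lambda>x. h' x v)" for v
    unfolding continuous_on_iff
  proof safe
    fix x and e :: real assume x: "x \<in> S" and e: "e > 0"
    have "continuous_on S (\<lambda>y. D y (h' x v, v))"
      unfolding D_def by (intro continuous_intros continuous_on_compose2[OF cont] hcont) auto
    moreover have "c * e > 0" using c e by simp
    ultimately obtain d where d: "d > 0" "\<And>y. y \<in> S \<Longrightarrow> dist y x < d \<Longrightarrow> dist (D y (h' x v, v)) (D x (h' x v, v)) < c * e"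
      using x unfolding continuous_on_iff by metis
    have "dist (h' y v) (h' x v) < e" if y: "y \<in> S" "dist y x < d" for y
    proof -
      have "c * norm (h' x v - h' y v) \<le> norm (D y (h' x v - h' y v, 0))" by (rule lower[OF y(1)])
      also have "D y (h' x v - h' y v, 0) = D y (h' x v, v)"
        using h'(2)[OF y(1), of v] blinfun.diff_right[of "D y" "(h' x v, v)" "(h' y v, v)"] by simp
      also have "norm \<dots> < c * e" using d(2)[OF y] h'(2)[OF x, of v] by simp
      finally show ?thesis using c by (simp add: dist_norm norm_minus_commute)
    qed
    with d show "\<exists>d>0. \<forall>x'\<in>S. dist x' x < d \<longrightarrow> dist (h' x' v) (h' x v) < e" by blast
  qed
  ultimately show thesis using that by blast
qed

text \<open>\<open>st i\<close> marks the contracting components, \<open>clk\<close> is a slow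
  coordinate of unit speed, and \<open>B\<close> prescribes \<open>u\<close> at clock value
  \<open>a\<close> or \<open>b\<close>. The rate \<open>\<kappa>\<close> is demanded only of the
  largest component and only inside the cone of slope \<open>K\<close>. \<open>E\<close> is the
  Gronwall factor for slow differences over a time span \<open>b - a\<close>: if these are at most
  \<open>2 * E * M\<close> at one time and the fast ones never exceed \<open>M\<close>, they are
  always at most \<open>E * (1 + 2 * E) * M\<close>, which the condition on \<open>K\<close> places
  in the cone. By \<open>\<beta> * K \<le> 1/4\<close> the boundary data then vary by at most a
  quarter of \<open>M\<close>.\<close>

locale hyperbolic_split =
  fixes F :: "real^'n::finite \<Rightarrow> 'x::euclidean_space \<Rightarrow> real^'n" and g :: "real^'n \<Rightarrow> 'x \<Rightarrow> 'x"
    and clk :: "'x \<Rightarrow> real" and st :: "'n \<Rightarrow> bool" and B :: "'x \<Rightarrow> real^'n"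
    and L K \<kappa> E \<beta> a b :: real
  assumes g_lip: "\<And>u v x y m. (\<And>i. \<bar>u$i - v$i\<bar> \<le> m) \<Longrightarrow> norm (g u x - g v y) \<le> L * (m + norm (x - y))"
    and hyp: "\<And>u v x y i. (\<And>j. \<bar>u$j - v$j\<bar> \<le> \<bar>u$i - v$i\<bar>) \<Longrightarrow> norm (x - y) \<le> K * \<bar>u$i - v$i\<bar> \<Longrightarrow>
       (if st i then 1 else -1) * ((u$i - v$i) * (F u x $ i - F v y $ i)) \<le> - \<kappa> * (u$i - v$i)\<^sup>2"
    and B_lip: "\<And>x y i. \<bar>B x $ i - B y $ i\<bar> \<le> \<beta> * norm (x - y)"
    and L: "L \<ge> 0" and \<kappa>: "\<kappa> > 0" and ab: "a \<le> b" and \<beta>: "\<beta> \<ge> 0" "\<beta> * K \<le> 1/4"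
    and E: "exp ((2*L+1) * (b - a) / 2) * (1 + L) \<le> E" and K: "E * (1 + 2 * E) \<le> K"
    and clk_linear: "bounded_linear clk" and clk_g: "\<And>u x. clk (g u x) = 1"
begin

definition sol :: "real \<Rightarrow> real \<Rightarrow> (real \<Rightarrow> real^'n) \<Rightarrow> (real \<Rightarrow> 'x) \<Rightarrow> bool" where
  "sol p q u x \<longleftrightarrow> (\<forall>s\<in>{p..q}. (u has_vector_derivative F (u s) (x s)) (at s within {p..q}) \<and>
     (x has_vector_derivative g (u s) (x s)) (at s within {p..q}))"

lemma E_ge_1: "E \<ge> 1"
proof -
  have "1 * 1 \<le> exp ((2*L+1) * (b - a) / 2) * (1 + L)" using L ab by (intro mult_mono) auto
  then show ?thesis using E by simp
qed

lemma K_ge_E: "K \<ge> E" "K > 0"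
proof -
  have "E * 1 \<le> E * (1 + 2 * E)" using E_ge_1 by (intro mult_left_mono) auto
  then show "K \<ge> E" using K by linarith
  then show "K > 0" using E_ge_1 by linarith
qed

lemma sol_subset: "sol p q u x \<Longrightarrow> p \<le> p' \<Longrightarrow> q' \<le> q \<Longrightarrow> sol p' q' u x"
  unfolding sol_def by (force intro: has_vector_derivative_within_subset)

lemma sol_clk:
  assumes "sol p q u x" "s \<in> {p..q}" "t \<in> {p..q}"
  shows "clk (x s) = clk (x t) + (s - t)"
proof -
  have "((\<lambda>r. clk (x r) - r) has_vector_derivative 0) (at r within {p..q})" if "r \<in> {p..q}" for r
    using bounded_linear.has_vector_derivative[OF clk_linear, of x "g (u r) (x r)" "at r within {p..q}"]
      assms(1) that clk_g unfolding sol_def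
    by (auto intro!: derivative_eq_intros simp: has_vector_derivative_def)
  then obtain c where "\<And>r. r \<in> {p..q} \<Longrightarrow> clk (x r) - r = c"
    using has_vector_derivative_zero_constant[of "{p..q}" "\<lambda>r. clk (x r) - r"] by auto
  from this[OF assms(2)] this[OF assms(3)] show ?thesis by simp
qed

text \<open>Gronwall for the slow difference, with the fast difference as a forcing term of size at
  most \<open>L * m\<close>.\<close>

lemma slow_close:
  assumes ux: "sol p q u x" and vy: "sol p q v y" and pq: "q - p \<le> b - a"
    and st: "s \<in> {p..q}" "t \<in> {p..q}" and m: "\<And>i r. r \<in> {p..q} \<Longrightarrow> \<bar>u r $ i - v r $ i\<bar> \<le> m"
  shows "norm (x s - y s) \<le> E * (norm (x t - y t) + m)"
proof -
  have m0: "m \<ge> 0" using m[OF st(1)] by (meson abs_ge_zero order_trans)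
  have "norm (x s - y s) \<le> exp ((2*L+1) * \<bar>s - t\<bar> / 2) * (norm (x t - y t) + L * m)"
  proof (rule gronwall_two_sided[where y'="\<lambda>r. g (u r) (x r) - g (v r) (y r)", OF _ _ L _ st])
    show "((\<lambda>r. x r - y r) has_vector_derivative g (u r) (x r) - g (v r) (y r)) (at r within {p..q})"
      if "r \<in> {p..q}" for r
      using ux vy that unfolding sol_def by (auto intro: has_vector_derivative_diff)
    show "norm (g (u r) (x r) - g (v r) (y r)) \<le> L * norm (x r - y r) + L * m" if "r \<in> {p..q}" for r
      using g_lip[of "u r" "v r" m "x r" "y r"] m[OF that] by (simp add: algebra_simps)
  qed (use L m0 in auto)
  also have "\<dots> \<le> exp ((2*L+1) * (b - a) / 2) * ((1 + L) * (norm (x t - y t) + m))"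
  proof (intro mult_mono)
    show "exp ((2*L+1) * \<bar>s - t\<bar> / 2) \<le> exp ((2*L+1) * (b - a) / 2)"
      using st pq L by (auto intro!: mult_left_mono)
    show "norm (x t - y t) + L * m \<le> (1 + L) * (norm (x t - y t) + m)"
      using L m0 by (simp add: algebra_simps)
  qed (use L m0 in auto)
  also have "\<dots> \<le> E * (norm (x t - y t) + m)"
    using mult_right_mono[OF E, of "norm (x t - y t) + m"] m0 by (simp add: mult_ac)
  finally show ?thesis .
qed

text \<open>Suppose the joint maximum \<open>M\<close> of the fast differences exceeds the claimed
  bound. Then slow differences stay within \<open>K * M\<close>, so the pair lies in the cone where
  the maximum is attained. The rate excludes every place except the end carrying the data of that
  component, and there the difference is at most \<open>d + M / 4 < M\<close>.\<close>

lemma fast_expand: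
  assumes ux: "sol p q u x" and vy: "sol p q v y" and pq: "q - p \<le> b - a"
    and t: "t \<in> {p..q}" and s: "s \<in> {p..q}"
    and bdry: "\<And>i r. r = (if st i then p else q) \<Longrightarrow> \<bar>(u r $ i - v r $ i) - (B (x r) $ i - B (y r) $ i)\<bar> \<le> d"
  shows "\<bar>u s $ j - v s $ j\<bar> \<le> max (2 * d) (norm (x t - y t) / (2 * E))"
proof -
  have D: "((\<lambda>s. u s $ i - v s $ i) has_real_derivative F (u r) (x r) $ i - F (v r) (y r) $ i) (at r within {p..q})"
    if "r \<in> {p..q}" for r i
  proof -
    have "((\<lambda>s. u s - v s) has_vector_derivative F (u r) (x r) - F (v r) (y r)) (at r within {p..q})"
      using ux vy that unfolding sol_def by (auto intro: has_vector_derivative_diff)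
    from bounded_linear.has_vector_derivative[OF bounded_linear_vec_nth this, of i]
    show ?thesis by (simp add: has_real_derivative_iff_has_vector_derivative)
  qed
  have "p \<le> q" using t by auto
  obtain i r where r: "r \<in> {p..q}" and
    mx: "\<And>j s. s \<in> {p..q} \<Longrightarrow> \<bar>u s $ j - v s $ j\<bar> \<le> \<bar>u r $ i - v r $ i\<bar>" and
    alt: "r = (if st i then p else q) \<or> 0 \<le> (if st i then 1 else -1) * ((u r $ i - v r $ i) * (F (u r) (x r) $ i - F (v r) (y r) $ i))"
    by (rule global_max_sign[where y="\<lambda>i s. u s $ i - v s $ i" and
          y'="\<lambda>i r. F (u r) (x r) $ i - F (v r) (y r) $ i" and st=st, OF \<open>p \<le> q\<close> D]) (assumption, rule that)
  define M where "M = \<bar>u r $ i - v r $ i\<bar>"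
  have "M \<le> max (2 * d) (norm (x t - y t) / (2 * E))"
  proof (rule ccontr)
    assume "\<not> ?thesis"
    then have d: "2 * d < M" and "norm (x t - y t) / (2 * E) < M" by auto
    then have xt: "norm (x t - y t) \<le> 2 * E * M" using E_ge_1 by (simp add: field_simps)
    have M0: "M > 0" using \<open>norm (x t - y t) / (2 * E) < M\<close> E_ge_1
      by (smt (verit) divide_nonneg_nonneg norm_ge_zero)
    have "norm (x r - y r) \<le> E * (norm (x t - y t) + M)"
      using slow_close[OF ux vy pq r t, of M] mx by (simp add: M_def)
    also have "\<dots> \<le> E * (2 * E * M + M)" using xt E_ge_1 by (intro mult_left_mono) auto
    also have "\<dots> = (E * (1 + 2 * E)) * M" by (simp add: algebra_simps)
    also have "\<dots> \<le> K * M" using K M0 by (intro mult_right_mono) auto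
    finally have xr: "norm (x r - y r) \<le> K * M" .
    from alt show False
    proof
      assume r': "r = (if st i then p else q)"
      have "\<bar>B (x r) $ i - B (y r) $ i\<bar> \<le> \<beta> * (K * M)"
        using B_lip[of "x r" i "y r"] mult_left_mono[OF xr \<beta>(1)] by linarith
      also have "\<dots> \<le> 1/4 * M" using mult_right_mono[OF \<beta>(2), of M] M0 by (simp add: mult_ac)
      finally show False using bdry[of r i, OF r'] d M0
        unfolding M_def by (simp add: abs_if split: if_splits)
    next
      assume "0 \<le> (if st i then 1 else -1) * ((u r $ i - v r $ i) * (F (u r) (x r) $ i - F (v r) (y r) $ i))"
      also have "\<dots> \<le> - \<kappa> * (u r $ i - v r $ i)\<^sup>2"
        by (rule hyp) (use mx[OF r] xr M_def in auto)
      also have "\<dots> < 0" using \<kappa> M0 by (auto simp: M_def)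
      finally show False by simp
    qed
  qed
  then show ?thesis using mx[OF s, of j] by (simp add: M_def)
qed

text \<open>The comparison orbit ends at the same slow point, so that no derivative of \<^term>\<open>h\<close> is needed;
  its slow deviation at time 0 is absorbed by the Lipschitz constant of \<^term>\<open>h\<close> on the slices
  of constant \<^term>\<open>clk\<close>.\<close>

lemma attraction:
  assumes all: "\<And>i. st i"
    and h_lip: "\<And>x y i. clk x = clk y \<Longrightarrow> clk x \<in> {a..b} \<Longrightarrow> \<bar>h x $ i - h y $ i\<bar> \<le> norm (x - y) / (2 * E)"
    and ux: "sol 0 T u x" and vy: "sol 0 T v y" and vh: "\<And>s. s \<in> {0..T} \<Longrightarrow> v s = h (y s)"
    and T: "0 \<le> T" "y T = x T"
    and clk: "clk (x 0) \<in> {a..b}" "clk (x T) \<in> {a..b}"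
    and m: "\<And>j. \<bar>u 0 $ j - h (x 0) $ j\<bar> \<le> m"
  shows "\<bar>u T $ i - h (x T) $ i\<bar> \<le> 2 * exp (- \<kappa> * T / 2) * m"
proof -
  have TT: "0 \<in> {0..T}" "T \<in> {0..T}" using T by auto
  have Tab: "T - 0 \<le> b - a" using sol_clk[OF ux TT] clk by auto
  have clk0: "clk (y 0) = clk (x 0)" using sol_clk[OF ux TT] sol_clk[OF vy TT] T by simp
  define w where "w i s = u s $ i - v s $ i" for i s
  define w' where "w' i s = F (u s) (x s) $ i - F (v s) (y s) $ i" for i s
  \<comment> \<open>Half of the rate is spent on the exponential weight; the other half keeps the
    sign strict at a weighted maximum.\<close>
  define \<gamma> where "\<gamma> = \<kappa> / 2"
  have wD: "(w i has_real_derivative w' i s) (at s within {0..T})" if "s \<in> {0..T}" for s i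
  proof -
    have "((\<lambda>s. u s - v s) has_vector_derivative F (u s) (x s) - F (v s) (y s)) (at s within {0..T})"
      using ux vy that unfolding sol_def by (auto intro: has_vector_derivative_diff)
    from bounded_linear.has_vector_derivative[OF bounded_linear_vec_nth this, of i]
    show ?thesis by (simp add: has_real_derivative_iff_has_vector_derivative w_def[abs_def] w'_def)
  qed
  then have D: "((\<lambda>s. exp (\<gamma> * s) * w i s) has_real_derivative exp (\<gamma> * s) * (\<gamma> * w i s + w' i s)) (at s within {0..T})"
    if "s \<in> {0..T}" for s i
    using that by (auto intro!: derivative_eq_intros simp: algebra_simps)
  obtain i0 r where r: "r \<in> {0..T}"
    and mx: "\<And>j s. s \<in> {0..T} \<Longrightarrow> \<bar>exp (\<gamma> * s) * w j s\<bar> \<le> \<bar>exp (\<gamma> * r) * w i0 r\<bar>"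
    and alt: "r = (if st i0 then 0 else T) \<or> 0 \<le> (if st i0 then 1 else -1) *
      ((exp (\<gamma> * r) * w i0 r) * (exp (\<gamma> * r) * (\<gamma> * w i0 r + w' i0 r)))"
    by (rule global_max_sign[where y="\<lambda>i s. exp (\<gamma> * s) * w i s" and
          y'="\<lambda>i r. exp (\<gamma> * r) * (\<gamma> * w i r + w' i r)" and st=st, OF T(1) D]) (assumption, rule that)
  \<comment> \<open>After \<open>r\<close> the weight only grows, so weighted maximality bounds the
    unweighted differences on \<open>{r..T}\<close>. This suffices, since the slow orbits meet at
    \<open>T\<close> and are compared backwards from there.\<close>
  have later: "\<bar>w j s\<bar> \<le> \<bar>w i0 r\<bar>" if "s \<in> {r..T}" for j s
  proof -
    have "exp (\<gamma> * r) * \<bar>w j s\<bar> \<le> exp (\<gamma> * s) * \<bar>w j s\<bar>"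
      using that \<kappa> by (intro mult_right_mono) (auto simp: \<gamma>_def)
    also have "\<dots> \<le> exp (\<gamma> * r) * \<bar>w i0 r\<bar>" using mx[of s j] that r by (simp add: abs_mult)
    finally show ?thesis by simp
  qed
  have xr: "norm (x r - y r) \<le> E * \<bar>w i0 r\<bar>"
    using slow_close[OF sol_subset[OF ux] sol_subset[OF vy], of r T r T "\<bar>w i0 r\<bar>"] r T Tab later
    by (auto simp: w_def)
  have "w i0 r = 0 \<or> r = 0"
  proof (rule ccontr)
    assume "\<not> ?thesis"
    then have w0: "w i0 r \<noteq> 0" and r0: "r \<noteq> 0" by auto
    have "E * \<bar>w i0 r\<bar> \<le> K * \<bar>w i0 r\<bar>" by (intro mult_right_mono K_ge_E) simp
    then have "w i0 r * w' i0 r \<le> - \<kappa> * (w i0 r)\<^sup>2"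
      using hyp[of "u r" "v r" i0 "x r" "y r"] later[of r] r xr all by (auto simp: w_def w'_def)
    moreover have "0 \<le> exp (\<gamma> * r) * exp (\<gamma> * r) * (\<gamma> * (w i0 r)\<^sup>2 + w i0 r * w' i0 r)"
      using alt r0 all by (simp add: power2_eq_square algebra_simps)
    then have "0 \<le> \<gamma> * (w i0 r)\<^sup>2 + w i0 r * w' i0 r" 
      by (metis exp_gt_zero mult_pos_pos zero_le_mult_iff linorder_not_le)
    ultimately have "0 \<le> - \<gamma> * (w i0 r)\<^sup>2" by (simp add: \<gamma>_def)
    moreover have "\<gamma> * (w i0 r)\<^sup>2 > 0" using \<kappa> w0 by (simp add: \<gamma>_def)
    ultimately show False by simp
  qed
  define M where "M = \<bar>w i0 0\<bar>"
  have M: "exp (\<gamma> * s) * \<bar>w j s\<bar> \<le> M" if "s \<in> {0..T}" for j s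
    using \<open>w i0 r = 0 \<or> r = 0\<close> mx[OF that, of j] by (auto simp: abs_mult M_def)
  have M1: "\<bar>w j s\<bar> \<le> M" if "s \<in> {0..T}" for j s
  proof -
    have "1 * \<bar>w j s\<bar> \<le> exp (\<gamma> * s) * \<bar>w j s\<bar>"
      using that \<kappa> by (intro mult_right_mono) (auto simp: \<gamma>_def)
    then show ?thesis using M[OF that, of j] by simp
  qed
  have "norm (x 0 - y 0) \<le> E * M"
    using slow_close[OF ux vy Tab TT, of M] M1 T by (simp add: w_def)
  \<comment> \<open>The Lipschitz constant \<open>1 / (2 * E)\<close> cancels the Gronwall factor
    \<open>E\<close>. Half of \<open>M\<close> is absorbed, which produces the factor 2 of the final
    estimate.\<close>
  then have "\<bar>h (x 0) $ i0 - h (y 0) $ i0\<bar> \<le> M / 2"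
    using h_lip[of "x 0" "y 0" i0] clk0 clk E_ge_1
      divide_right_mono[of "norm (x 0 - y 0)" "E * M" "2 * E"] by simp
  moreover have "v 0 $ i0 = h (y 0) $ i0" using vh[OF TT(1)] by simp
  ultimately have "M \<le> 2 * m" using m[of i0] unfolding M_def w_def
    by (simp add: abs_if split: if_splits)
  have "\<bar>u T $ i - h (x T) $ i\<bar> = \<bar>w i T\<bar>" using vh[OF TT(2)] T by (simp add: w_def)
  also have "\<dots> = exp (- \<gamma> * T) * (exp (\<gamma> * T) * \<bar>w i T\<bar>)" by (simp flip: mult.assoc exp_add)
  also have "\<dots> \<le> exp (- \<gamma> * T) * (2 * m)"
    using M[OF TT(2), of i] \<open>M \<le> 2 * m\<close> by (intro mult_left_mono) auto
  finally show ?thesis by (simp add: \<gamma>_def mult_ac)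
qed

end


section \<open>The invariant graph as the zero set of the boundary defect\<close>

lemma norm_vec_le_CARD:
  fixes v :: "real^'n"
  assumes "\<And>i. \<bar>v $ i\<bar> \<le> m"
  shows "norm v \<le> real CARD('n) * m"
  using order_trans[OF norm_le_l1_cart sum_mono[of UNIV "\<lambda>i. \<bar>v $ i\<bar>" "\<lambda>_. m"]] assms by simp

text \<open>\<open>L0\<close> is a Lipschitz constant of the full field and may be large when the
  fast part is stiff. It serves the existence and differentiability of the flow; the quantitative
  estimates use the constants of \<open>hyperbolic_split\<close>.\<close>

locale boundary_manifold =
  hyperbolic_split F g clk st B L K \<kappa> E \<beta> a b +
  c1_flow "\<lambda>z. (F (fst z) (snd z), g (fst z) (snd z))" f' L0
  for F :: "real^'n::finite \<Rightarrow> 'x::euclidean_space \<Rightarrow> real^'n" and g :: "real^'n \<Rightarrow> 'x \<Rightarrow> 'x"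
    and clk :: "'x \<Rightarrow> real" and st :: "'n \<Rightarrow> bool" and B :: "'x \<Rightarrow> real^'n"
    and L K \<kappa> E \<beta> a b :: real
    and f' :: "(real^'n) \<times> 'x \<Rightarrow> ((real^'n) \<times> 'x) \<Rightarrow>\<^sub>L ((real^'n) \<times> 'x)" and L0 :: real +
  fixes B' :: "'x \<Rightarrow> 'x \<Rightarrow>\<^sub>L (real^'n)"
  assumes B_der: "\<And>x. (B has_derivative blinfun_apply (B' x)) (at x)"
    and B'_cont: "continuous_on UNIV B'"
begin

abbreviation "orb u x s \<equiv> fl s (u, x)"

lemma sol_fl: "sol p q (\<lambda>s. fst (fl (s - t) z)) (\<lambda>s. snd (fl (s - t) z))"
  unfolding sol_def
  using fl_shift_D[of t z] bounded_linear.has_vector_derivative[OF bounded_linear_fst fl_shift_D[of t z]]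
    bounded_linear.has_vector_derivative[OF bounded_linear_snd fl_shift_D[of t z]] by simp

lemma sol_imp_fl:
  assumes "sol p q u x" "s \<in> {p..q}" "t \<in> {p..q}"
  shows "(u s, x s) = fl (s - t) (u t, x t)"
  by (rule sol_eq_fl[where y="\<lambda>s. (u s, x s)" and a=p and b=q])
     (use assms in \<open>auto simp: sol_def intro!: has_vector_derivative_Pair\<close>)

definition bt :: "'n \<Rightarrow> real" where "bt i = (if st i then a else b)"

text \<open>Since the clock has unit speed, the travel time is explicit: this is the point where the
  orbit of \<open>z\<close> crosses the slice on which component \<open>i\<close> has its
  data.\<close>

definition bpt :: "'n \<Rightarrow> (real^'n) \<times> 'x \<Rightarrow> (real^'n) \<times> 'x" where
  "bpt i z = fl (bt i - clk (snd z)) z"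

text \<open>Zero exactly when the orbit through \<open>(u, x)\<close> meets all boundary conditions,
  each component being read at its own end. Taking the present value \<open>u\<close> as the unknown
  makes the solution a graph over the present slow point.\<close>

definition G :: "real^'n \<Rightarrow> 'x \<Rightarrow> real^'n" where
  "G u x = (\<chi> i. fst (bpt i (u, x)) $ i - B (snd (bpt i (u, x))) $ i)"

definition dbpt :: "'n \<Rightarrow> (real^'n) \<times> 'x \<Rightarrow> (real^'n) \<times> 'x \<Rightarrow> (real^'n) \<times> 'x" where
  "dbpt i z w = (- clk (snd w)) *\<^sub>R (F (fst (bpt i z)) (snd (bpt i z)), g (fst (bpt i z)) (snd (bpt i z)))
     + W (bt i - clk (snd z)) z w"

lemma bpt_der: "(bpt i has_derivative dbpt i z) (at z)"
proof -
  have clk': "((\<lambda>z. clk (snd z)) has_derivative (\<lambda>w. clk (snd w))) (at z)"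
    by (intro bounded_linear_imp_has_derivative bounded_linear_compose[OF clk_linear] bounded_linear_snd)
  have "((\<lambda>z. (bt i - clk (snd z), z)) has_derivative (\<lambda>w. (- clk (snd w), w))) (at z)"
    by (auto intro!: derivative_eq_intros clk')
  from has_derivative_compose[OF this fl_has_derivative2]
  show ?thesis by (simp add: bpt_def[abs_def] dbpt_def[abs_def])
qed

definition G'0 where "G'0 z w = (\<chi> i. fst (dbpt i z w) $ i - B' (snd (bpt i z)) (snd (dbpt i z w)) $ i)"

lemma G_der0: "((\<lambda>(u, x). G u x) has_derivative G'0 z) (at z)"
proof (subst has_derivative_componentwise_within, intro ballI)
  fix e :: "real^'n" assume "e \<in> Basis"
  then obtain i where e: "e = axis i 1" by (auto simp: Basis_vec_def)
  have 1: "((\<lambda>z. fst (bpt i z) $ i) has_derivative (\<lambda>w. fst (dbpt i z w) $ i)) (at z)"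
    by (intro bounded_linear.has_derivative[OF bounded_linear_vec_nth] has_derivative_fst bpt_der)
  have "((\<lambda>z. B (snd (bpt i z))) has_derivative (\<lambda>w. B' (snd (bpt i z)) (snd (dbpt i z w)))) (at z)"
    by (rule has_derivative_compose[OF has_derivative_snd[OF bpt_der] B_der])
  from has_derivative_diff[OF 1 bounded_linear.has_derivative[OF bounded_linear_vec_nth this]]
  show "((\<lambda>x. (case x of (u, x) \<Rightarrow> G u x) \<bullet> e) has_derivative (\<lambda>x. G'0 z x \<bullet> e)) (at z)"
    by (simp add: e inner_axis G_def G'0_def case_prod_unfold)
qed

definition G' where "G' z = Blinfun (G'0 z)"

lemma G'_apply: "blinfun_apply (G' z) = G'0 z"
  unfolding G'_def by (intro bounded_linear_Blinfun_apply has_derivative_bounded_linear[OF G_der0])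

lemma cont_bpt: "continuous_on UNIV (bpt i)"
  by (meson bpt_der continuous_at_imp_continuous_on has_derivative_continuous)

lemma G'_cont: "continuous_on UNIV G'"
proof (rule continuous_at_imp_continuous_on, safe)
  fix z :: "(real^'n) \<times> 'x"
  have clk': "continuous_on UNIV (\<lambda>z::(real^'n) \<times> 'x. clk (snd z))"
    by (rule linear_continuous_on[OF bounded_linear_compose[OF clk_linear bounded_linear_snd]])
  show "isCont G' z"
  proof (rule continuous_blinfun_componentwiseI1)
    fix w
    have c1: "continuous_on UNIV (\<lambda>z. W (bt i - clk (snd z)) z w)" for i
        using continuous_on_compose2[OF W_apply_continuous[of w], of UNIV "\<lambda>z. (bt i - clk (snd z), z)"]
        continuous_on_Pair[OF continuous_on_diff[OF continuous_on_const clk'] continuous_on_id]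
      by simp
    have c2: "continuous_on UNIV (\<lambda>z. (F (fst (bpt i z)) (snd (bpt i z)), g (fst (bpt i z)) (snd (bpt i z))))" for i
      using continuous_on_compose2[OF cont_f[of UNIV] cont_bpt] by simp
    have d: "continuous_on UNIV (\<lambda>z. dbpt i z w)" for i
      unfolding dbpt_def by (rule continuous_on_add[OF continuous_on_scaleR[OF continuous_on_const c2] c1])
    have "continuous_on UNIV (\<lambda>z. B' (snd (bpt i z)))" for i
      by (rule continuous_on_compose2[OF B'_cont]) (auto intro!: continuous_intros cont_bpt)
    then have "continuous_on UNIV (\<lambda>z. G'0 z w)"
      unfolding G'0_def by (intro continuous_intros d)
    then show "isCont (\<lambda>z. G' z w) z"
      unfolding G'_apply using continuous_on_eq_continuous_at[OF open_UNIV] by blast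
  qed
qed

lemma G_der: "((\<lambda>(u, x). G u x) has_derivative blinfun_apply (G' (u, x))) (at (u, x))"
  unfolding G'_apply by (rule G_der0)

lemma clk_bounds_time: "clk x \<in> {a..b} \<Longrightarrow> 0 \<in> {a - clk x..b - clk x}"
  by simp

text \<open>Equal clock values let both orbits reach each end after the same time, so the difference
  of the defects is the boundary difference in \<open>fast_expand\<close>, which is then evaluated
  at time 0.\<close>

lemma G_expanding_sup:
  assumes x: "clk x \<in> {a..b}" and y: "clk x = clk y"
    and d: "\<And>i. \<bar>G u x $ i - G v y $ i\<bar> \<le> d"
  shows "\<bar>u $ j - v $ j\<bar> \<le> max (2 * d) (norm (x - y) / (2 * E))"
proof -
  let ?p = "a - clk x" and ?q = "b - clk x"
  have s: "sol ?p ?q (\<lambda>s. fst (fl s z)) (\<lambda>s. snd (fl s z))" for z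
    using sol_fl[of _ _ 0 z] by simp
  have bd: "\<bar>fst (orb u x r) $ i - fst (orb v y r) $ i - (B (snd (orb u x r)) $ i - B (snd (orb v y r)) $ i)\<bar> \<le> d"
    if "r = (if st i then ?p else ?q)" for i r
  proof -
    have r: "r = bt i - clk x" using that by (simp add: bt_def)
    show ?thesis using d[of i] y unfolding r by (simp add: G_def bpt_def algebra_simps)
  qed
  show ?thesis
    using fast_expand[OF s[of "(u, x)"] s[of "(v, y)"] _ clk_bounds_time[OF x] clk_bounds_time[OF x] bd, of j]
    by simp
qed

lemma G_expanding:
  assumes "clk x \<in> {a..b}"
  shows "1 / (2 * CARD('n)) * norm (u - v) \<le> norm (G u x - G v x)"
proof -
  let ?d = "norm (G u x - G v x)"
  have "\<bar>G u x $ i - G v x $ i\<bar> \<le> ?d" for i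
    using component_le_norm_cart[of "G u x - G v x" i] by simp
  note sup = G_expanding_sup[OF assms refl this]
  have "norm (u - v) \<le> CARD('n) * (2 * ?d)"
    by (rule norm_vec_le_CARD) (use sup in simp)
  then show ?thesis by (simp add: field_simps)
qed

text \<open>An expanding continuous map of a finite-dimensional space into itself is onto: its range
  is open by invariance of domain, and closed because preimages of a convergent sequence form a
  Cauchy sequence.\<close>

lemma G_surj:
  assumes x: "clk x \<in> {a..b}"
  shows "\<exists>u. G u x = 0"
proof -
  let ?g = "\<lambda>u. G u x" and ?c = "1 / (2 * CARD('n))"
  have c: "?c > 0" by simp
  have contG: "continuous_on UNIV (\<lambda>(u, x). G u x)"
    by (rule continuous_at_imp_continuous_on) (auto intro: has_derivative_continuous[OF G_der])
  have cont: "continuous_on UNIV ?g"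
    using continuous_on_compose2[OF contG continuous_on_Pair[OF continuous_on_id continuous_on_const], of x] by simp
  have "inj ?g"
  proof (rule injI)
    fix u v assume "?g u = ?g v"
    then show "u = v" using G_expanding[OF x, of u v] by (simp add: divide_le_0_iff)
  qed
  then have "open (range ?g)" using invariance_of_domain[OF cont open_UNIV] by blast
  moreover have "closed (range ?g)"
    unfolding closed_sequential_limits
  proof (intro allI impI, elim conjE)
    fix s l assume s: "\<forall>n. s n \<in> range ?g" "s \<longlonglongrightarrow> l"
    from s(1) have "\<forall>n. \<exists>w. s n = ?g w" by auto
    then obtain w where w: "\<And>n. s n = ?g (w n)" using choice[of "\<lambda>n w. s n = ?g w"] by blast
    have "Cauchy w"
    proof (rule metric_CauchyI)
      fix e :: real assume e: "e > 0"
      then obtain M where M: "\<And>m n. m \<ge> M \<Longrightarrow> n \<ge> M \<Longrightarrow> dist (s m) (s n) < ?c * e"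
        using LIMSEQ_imp_Cauchy[OF s(2)] c unfolding Cauchy_def by (meson mult_pos_pos)
      have "dist (w m) (w n) < e" if "m \<ge> M" "n \<ge> M" for m n
      proof -
        have "?c * norm (w m - w n) < ?c * e"
          using G_expanding[OF x, of "w m" "w n"] M[OF that] by (simp add: w dist_norm)
        then show ?thesis unfolding dist_norm using mult_less_cancel_left_pos[OF c] by blast
      qed
      then show "\<exists>M. \<forall>m\<ge>M. \<forall>n\<ge>M. dist (w m) (w n) < e" by blast
    qed
    then obtain u where u: "w \<longlonglongrightarrow> u" using Cauchy_convergent convergent_def by blast
    have "(\<lambda>n. ?g (w n)) \<longlonglongrightarrow> ?g u"
      using continuous_on_tendsto_compose[OF cont u] by simp
    then have "l = ?g u" using s(2) LIMSEQ_unique by (simp flip: w)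
    then show "l \<in> range ?g" by simp
  qed
  ultimately have "range ?g = UNIV" using clopen by blast
  then show ?thesis by (metis surjD)
qed

text \<open>Meaningful only if \<open>clk x \<in> {a..b}\<close>.\<close>

definition hm :: "'x \<Rightarrow> real^'n" where "hm x = (SOME u. G u x = 0)"

lemma G_hm: "clk x \<in> {a..b} \<Longrightarrow> G (hm x) x = 0"
  unfolding hm_def by (rule someI_ex) (rule G_surj)

lemma hm_unique:
  assumes "clk x \<in> {a..b}" "G u x = 0" shows "u = hm x"
proof -
  have "norm (u - hm x) / (2 * CARD('n)) \<le> 0"
    using G_expanding[OF assms(1), of u "hm x"] assms(2) G_hm[OF assms(1)] by simp
  then show ?thesis by (simp add: divide_le_0_iff)
qed

text \<open>At two zeros of the defect \<open>d = 0\<close>, so only the slow alternative of the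
  expansion estimate is left.\<close>

lemma hm_lip:
  assumes "clk x = clk y" "clk x \<in> {a..b}"
  shows "\<bar>hm x $ i - hm y $ i\<bar> \<le> norm (x - y) / (2 * E)"
  using G_expanding_sup[of x y "hm x" "hm y" 0 i] G_hm[of x] G_hm[of y] assms E_ge_1 by simp

lemma hm_boundary:
  assumes "clk x \<in> {a..b}"
  shows "fst (fl (bt i - clk x) (hm x, x)) $ i = B (snd (fl (bt i - clk x) (hm x, x))) $ i"
  using arg_cong[OF G_hm[OF assms], of "\<lambda>v. v $ i"] by (simp add: G_def bpt_def)

text \<open>Points of one orbit have the same boundary points, because the clock difference
  compensates the elapsed time. The defect thus vanishes along the orbit once it vanishes somewhere,
  and its zero over each slow point is unique.\<close>

lemma hm_invariant:
  assumes ux: "sol p q u x" and st: "s \<in> {p..q}" "t \<in> {p..q}"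
    and clk: "clk (x s) \<in> {a..b}" "clk (x t) \<in> {a..b}" and ut: "u t = hm (x t)"
  shows "u s = hm (x s)"
proof (rule hm_unique[OF clk(1)])
  have "bpt i (u s, x s) = bpt i (u t, x t)" for i
  proof -
    have "bpt i (u s, x s) = fl (bt i - clk (x s)) (fl (s - t) (u t, x t))"
      by (simp add: bpt_def sol_imp_fl[OF ux st, symmetric])
    also have "\<dots> = bpt i (u t, x t)"
      unfolding fl_add bpt_def using sol_clk[OF ux st] by (simp add: algebra_simps)
    finally show ?thesis .
  qed
  then show "G (u s) (x s) = 0" using G_hm[OF clk(2)] by (simp add: G_def ut)
qed

lemma hm_C1:
  obtains h' where "\<And>x. clk x \<in> {a..b} \<Longrightarrow> (hm has_derivative h' x) (at x within {x. clk x \<in> {a..b}})"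
    "\<And>v. continuous_on {x. clk x \<in> {a..b}} (\<lambda>x. h' x v)"
  using implicit_function_expanding[of G G' "{x. clk x \<in> {a..b}}" "1 / (2 * CARD('n))" hm]
    G_der G'_cont G_expanding G_hm by auto

lemma hm_orbit:
  assumes "clk x \<in> {a..b}" "s \<in> {a - clk x..b - clk x}"
  shows "fst (fl s (hm x, x)) = hm (snd (fl s (hm x, x)))" "clk (snd (fl s (hm x, x))) = clk x + s"
proof -
  have sl: "sol (a - clk x) (b - clk x) (\<lambda>s. fst (fl s (hm x, x))) (\<lambda>s. snd (fl s (hm x, x)))"
    using sol_fl[of _ _ 0 "(hm x, x)"] by simp
  have z: "0 \<in> {a - clk x..b - clk x}" using assms(1) by (rule clk_bounds_time)
  show c: "clk (snd (fl s (hm x, x))) = clk x + s" using sol_clk[OF sl assms(2) z] by simp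
  show "fst (fl s (hm x, x)) = hm (snd (fl s (hm x, x)))"
    by (rule hm_invariant[OF sl assms(2) z]) (use c assms in auto)
qed

end


section \<open>Globally Lipschitz and continuously differentiable maps\<close>

text \<open>\<open>Bd\<close>, \<open>Lip\<close> and \<open>C1\<close> are global properties that
  pass through the operations from which the truncated fields are built, so the regularity of these
  fields follows by introduction rules. The product rule for \<open>Lip\<close> needs bounded
  factors, which is why \<open>Bd\<close> is tracked along with it.\<close>

definition Bd :: "('a::real_normed_vector \<Rightarrow> 'b::real_normed_vector) \<Rightarrow> bool" where
  "Bd f \<longleftrightarrow> (\<exists>M\<ge>0. \<forall>x. norm (f x) \<le> M)"

definition Lip :: "('a::real_normed_vector \<Rightarrow> 'b::real_normed_vector) \<Rightarrow> bool" where
  "Lip f \<longleftrightarrow> (\<exists>L\<ge>0. \<forall>x y. norm (f x - f y) \<le> L * norm (x - y))"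

definition C1 :: "('a::euclidean_space \<Rightarrow> 'b::euclidean_space) \<Rightarrow> bool" where
  "C1 f \<longleftrightarrow> (\<exists>f'. (\<forall>x. (f has_derivative f' x) (at x)) \<and> (\<forall>v. continuous_on UNIV (\<lambda>x. f' x v)))"

lemma BdI: "(\<And>x. norm (f x) \<le> M) \<Longrightarrow> Bd f"
  unfolding Bd_def by (metis norm_ge_zero order_trans)

lemma LipI: "0 \<le> L \<Longrightarrow> (\<And>x y. norm (f x - f y) \<le> L * norm (x - y)) \<Longrightarrow> Lip f"
  unfolding Lip_def by blast

lemma C1I: "(\<And>x. (f has_derivative f' x) (at x)) \<Longrightarrow> (\<And>v. continuous_on UNIV (\<lambda>x. f' x v)) \<Longrightarrow> C1 f"
  unfolding C1_def by blast

lemma Bd_const: "Bd (\<lambda>_. c)" by (rule BdI[where M="norm c"]) simp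

lemma Bd_compose: "Bd f \<Longrightarrow> Bd (\<lambda>x. f (g x))" unfolding Bd_def by blast

lemma Bd_add: "Bd f \<Longrightarrow> Bd g \<Longrightarrow> Bd (\<lambda>x. f x + g x)"
  unfolding Bd_def by (meson add_mono add_nonneg_nonneg norm_triangle_ineq order_trans)

lemma Bd_minus: "Bd f \<Longrightarrow> Bd (\<lambda>x. - f x)" unfolding Bd_def by simp

lemma Bd_diff: "Bd f \<Longrightarrow> Bd g \<Longrightarrow> Bd (\<lambda>x. f x - g x)"
  using Bd_add[of f "\<lambda>x. - g x"] Bd_minus[of g] by simp

lemma Bd_mult:
  fixes f g :: "'a::real_normed_vector \<Rightarrow> real"
  assumes "Bd f" "Bd g" shows "Bd (\<lambda>x. f x * g x)"
  using assms unfolding Bd_def norm_mult by (meson mult_mono mult_nonneg_nonneg norm_ge_zero)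

lemma Bd_sum: "(\<And>i. i \<in> S \<Longrightarrow> Bd (f i)) \<Longrightarrow> Bd (\<lambda>x. \<Sum>i\<in>S. f i x)"
  by (induction S rule: infinite_finite_induct) (auto intro: Bd_const Bd_add)

lemma Bd_cos: "Bd (cos :: real \<Rightarrow> real)" and Bd_sin: "Bd (sin :: real \<Rightarrow> real)"
  by (auto intro!: BdI[where M=1])

lemma Bd_vec:
  fixes f :: "'a::real_normed_vector \<Rightarrow> real^'n"
  assumes "\<And>i. Bd (\<lambda>x. f x $ i)" shows "Bd f"
proof -
  obtain M where M: "\<And>i x. norm (f x $ i) \<le> M i" using assms unfolding Bd_def by metis
  show ?thesis
    using order_trans[OF norm_le_l1_cart sum_mono[of UNIV]] M by (intro BdI[where M="\<Sum>i\<in>UNIV. M i"]) auto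
qed

lemma Bd_Pair: "Bd f \<Longrightarrow> Bd g \<Longrightarrow> Bd (\<lambda>x. (f x, g x))"
  unfolding Bd_def by (meson add_mono add_nonneg_nonneg norm_Pair_le order_trans)

lemma Lip_const: "Lip (\<lambda>_. c)" by (rule LipI[where L=0]) auto

lemma Lip_linear:
  assumes "bounded_linear f" shows "Lip f"
proof -
  interpret bounded_linear f by fact
  obtain K where "K \<ge> 0" "\<And>x. norm (f x) \<le> norm x * K" using nonneg_bounded by blast
  then show ?thesis by (intro LipI[where L=K]) (auto simp: diff[symmetric] mult.commute)
qed

lemma Lip_compose:
  assumes "Lip g" "Lip f" shows "Lip (\<lambda>x. g (f x))"
proof -
  obtain A where A: "A \<ge> 0" "\<And>x y. norm (g x - g y) \<le> A * norm (x - y)" using assms(1) unfolding Lip_def by blast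
  obtain C where C: "C \<ge> 0" "\<And>x y. norm (f x - f y) \<le> C * norm (x - y)" using assms(2) unfolding Lip_def by blast
  show ?thesis
  proof (rule LipI[where L="A * C"])
    fix x y
    have "norm (g (f x) - g (f y)) \<le> A * norm (f x - f y)" by (rule A)
    also have "\<dots> \<le> A * (C * norm (x - y))" by (intro mult_left_mono C A)
    finally show "norm (g (f x) - g (f y)) \<le> A * C * norm (x - y)" by (simp add: mult.assoc)
  qed (use A C in simp)
qed

lemma Lip_add:
  assumes "Lip f" "Lip g" shows "Lip (\<lambda>x. f x + g x)"
proof -
  obtain A where A: "A \<ge> 0" "\<And>x y. norm (g x - g y) \<le> A * norm (x - y)" using assms(2) unfolding Lip_def by blast
  obtain C where C: "C \<ge> 0" "\<And>x y. norm (f x - f y) \<le> C * norm (x - y)" using assms(1) unfolding Lip_def by blast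
  show ?thesis
  proof (rule LipI[where L="C + A"])
    fix x y
    show "norm (f x + g x - (f y + g y)) \<le> (C + A) * norm (x - y)"
      using norm_triangle_ineq[of "f x - f y" "g x - g y"] A(2)[of x y] C(2)[of x y] by (simp add: algebra_simps)
  qed (use A C in simp)
qed

lemma Lip_minus: "Lip f \<Longrightarrow> Lip (\<lambda>x. - f x)"
  by (rule Lip_compose[OF Lip_linear[OF bounded_linear_minus[OF bounded_linear_ident]]])

lemma Lip_diff: "Lip f \<Longrightarrow> Lip g \<Longrightarrow> Lip (\<lambda>x. f x - g x)"
  using Lip_add[of f "\<lambda>x. - g x"] Lip_minus[of g] by simp

lemma Lip_cmult: "Lip f \<Longrightarrow> Lip (\<lambda>x. (c::real) * f x)"
  by (rule Lip_compose[OF Lip_linear[OF bounded_linear_mult_right]])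

lemma Lip_sum: "(\<And>i. i \<in> S \<Longrightarrow> Lip (f i)) \<Longrightarrow> Lip (\<lambda>x. \<Sum>i\<in>S. f i x)"
  by (induction S rule: infinite_finite_induct) (auto intro: Lip_const Lip_add)

lemma Lip_mult:
  fixes f g :: "'a::real_normed_vector \<Rightarrow> real"
  assumes "Lip f" "Lip g" "Bd f" "Bd g" shows "Lip (\<lambda>x. f x * g x)"
proof -
  obtain A where A: "A \<ge> 0" "\<And>x y. norm (g x - g y) \<le> A * norm (x - y)" using assms(2) unfolding Lip_def by blast
  obtain C where C: "C \<ge> 0" "\<And>x y. norm (f x - f y) \<le> C * norm (x - y)" using assms(1) unfolding Lip_def by blast
  obtain M where M: "M \<ge> 0" "\<And>x. norm (f x) \<le> M" using assms(3) unfolding Bd_def by blast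
  obtain N where N: "N \<ge> 0" "\<And>x. norm (g x) \<le> N" using assms(4) unfolding Bd_def by blast
  show ?thesis
  proof (rule LipI[where L="M * A + C * N"])
    fix x y
    have "f x * g x - f y * g y = f x * (g x - g y) + (f x - f y) * g y" by (simp add: algebra_simps)
    also have "norm \<dots> \<le> norm (f x) * norm (g x - g y) + norm (f x - f y) * norm (g y)"
      by (metis norm_mult norm_triangle_ineq)
    also have "\<dots> \<le> M * (A * norm (x - y)) + (C * norm (x - y)) * N"
      using A C M N by (intro add_mono mult_mono) auto
    finally show "norm (f x * g x - f y * g y) \<le> (M * A + C * N) * norm (x - y)" by (simp add: algebra_simps)
  qed (use A C M N in simp)
qed

lemma Lip_vec:
  fixes f :: "'a::real_normed_vector \<Rightarrow> real^'n"
  assumes "\<And>i. Lip (\<lambda>x. f x $ i)" shows "Lip f"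
proof -
  obtain L where L: "\<And>i. L i \<ge> 0" "\<And>i x y. norm (f x $ i - f y $ i) \<le> L i * norm (x - y)"
    using assms unfolding Lip_def by metis
  show ?thesis
  proof (rule LipI[where L="\<Sum>i\<in>UNIV. L i"])
    fix x y
    have "norm (f x - f y) \<le> (\<Sum>i\<in>UNIV. \<bar>(f x - f y) $ i\<bar>)" by (rule norm_le_l1_cart)
    also have "\<dots> \<le> (\<Sum>i\<in>UNIV. L i * norm (x - y))" using L(2) by (intro sum_mono) auto
    finally show "norm (f x - f y) \<le> (\<Sum>i\<in>UNIV. L i) * norm (x - y)" by (simp add: sum_distrib_right)
  qed (use L in \<open>auto intro: sum_nonneg\<close>)
qed

lemma Lip_Pair:
  assumes "Lip f" "Lip g" shows "Lip (\<lambda>x. (f x, g x))"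
proof -
  obtain A where A: "A \<ge> 0" "\<And>x y. norm (g x - g y) \<le> A * norm (x - y)" using assms(2) unfolding Lip_def by blast
  obtain C where C: "C \<ge> 0" "\<And>x y. norm (f x - f y) \<le> C * norm (x - y)" using assms(1) unfolding Lip_def by blast
  show ?thesis
  proof (rule LipI[where L="C + A"])
    fix x y
    show "norm ((f x, g x) - (f y, g y)) \<le> (C + A) * norm (x - y)"
      using norm_Pair_le[of "f x - f y" "g x - g y"] A(2)[of x y] C(2)[of x y] by (simp add: algebra_simps)
  qed (use A C in simp)
qed

lemma Lip_inverse:
  fixes f :: "'a::real_normed_vector \<Rightarrow> real"
  assumes "Lip f" "\<And>x. f x \<ge> c" "c > 0" shows "Lip (\<lambda>x. inverse (f x))"
proof -
  obtain A where A: "A \<ge> 0" "\<And>x y. norm (f x - f y) \<le> A * norm (x - y)" using assms(1) unfolding Lip_def by blast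
  show ?thesis
  proof (rule LipI[where L="A / (c * c)"])
    fix x y
    have f0: "f x > 0" "f y > 0" using assms by (meson less_le_trans)+
    then have "norm (inverse (f x) - inverse (f y)) = norm (f x - f y) / (f x * f y)"
      by (simp add: field_simps abs_minus_commute)
    also have "\<dots> \<le> (A * norm (x - y)) / (c * c)"
      using assms(2,3) A f0 by (intro frac_le mult_mono) (auto simp: less_imp_le)
    finally show "norm (inverse (f x) - inverse (f y)) \<le> A / (c * c) * norm (x - y)" by simp
  qed (use A assms in simp)
qed

lemma Lip_real_deriv:
  fixes f :: "real \<Rightarrow> real"
  assumes "\<And>x. DERIV f x :> f' x" "\<And>x. \<bar>f' x\<bar> \<le> M" shows "Lip f"
proof (rule LipI[where L=M])
  show "0 \<le> M" using assms(2)[of 0] by linarith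
  show "norm (f x - f y) \<le> M * norm (x - y)" for x y
    by (rule field_differentiable_bound[where S=UNIV]) (use assms in auto)
qed

lemma Lip_cos: "Lip (cos :: real \<Rightarrow> real)" and Lip_sin: "Lip (sin :: real \<Rightarrow> real)"
  by (rule Lip_real_deriv[OF DERIV_cos, of 1], simp) (rule Lip_real_deriv[OF DERIV_sin, of 1], simp)

lemma C1_const: "C1 (\<lambda>_. c)" by (rule C1I[where f'="\<lambda>_ _. 0"]) auto

lemma C1_linear: "bounded_linear f \<Longrightarrow> C1 f"
  by (rule C1I[where f'="\<lambda>_. f"]) (auto intro: bounded_linear_imp_has_derivative)

lemma C1_add:
  assumes "C1 f" "C1 g" shows "C1 (\<lambda>x. f x + g x)"
proof -
  obtain f' g' where "\<And>x. (f has_derivative f' x) (at x)" "\<And>v. continuous_on UNIV (\<lambda>x. f' x v)"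
    "\<And>x. (g has_derivative g' x) (at x)" "\<And>v. continuous_on UNIV (\<lambda>x. g' x v)"
    using assms unfolding C1_def by metis
  then show ?thesis by (intro C1I[where f'="\<lambda>x v. f' x v + g' x v"] has_derivative_add continuous_intros)
qed

lemma C1_linear_compose:
  assumes "bounded_linear l" "C1 f" shows "C1 (\<lambda>x. l (f x))"
proof -
  obtain f' where "\<And>x. (f has_derivative f' x) (at x)" "\<And>v. continuous_on UNIV (\<lambda>x. f' x v)"
    using assms unfolding C1_def by metis
  then show ?thesis
    by (intro C1I[where f'="\<lambda>x v. l (f' x v)"] bounded_linear.has_derivative[OF assms(1)]
          bounded_linear.continuous_on[OF assms(1)])
qed

lemma C1_compose_linear:
  assumes "C1 f" "bounded_linear l" shows "C1 (\<lambda>x. f (l x))"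
proof -
  obtain f' where f': "\<And>x. (f has_derivative f' x) (at x)" "\<And>v. continuous_on UNIV (\<lambda>x. f' x v)"
    using assms unfolding C1_def by metis
  show ?thesis
  proof (rule C1I[where f'="\<lambda>x v. f' (l x) (l v)"])
    show "((\<lambda>x. f (l x)) has_derivative (\<lambda>v. f' (l x) (l v))) (at x)" for x
      by (rule has_derivative_compose[OF bounded_linear_imp_has_derivative[OF assms(2)] f'(1)])
    show "continuous_on UNIV (\<lambda>x. f' (l x) (l v))" for v
      by (rule continuous_on_compose2[OF f'(2) linear_continuous_on[OF assms(2)]]) auto
  qed
qed

lemma C1_minus: "C1 f \<Longrightarrow> C1 (\<lambda>x. - f x)"
  by (rule C1_linear_compose[OF bounded_linear_minus[OF bounded_linear_ident]])

lemma C1_diff: "C1 f \<Longrightarrow> C1 g \<Longrightarrow> C1 (\<lambda>x. f x - g x)"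
  using C1_add[of f "\<lambda>x. - g x"] C1_minus[of g] by simp

lemma C1_sum: "(\<And>i. i \<in> S \<Longrightarrow> C1 (f i)) \<Longrightarrow> C1 (\<lambda>x. \<Sum>i\<in>S. f i x)"
  by (induction S rule: infinite_finite_induct) (auto intro: C1_const C1_add)

lemma C1_continuous: "C1 f \<Longrightarrow> continuous_on S f"
  unfolding C1_def by (meson continuous_at_imp_continuous_on has_derivative_continuous)

lemma C1_mult:
  fixes f g :: "'a::euclidean_space \<Rightarrow> real"
  assumes "C1 f" "C1 g" shows "C1 (\<lambda>x. f x * g x)"
proof -
  obtain f' where f': "\<And>x. (f has_derivative f' x) (at x)" "\<And>v. continuous_on UNIV (\<lambda>x. f' x v)"
    using assms unfolding C1_def by metis
  obtain g' where g': "\<And>x. (g has_derivative g' x) (at x)" "\<And>v. continuous_on UNIV (\<lambda>x. g' x v)"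
    using assms unfolding C1_def by metis
  show ?thesis
  proof (rule C1I[where f'="\<lambda>x v. f x * g' x v + f' x v * g x"])
    show "((\<lambda>x. f x * g x) has_derivative (\<lambda>v. f x * g' x v + f' x v * g x)) (at x)" for x
      by (rule has_derivative_mult[OF f'(1) g'(1)])
    show "continuous_on UNIV (\<lambda>x. f x * g' x v + f' x v * g x)" for v
      by (rule continuous_on_add[OF continuous_on_mult[OF C1_continuous[OF assms(1)] g'(2)]
            continuous_on_mult[OF f'(2) C1_continuous[OF assms(2)]]])
  qed
qed

lemma C1_cmult: "C1 f \<Longrightarrow> C1 (\<lambda>x. (c::real) * f x)"
  by (rule C1_mult[OF C1_const])

lemma C1_real:
  fixes f :: "real \<Rightarrow> real"
  assumes "\<And>x. DERIV f x :> f' x" "continuous_on UNIV f'" shows "C1 f"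
proof (rule C1I[where f'="\<lambda>x v. f' x * v"])
  show "(f has_derivative (\<lambda>v. f' x * v)) (at x)" for x
    using assms(1)[of x] by (simp add: has_field_derivative_def)
  show "continuous_on UNIV (\<lambda>x. f' x * v)" for v
    by (rule continuous_on_mult[OF assms(2) continuous_on_const])
qed

lemma C1_real_compose:
  fixes f :: "real \<Rightarrow> real"
  assumes "C1 f" "C1 g" shows "C1 (\<lambda>x. f (g x))"
proof -
  obtain f' where f': "\<And>x. (f has_derivative f' x) (at x)" "\<And>v. continuous_on UNIV (\<lambda>x. f' x v)"
    using assms unfolding C1_def by metis
  obtain g' where g': "\<And>x. (g has_derivative g' x) (at x)" "\<And>v. continuous_on UNIV (\<lambda>x. g' x v)"
    using assms unfolding C1_def by metis
  have f1: "f' y v = v * f' y 1" for y v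
    using linear_scale[OF has_derivative_linear[OF f'(1)], of y v 1] by simp
  have d: "((\<lambda>x. f (g x)) has_derivative (\<lambda>v. f' (g x) (g' x v))) (at x)" for x
    by (rule has_derivative_compose[OF g'(1) f'(1)])
  show ?thesis
  proof (rule C1I[OF d])
    show "continuous_on UNIV (\<lambda>x. f' (g x) (g' x v))" for v
      by (subst f1, rule continuous_on_mult[OF g'(2) continuous_on_compose2[OF f'(2) C1_continuous[OF assms(2)]]]) simp
  qed
qed

lemma C1_cos: "C1 (cos :: real \<Rightarrow> real)" and C1_sin: "C1 (sin :: real \<Rightarrow> real)"
  by (rule C1_real[OF DERIV_cos], intro continuous_intros) (rule C1_real[OF DERIV_sin], intro continuous_intros)

lemma C1_inverse:
  fixes f :: "'a::euclidean_space \<Rightarrow> real"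
  assumes "C1 f" "\<And>x. f x \<noteq> 0" shows "C1 (\<lambda>x. inverse (f x))"
proof -
  obtain f' where f': "\<And>x. (f has_derivative f' x) (at x)" "\<And>v. continuous_on UNIV (\<lambda>x. f' x v)"
    using assms unfolding C1_def by metis
  have c: "continuous_on UNIV (\<lambda>x. inverse (f x))"
    by (rule continuous_on_inverse[OF C1_continuous[OF assms(1)]]) (simp add: assms)
  show ?thesis
  proof (rule C1I[where f'="\<lambda>x v. - (inverse (f x) * f' x v * inverse (f x))"])
    show "((\<lambda>x. inverse (f x)) has_derivative (\<lambda>v. - (inverse (f x) * f' x v * inverse (f x)))) (at x)" for x
      by (rule Deriv.has_derivative_inverse[OF assms(2) f'(1)])
    show "continuous_on UNIV (\<lambda>x. - (inverse (f x) * f' x v * inverse (f x)))" for v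
      by (rule continuous_on_minus[OF continuous_on_mult[OF continuous_on_mult[OF c f'(2)] c]])
  qed
qed

lemma C1_vec:
  fixes f :: "'a::euclidean_space \<Rightarrow> real^'n"
  assumes "\<And>i. C1 (\<lambda>x. f x $ i)" shows "C1 f"
proof -
  obtain f' where f': "\<And>i x. ((\<lambda>x. f x $ i) has_derivative f' i x) (at x)"
     "\<And>i v. continuous_on UNIV (\<lambda>x. f' i x v)"
    using assms unfolding C1_def by metis
  show ?thesis
  proof (rule C1I[where f'="\<lambda>x v. \<chi> i. f' i x v"])
    show "(f has_derivative (\<lambda>v. \<chi> i. f' i x v)) (at x)" for x
    proof (subst has_derivative_componentwise_within, intro ballI)
      fix e :: "real^'n" assume "e \<in> Basis"
      then obtain i where e: "e = axis i 1" by (auto simp: Basis_vec_def)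
      show "((\<lambda>x. f x \<bullet> e) has_derivative (\<lambda>v. (\<chi> i. f' i x v) \<bullet> e)) (at x)"
        using f'(1)[of i x] by (simp add: e inner_axis)
    qed
    show "continuous_on UNIV (\<lambda>x. \<chi> i. f' i x v)" for v
      by (intro continuous_intros f')
  qed
qed

lemma C1_Pair:
  assumes "C1 f" "C1 g" shows "C1 (\<lambda>x. (f x, g x))"
proof -
  obtain f' g' where "\<And>x. (f has_derivative f' x) (at x)" "\<And>v. continuous_on UNIV (\<lambda>x. f' x v)"
    "\<And>x. (g has_derivative g' x) (at x)" "\<And>v. continuous_on UNIV (\<lambda>x. g' x v)"
    using assms unfolding C1_def by metis
  then show ?thesis by (intro C1I[where f'="\<lambda>x v. (f' x v, g' x v)"] has_derivative_Pair continuous_intros)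
qed

text \<open>In finite dimension continuity of every directional derivative is continuity in operator
  norm, the form that \<open>c1_flow\<close> expects.\<close>

lemma C1_blinfun:
  assumes "C1 f"
  obtains f' where "\<And>x. (f has_derivative blinfun_apply (f' x)) (at x)" "continuous_on UNIV f'"
proof -
  obtain f' where f': "\<And>x. (f has_derivative f' x) (at x)" "\<And>v. continuous_on UNIV (\<lambda>x. f' x v)"
    using assms unfolding C1_def by metis
  have ap: "blinfun_apply (Blinfun (f' x)) = f' x" for x
    by (intro bounded_linear_Blinfun_apply has_derivative_bounded_linear[OF f'(1)])
  show thesis
  proof (rule that[of "\<lambda>x. Blinfun (f' x)"])
    show "continuous_on UNIV (\<lambda>x. Blinfun (f' x))"
    proof (rule continuous_at_imp_continuous_on, safe)
      fix x show "isCont (\<lambda>x. Blinfun (f' x)) x"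
      proof (rule continuous_blinfun_componentwiseI1)
        fix v show "isCont (\<lambda>x. blinfun_apply (Blinfun (f' x)) v) x"
          using f'(2)[of v] continuous_on_eq_continuous_at[OF open_UNIV] unfolding ap by blast
      qed
    qed
  qed (simp add: ap f')
qed

section \<open>Smooth truncations\<close>

text \<open>The slope is 1 up to 0, falls linearly to 0 at 1 and then stays 0. This gives a
  continuously differentiable, nondecreasing, 1-Lipschitz function that is the identity on the
  negative axis and bounded above.\<close>

definition ramp :: "real \<Rightarrow> real" where
  "ramp = (SOME P. P 0 = 0 \<and> (\<forall>y. DERIV P y :> max 0 (1 - max 0 y)))"

lemma ramp_0: "ramp 0 = 0" and ramp_DERIV: "DERIV ramp y :> max 0 (1 - max 0 y)"
proof -
  have "continuous_on UNIV (\<lambda>y::real. max 0 (1 - max 0 y))" by (intro continuous_intros)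
  then have "\<exists>P. P 0 = 0 \<and> (\<forall>y::real. DERIV P y :> max 0 (1 - max 0 y))"
    unfolding has_real_derivative_iff_has_vector_derivative by (metis antiderivative_on_UNIV)
  from someI_ex[OF this] show "ramp 0 = 0" "DERIV ramp y :> max 0 (1 - max 0 y)"
    unfolding ramp_def by auto
qed

lemma C1_ramp: "C1 ramp"
  by (rule C1_real[OF ramp_DERIV]) (intro continuous_intros)

lemma ramp_mono:
  assumes "y \<le> z" shows "ramp y \<le> ramp z" "ramp z - ramp y \<le> z - y"
proof -
  show "ramp y \<le> ramp z"
    by (rule DERIV_nonneg_imp_nondecreasing[OF assms]) (use ramp_DERIV in fastforce)
  have "y - ramp y \<le> z - ramp z"
  proof (rule DERIV_nonneg_imp_nondecreasing[OF assms, of "\<lambda>x. x - ramp x"], intro exI conjI)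
    show "((\<lambda>x. x - ramp x) has_real_derivative 1 - max 0 (1 - max 0 x)) (at x)" for x
      by (intro derivative_intros ramp_DERIV)
  qed auto
  then show "ramp z - ramp y \<le> z - y" by simp
qed

lemma ramp_id:
  assumes "y \<le> 0" shows "ramp y = y"
proof -
  have "ramp y - y \<le> ramp 0 - 0"
  proof (rule DERIV_nonneg_imp_nondecreasing[OF assms, of "\<lambda>x. ramp x - x"], intro exI conjI)
    show "((\<lambda>x. ramp x - x) has_real_derivative max 0 (1 - max 0 x) - 1) (at x)" for x
      by (intro derivative_intros ramp_DERIV)
  qed auto
  then show ?thesis using ramp_mono(2)[OF assms] by (simp add: ramp_0)
qed

lemma ramp_le: "ramp y \<le> 1"
proof (cases "y \<le> 1")
  case True
  then show ?thesis using ramp_mono(2)[of 0 y] ramp_id[of y] by (cases "y \<le> 0") (auto simp: ramp_0)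
next
  case False
  have "ramp y \<le> ramp 1"
    by (rule DERIV_nonpos_imp_nonincreasing[of 1 y]) (use False ramp_DERIV in fastforce)+
  then show ?thesis using ramp_mono(2)[of 0 1] by (simp add: ramp_0)
qed

definition up :: "real \<Rightarrow> real \<Rightarrow> real" where "up R y = R + ramp (y - R)"

definition clamp2 :: "real \<Rightarrow> real \<Rightarrow> real" where "clamp2 R y = - up R (- up R y)"

text \<open>A floor built from the cap: the identity above \<open>c\<close>, never below
  \<open>c / 2\<close>. It keeps the coefficient of the fast equation away from 0 outside
  \<open>D\<close> without changing it over \<open>D\<close>.\<close>

definition lowclamp :: "real \<Rightarrow> real \<Rightarrow> real" where
  "lowclamp c y = c - c / 2 * ramp ((c - y) * (2 / c))"

text \<open>Scaling a fixed clamp keeps the slope at most 1 for every \<open>r\<close>, while the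
  range shrinks into \<open>{- 2 * r..2 * r}\<close> and the identity remains on
  \<open>{- r..r}\<close>.\<close>

definition smallclamp :: "real \<Rightarrow> real \<Rightarrow> real" where "smallclamp r y = r * clamp2 1 (y / r)"

lemma up_mono: "y \<le> z \<Longrightarrow> up R y \<le> up R z" "y \<le> z \<Longrightarrow> up R z - up R y \<le> z - y"
  using ramp_mono[of "y - R" "z - R"] by (auto simp: up_def)

lemma clamp2_mono:
  assumes "y \<le> z" shows "clamp2 R y \<le> clamp2 R z" "clamp2 R z - clamp2 R y \<le> z - y"
  using up_mono[OF assms, of R] up_mono[of "- up R z" "- up R y" R] by (auto simp: clamp2_def)

lemma clamp2_id: "\<bar>y\<bar> \<le> R \<Longrightarrow> clamp2 R y = y"
  using ramp_id[of "y - R"] ramp_id[of "- y - R"] by (auto simp: clamp2_def up_def)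

lemma clamp2_le: 
  assumes "R \<ge> 0" shows "\<bar>clamp2 R y\<bar> \<le> R + 1"
proof -
  have v: "up R y \<le> R + 1" "up R (- up R y) \<le> R + 1" using ramp_le by (simp_all add: up_def)
  have "- (R + 1) \<le> up R (- up R y)"
  proof (cases "- up R y \<le> R")
    case True
    then show ?thesis using ramp_id[of "- up R y - R"] v by (simp add: up_def[of R "- up R y"])
  next
    case False
    then have "up R R \<le> up R (- up R y)" by (intro up_mono) simp
    then show ?thesis using assms by (simp add: up_def[of R R] ramp_0)
  qed
  then show ?thesis using v(2) by (simp add: clamp2_def abs_le_iff)
qed

lemma clamp2_lip: "\<bar>clamp2 R y - clamp2 R z\<bar> \<le> \<bar>y - z\<bar>"
  using clamp2_mono[of y z R] clamp2_mono[of z y R] by (cases "y \<le> z") auto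

lemma Lip_clamp2: "Lip (clamp2 R)"
  by (rule LipI[where L=1]) (auto simp: clamp2_lip)

lemma Bd_clamp2: "R \<ge> 0 \<Longrightarrow> Bd (clamp2 R)"
  by (rule BdI[where M="R + 1"]) (simp add: clamp2_le)

lemma C1_clamp2: "C1 (clamp2 R)"
proof -
  have "C1 (\<lambda>y. up R (f y))" if "C1 f" for f :: "real \<Rightarrow> real"
    unfolding up_def by (rule C1_add[OF C1_const C1_real_compose[OF C1_ramp C1_diff[OF that C1_const]]])
  from C1_minus[OF this[OF C1_minus[OF this[OF C1_linear[OF bounded_linear_ident]]]]]
  show ?thesis by (simp add: clamp2_def[abs_def])
qed

lemma smallclamp_mono:
  assumes "y \<le> z" "r > 0"
  shows "smallclamp r y \<le> smallclamp r z" "smallclamp r z - smallclamp r y \<le> z - y"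
proof -
  have le: "y / r \<le> z / r" using assms by (simp add: divide_right_mono)
  show "smallclamp r y \<le> smallclamp r z" unfolding smallclamp_def using clamp2_mono(1)[OF le] assms by simp
  have "smallclamp r z - smallclamp r y = r * (clamp2 1 (z / r) - clamp2 1 (y / r))" by (simp add: smallclamp_def algebra_simps)
  also have "\<dots> \<le> r * (z / r - y / r)" using clamp2_mono(2)[OF le] assms by (intro mult_left_mono) auto
  also have "\<dots> = z - y" using assms by (simp add: right_diff_distrib)
  finally show "smallclamp r z - smallclamp r y \<le> z - y" .
qed

lemma smallclamp_id: "\<bar>y\<bar> \<le> r \<Longrightarrow> r > 0 \<Longrightarrow> smallclamp r y = y"
  using clamp2_id[of "y / r" 1] by (simp add: smallclamp_def abs_divide)

lemma smallclamp_le: "r > 0 \<Longrightarrow> \<bar>smallclamp r y\<bar> \<le> 2 * r"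
  using clamp2_le[of 1 "y / r"] by (simp add: smallclamp_def abs_mult)

lemma C1_smallclamp: "C1 (smallclamp r)"
  unfolding smallclamp_def[abs_def]
  by (rule C1_cmult[OF C1_real_compose[OF C1_clamp2 C1_linear[OF bounded_linear_divide]]])

lemma Lip_smallclamp: "r > 0 \<Longrightarrow> Lip (smallclamp r)"
  unfolding smallclamp_def[abs_def]
  by (rule Lip_cmult[OF Lip_compose[OF Lip_clamp2 Lip_linear[OF bounded_linear_divide]]])

lemma lowclamp_id: "c > 0 \<Longrightarrow> c \<le> y \<Longrightarrow> lowclamp c y = y"
  by (subst lowclamp_def, subst ramp_id) (auto simp: mult_nonpos_nonneg field_simps)

lemma lowclamp_ge: "c > 0 \<Longrightarrow> c / 2 \<le> lowclamp c y"
  using ramp_le[of "(c - y) * (2 / c)"] mult_left_mono[of "ramp ((c - y) * (2 / c))" 1 "c / 2"]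
  by (simp add: lowclamp_def)

lemma ramp_lip: "\<bar>ramp y - ramp z\<bar> \<le> \<bar>y - z\<bar>"
  using ramp_mono[of y z] ramp_mono[of z y] by (cases "y \<le> z") auto

lemma Lip_lowclamp: "Lip (lowclamp c)"
proof -
  have "Lip ramp" by (rule LipI[where L=1]) (auto simp: ramp_lip)
  then have "Lip (\<lambda>y. ramp ((c - y) * (2 / c)))"
    by (rule Lip_compose[OF _ Lip_compose[OF Lip_linear[OF bounded_linear_mult_left]
          Lip_diff[OF Lip_const Lip_linear[OF bounded_linear_ident]]]])
  then show ?thesis unfolding lowclamp_def[abs_def]
    by (rule Lip_diff[OF Lip_const Lip_cmult])
qed

lemma C1_lowclamp: "C1 (lowclamp c)"
  unfolding lowclamp_def[abs_def]
  by (rule C1_diff[OF C1_const C1_cmult[OF C1_real_compose[OF C1_ramp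
        C1_mult[OF C1_diff[OF C1_const C1_linear[OF bounded_linear_ident]] C1_const]]]])

lemma Bd_lip_compose:
  fixes \<phi> :: "'b::real_normed_vector \<Rightarrow> 'c::real_normed_vector"
  assumes "Lip \<phi>" "Bd f" shows "Bd (\<lambda>x. \<phi> (f x))"
proof -
  obtain L where L: "L \<ge> 0" "\<And>x y. norm (\<phi> x - \<phi> y) \<le> L * norm (x - y)" using assms(1) unfolding Lip_def by blast
  obtain M where M: "M \<ge> 0" "\<And>x. norm (f x) \<le> M" using assms(2) unfolding Bd_def by blast
  show ?thesis
  proof (rule BdI[where M="L * M + norm (\<phi> 0)"])
    fix x
    have "L * norm (f x - 0) \<le> L * M" using mult_left_mono[OF M(2)[of x] L(1)] by simp
    then show "norm (\<phi> (f x)) \<le> L * M + norm (\<phi> 0)"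
      using L(2)[of "f x" 0] norm_triangle_sub[of "\<phi> (f x)" "\<phi> 0"] by linarith
  qed
qed

text \<open>The clamp confines the argument to a compact interval, on which a continuously
  differentiable function is bounded and Lipschitz, so the growth of \<open>I\<close> does not
  matter.\<close>

lemma truncated_function:
  fixes I :: "real \<Rightarrow> real"
  assumes "C1 I" "R \<ge> 0"
  shows "C1 (\<lambda>y. I (clamp2 R y))" "Lip (\<lambda>y. I (clamp2 R y))" "Bd (\<lambda>y. I (clamp2 R y))"
proof -
  show "C1 (\<lambda>y. I (clamp2 R y))" by (rule C1_real_compose[OF assms(1) C1_clamp2])
  obtain f' where f': "\<And>x. (I has_derivative f' x) (at x)" "\<And>v. continuous_on UNIV (\<lambda>x. f' x v)"
    using assms(1) unfolding C1_def by metis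
  let ?S = "{-(R+1)..R+1}"
  have mem: "clamp2 R y \<in> ?S" for y using clamp2_le[OF assms(2), of y] by (auto simp: abs_le_iff)
  have "bounded ((\<lambda>x. f' x 1) ` ?S)"
    by (intro compact_imp_bounded compact_continuous_image continuous_on_subset[OF f'(2)]) auto
  then obtain M where "\<forall>z\<in>(\<lambda>x. f' x 1) ` ?S. norm z \<le> M" unfolding bounded_iff by blast
  then have M: "\<bar>f' x 1\<bar> \<le> M" if "x \<in> ?S" for x using that by auto
  have D: "(I has_real_derivative f' x 1) (at x within ?S)" for x
  proof -
    have "f' x = (*) (f' x 1)"
    proof
      show "f' x v = f' x 1 * v" for v
        using linear_scale[OF has_derivative_linear[OF f'(1)], of x v 1] by simp
    qed
    then show ?thesis unfolding has_field_derivative_def using has_derivative_at_withinI[OF f'(1)[of x]] by metis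
  qed
  show "Lip (\<lambda>y. I (clamp2 R y))"
  proof (rule LipI[where L=M])
    show M0: "0 \<le> M" using M[of 0] assms(2) by force
    fix x y
    have "norm (I (clamp2 R x) - I (clamp2 R y)) \<le> M * norm (clamp2 R x - clamp2 R y)"
      by (rule field_differentiable_bound[of ?S I "\<lambda>x. f' x 1"]) (use D M mem in auto)
    also have "\<dots> \<le> M * norm (x - y)" using clamp2_lip M0 by (intro mult_left_mono) auto
    finally show "norm (I (clamp2 R x) - I (clamp2 R y)) \<le> M * norm (x - y)" .
  qed
  have "bounded (I ` ?S)"
    by (intro compact_imp_bounded compact_continuous_image C1_continuous assms) auto
  then obtain N where "\<forall>z\<in>I ` ?S. norm z \<le> N" unfolding bounded_iff by blast
  then have N: "\<bar>I x\<bar> \<le> N" if "x \<in> ?S" for x using that by auto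
  show "Bd (\<lambda>y. I (clamp2 R y))" by (rule BdI[where M=N]) (use N mem in auto)
qed


text \<open>Trades the Euclidean norm for the maximum norm in the fast variables, the mixed form in
  which \<open>hyperbolic_split\<close> states its slow estimate; the dimension enters the
  constant.\<close>

lemma Lip_sup_bound:
  fixes f :: "(real^'n) \<times> 'x::real_normed_vector \<Rightarrow> 'b::real_normed_vector"
  assumes "Lip f"
  obtains L where "L > 0"
    "\<And>u v x y m. (\<And>i. \<bar>u$i - v$i\<bar> \<le> m) \<Longrightarrow> norm (f (u, x) - f (v, y)) \<le> L * (m + norm (x - y))"
proof -
  obtain A where A: "A \<ge> 0" "\<And>z w. norm (f z - f w) \<le> A * norm (z - w)" using assms unfolding Lip_def by blast
  define L where "L = A * CARD('n) + 1"
  have "norm (f (u, x) - f (v, y)) \<le> L * (m + norm (x - y))" if m: "\<And>i. \<bar>u$i - v$i\<bar> \<le> m" for u v x y m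
  proof -
    have m0: "m \<ge> 0" using m by (meson abs_ge_zero order_trans)
    have N: "real CARD('n) \<ge> 1" by (simp add: Suc_le_eq)
    have "norm ((u, x) - (v, y)) \<le> norm (u - v) + norm (x - y)" using norm_Pair_le[of "u - v" "x - y"] by simp
    also have "norm (u - v) \<le> CARD('n) * m" by (rule norm_vec_le_CARD) (use m in simp)
    also have "norm (x - y) \<le> CARD('n) * norm (x - y)" using mult_right_mono[OF N, of "norm (x - y)"] by simp
    finally have "A * norm ((u, x) - (v, y)) \<le> A * (CARD('n) * m + CARD('n) * norm (x - y))"
      using A(1) by (intro mult_left_mono) auto
    then have "norm (f (u, x) - f (v, y)) \<le> A * CARD('n) * (m + norm (x - y))"
      using A(2)[of "(u, x)" "(v, y)"] by (simp add: algebra_simps)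
    also have "\<dots> \<le> L * (m + norm (x - y))" using m0 by (intro mult_right_mono) (auto simp: L_def)
    finally show ?thesis .
  qed
  moreover have "L > 0" using A by (simp add: L_def add_nonneg_pos)
  ultimately show thesis using that by blast
qed

section \<open>Sine and cosine near multiples of pi\<close>

lemma cos_ge_half: "\<bar>y::real\<bar> \<le> 1 \<Longrightarrow> 1/2 \<le> cos y"
proof -
  assume "\<bar>y\<bar> \<le> 1"
  then have "cos (pi/3) \<le> cos \<bar>y\<bar>" using pi_gt3 by (intro cos_monotone_0_pi_le) auto
  then show ?thesis by (simp add: cos_60)
qed

lemma abs_one_minus_cos_le: "\<bar>1 - cos y\<bar> \<le> \<bar>y\<bar>" for y :: real
  using field_differentiable_bound[of UNIV cos "\<lambda>x. - sin x" 1 0 y] by (auto intro!: derivative_eq_intros)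

lemma sin_diff_ge_half:
  fixes y z :: real
  assumes "z \<le> y" "\<bar>y\<bar> \<le> 1" "\<bar>z\<bar> \<le> 1" shows "(y - z) / 2 \<le> sin y - sin z"
proof -
  have "sin z - z / 2 \<le> sin y - y / 2"
  proof (rule DERIV_nonneg_imp_nondecreasing[OF assms(1), of "\<lambda>x. sin x - x / 2"], intro exI conjI)
    fix x assume x: "z \<le> x" "x \<le> y"
    show "((\<lambda>x. sin x - x / 2) has_real_derivative cos x - 1/2) (at x)" by (auto intro!: derivative_eq_intros)
    show "0 \<le> cos x - 1/2" using cos_ge_half[of x] x assms by (simp add: abs_le_iff)
  qed
  then show ?thesis by (simp add: field_simps)
qed

lemma abs_sin_minus_le:
  fixes y :: real assumes "\<bar>y\<bar> \<le> 1" shows "\<bar>sin y - y\<bar> \<le> y\<^sup>2"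
proof -
  have "\<bar>sin y - (\<Sum>m<3. sin_coeff m * y ^ m)\<bar> \<le> inverse (fact 3) * \<bar>y\<bar> ^ 3"
    by (rule Maclaurin_sin_bound)
  moreover have "(\<Sum>m<3. sin_coeff m * y ^ m) = y"
    by (simp add: sin_coeff_def numeral_3_eq_3)
  moreover have "inverse (fact 3) * \<bar>y\<bar> ^ 3 \<le> y\<^sup>2"
  proof -
    have "\<bar>y\<bar> ^ 3 \<le> \<bar>y\<bar> ^ 2" using assms by (intro power_decreasing) auto
    moreover have "inverse (fact 3) * \<bar>y\<bar> ^ 3 \<le> 1 * \<bar>y\<bar> ^ 3" by (intro mult_right_mono) (auto simp: fact_numeral)
    ultimately show ?thesis by simp
  qed
  ultimately show ?thesis by simp
qed

lemma powi_minus_one_cases: "(-1::real) powi m = 1 \<or> (-1::real) powi m = -1"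
  by (cases "even m") auto

lemma sin_cos_add_int_pi:
  "sin (y + of_int m * pi) = (-1) powi m * sin y" "cos (y + of_int m * pi) = (-1) powi m * cos y"
proof -
  have "cos (of_int m * pi) = (-1) powi m \<and> sin (of_int m * pi) = 0"
  proof (cases "even m")
    case True
    then obtain n where "m = 2 * n" by (rule evenE)
    then have "of_int m * pi = 2 * pi * of_int n" by simp
    moreover have "(-1::real) powi m = 1" using True by simp
    ultimately show ?thesis by (metis cos_int_2pin sin_int_2pin)
  next
    case False
    then obtain n where n: "m = 2 * n + 1" by (rule oddE)
    then have "of_int m * pi = 2 * pi * of_int n + pi" by (simp add: algebra_simps)
    then show ?thesis using False cos_int_2pin[of n] sin_int_2pin[of n]
      by (simp add: cos_add sin_add)
  qed
  then show "sin (y + of_int m * pi) = (-1) powi m * sin y" "cos (y + of_int m * pi) = (-1) powi m * cos y"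
    by (simp_all add: sin_add cos_add mult.commute)
qed

section \<open>The truncated system\<close>

text \<open>The fast variable is $u_i = \Omega_i + \omega_i - k_i\pi$, with \<open>s i\<close> $= (-1)^{k_i}$ and \<open>\<sigma>\<close> the sign
  of $I(\theta) - \sum_j (-1)^{k_j}\alpha_j$ on $D$. On $D$ and for small $u$ the truncations are inactive:
  \<open>Aa\<close> is the absolute value of $I(\theta) - \sum_j \alpha_j\cos(\Omega_j+\omega_j)$ and
  \<open>p x i\<close> is $k_i\pi - \Omega_i$, while \<open>\<epsilon> * q x\<close> is the first order term of the expansion of $u$.
  Component \<open>i\<close> is contracting iff \<open>sg i = 1\<close>.\<close>

locale truncated_system =
  fixes I :: "real \<Rightarrow> real" and lam \<eta> :: real and k :: "'n::finite \<Rightarrow> int" and \<sigma> R c :: real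
  assumes C1_I: "C1 I" and lam: "lam > 0" and \<sigma>: "\<sigma> = 1 \<or> \<sigma> = -1" and R: "R \<ge> 0" and c: "c > 0"
begin

definition s :: "'n \<Rightarrow> real" where "s i = (-1) powi k i"

definition sg :: "'n \<Rightarrow> real" where "sg i = s i * \<sigma>"

definition In :: "real^'n \<Rightarrow> 'n slow \<Rightarrow> real" where
  "In u x = I (clamp2 R (snd (snd x))) - (\<Sum>j\<in>UNIV. s j * (clamp2 R (fst (snd x) $ j) * cos (u $ j)))"

definition Aa :: "real^'n \<Rightarrow> 'n slow \<Rightarrow> real" where "Aa u x = lowclamp c (\<sigma> * In u x)"

definition p :: "'n slow \<Rightarrow> 'n \<Rightarrow> real" where "p x i = of_int (k i) * pi - clamp2 R (fst x $ i)"

text \<open>The balance of \<open>(sg i / \<epsilon>) * Aa 0 x * u$i\<close> with the drift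
  \<open>lam * p x i\<close>, solved for \<open>u$i\<close> and divided by \<epsilon>; dividing by
  \<open>sg i\<close> is multiplying by it, since its square is 1.\<close>

definition q :: "'n slow \<Rightarrow> real^'n" where "q x = (\<chi> i. lam * (sg i * (p x i * inverse (Aa 0 x))))"

definition gg :: "real^'n \<Rightarrow> 'n slow \<Rightarrow> 'n slow" where
  "gg u x = (\<chi> i. lam * (u $ i + p x i), \<chi> i. \<eta> * (s i * (cos (u $ i) * In u x)), 1)"

text \<open>\<open>u\<close> contains \<open>\<Omega>\<close>, so the slow velocity
  \<open>lam * \<omega>\<close> enters its equation, with \<open>\<omega>\<close> written as
  \<open>u + p\<close>. The linear term vanishes for \<open>\<bar>u$i\<bar> \<le> r\<close> and
  supplies the monotonicity where the clamped sine flattens, which makes hyperbolicity global in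
  \<open>u\<close>.\<close>

definition FF :: "real \<Rightarrow> real \<Rightarrow> real^'n \<Rightarrow> 'n slow \<Rightarrow> real^'n" where
  "FF r \<epsilon> u x = (\<chi> i. - (sg i / \<epsilon>) * (Aa u x * sin (smallclamp r (u $ i)) + c / 2 * (u $ i - smallclamp r (u $ i)))
     + lam * (u $ i + p x i))"

lemma s_cases: "s i = 1 \<or> s i = -1" unfolding s_def by (rule powi_minus_one_cases)

lemma sg_cases: "sg i = 1 \<or> sg i = -1" unfolding sg_def using s_cases[of i] \<sigma> by auto

lemma lin_z:
  "bounded_linear (\<lambda>z::(real^'n) \<times> 'n slow. fst z $ i)"
  "bounded_linear (\<lambda>z::(real^'n) \<times> 'n slow. fst (snd z) $ i)"
  "bounded_linear (\<lambda>z::(real^'n) \<times> 'n slow. fst (snd (snd z)) $ i)"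
  "bounded_linear (\<lambda>z::(real^'n) \<times> 'n slow. snd (snd (snd z)))"
  by (intro bounded_linear_compose[OF bounded_linear_vec_nth] bounded_linear_compose[OF bounded_linear_fst]
       bounded_linear_compose[OF bounded_linear_snd] bounded_linear_snd bounded_linear_fst)+

lemma In_reg:
  "C1 (\<lambda>z. In (fst z) (snd z))" "Lip (\<lambda>z. In (fst z) (snd z))" "Bd (\<lambda>z. In (fst z) (snd z))"
proof -
  note I' = truncated_function[OF C1_I R]
  show "C1 (\<lambda>z. In (fst z) (snd z))" unfolding In_def
    by (intro C1_diff C1_real_compose[OF I'(1)] C1_sum C1_cmult C1_mult C1_real_compose[OF C1_clamp2]
        C1_real_compose[OF C1_cos] C1_linear lin_z)
  show "Lip (\<lambda>z. In (fst z) (snd z))" unfolding In_def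
    by (intro Lip_diff Lip_compose[OF I'(2)] Lip_sum Lip_cmult Lip_mult Lip_compose[OF Lip_clamp2]
        Lip_compose[OF Lip_cos] Lip_linear lin_z Bd_compose[OF Bd_clamp2[OF R]] Bd_compose[OF Bd_cos])
  show "Bd (\<lambda>z. In (fst z) (snd z))" unfolding In_def
    by (intro Bd_diff Bd_compose[OF I'(3)] Bd_sum Bd_mult Bd_const Bd_compose[OF Bd_clamp2[OF R]] Bd_compose[OF Bd_cos])
qed

lemma Aa_ge: "c / 2 \<le> Aa u x" unfolding Aa_def by (rule lowclamp_ge[OF c])

lemma Aa_pos: "Aa u x > 0" using Aa_ge[of u x] c by linarith

lemma Aa_reg:
  "C1 (\<lambda>z. Aa (fst z) (snd z))" "Lip (\<lambda>z. Aa (fst z) (snd z))" "Bd (\<lambda>z. Aa (fst z) (snd z))"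
  unfolding Aa_def
  by (intro C1_real_compose[OF C1_lowclamp] C1_cmult Lip_compose[OF Lip_lowclamp] Lip_cmult
      Bd_lip_compose[OF Lip_lowclamp] Bd_mult Bd_const In_reg)+

lemma p_reg:
  "C1 (\<lambda>x. p x i)" "Lip (\<lambda>x. p x i)" "Bd (\<lambda>x. p x i)"
  unfolding p_def
  by (intro C1_diff C1_const C1_real_compose[OF C1_clamp2] C1_linear Lip_diff Lip_const Lip_compose[OF Lip_clamp2]
      Lip_linear Bd_diff Bd_const Bd_compose[OF Bd_clamp2[OF R]]
      bounded_linear_compose[OF bounded_linear_vec_nth bounded_linear_fst])+

lemma p_lip: "\<bar>p x i - p y i\<bar> \<le> norm (x - y)"
proof -
  have "\<bar>p x i - p y i\<bar> \<le> \<bar>fst x $ i - fst y $ i\<bar>"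
    unfolding p_def using clamp2_lip[of R "fst x $ i" "fst y $ i"] by (simp add: abs_minus_commute)
  also have "\<dots> \<le> norm (fst (x - y))" using component_le_norm_cart[of "fst (x - y)" i] by simp
  also have "\<dots> \<le> norm (x - y)" by (metis norm_fst_le prod.collapse)
  finally show ?thesis .
qed

lemma lin_0: "bounded_linear (\<lambda>x::'n slow. (0::real^'n, x))"
  by (intro bounded_linear_Pair bounded_linear_zero bounded_linear_ident)

lemma Aa0_reg:
  "C1 (\<lambda>x. Aa 0 x)" "Lip (\<lambda>x. Aa 0 x)" "Bd (\<lambda>x. inverse (Aa 0 x))"
proof -
  show "C1 (\<lambda>x. Aa 0 x)" using C1_compose_linear[OF Aa_reg(1) lin_0] by simp
  show "Lip (\<lambda>x. Aa 0 x)" using Lip_compose[OF Aa_reg(2) Lip_linear[OF lin_0]] by simp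
  show "Bd (\<lambda>x. inverse (Aa 0 x))"
  proof (rule BdI[where M="inverse (c / 2)"])
    show "norm (inverse (Aa 0 x)) \<le> inverse (c / 2)" for x
      using Aa_ge[of 0 x] c Aa_pos[of 0 x] le_imp_inverse_le[of "c / 2" "Aa 0 x"] by simp
  qed
qed

lemma q_reg: "C1 q" "Lip q" "Bd q"
proof -
  have Ln: "Lip (\<lambda>x. inverse (Aa 0 x))" by (rule Lip_inverse[OF Aa0_reg(2) Aa_ge]) (use c in simp)
  have Cn: "C1 (\<lambda>x. inverse (Aa 0 x))" by (rule C1_inverse[OF Aa0_reg(1)]) (metis Aa_pos less_irrefl)
  show "C1 q" unfolding q_def by (rule C1_vec) (simp, intro C1_cmult C1_mult p_reg Cn)
  show "Lip q" unfolding q_def by (rule Lip_vec) (simp, intro Lip_cmult Lip_mult p_reg Ln Aa0_reg)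
  show "Bd q" unfolding q_def by (rule Bd_vec) (simp, intro Bd_mult Bd_const p_reg Aa0_reg)
qed

lemma gg_reg: "C1 (\<lambda>z. gg (fst z) (snd z))" "Lip (\<lambda>z. gg (fst z) (snd z))" "Bd (\<lambda>x. gg 0 x)"
proof -
  have p1: "C1 (\<lambda>z::(real^'n) \<times> 'n slow. p (snd z) i)" for i
    by (rule C1_compose_linear[OF p_reg(1) bounded_linear_snd])
  have p2: "Lip (\<lambda>z::(real^'n) \<times> 'n slow. p (snd z) i)" for i
    by (rule Lip_compose[OF p_reg(2) Lip_linear[OF bounded_linear_snd]])
  show "C1 (\<lambda>z. gg (fst z) (snd z))" unfolding gg_def
    by (rule C1_Pair[OF C1_vec C1_Pair[OF C1_vec C1_const]])
       (simp, intro C1_cmult C1_add C1_linear lin_z p1, simp, intro C1_cmult C1_mult In_reg C1_real_compose[OF C1_cos] C1_linear lin_z)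
  show "Lip (\<lambda>z. gg (fst z) (snd z))" unfolding gg_def
    by (rule Lip_Pair[OF Lip_vec Lip_Pair[OF Lip_vec Lip_const]])
       (simp, intro Lip_cmult Lip_add Lip_linear lin_z p2, simp,
        intro Lip_cmult Lip_mult In_reg Lip_compose[OF Lip_cos] Lip_linear lin_z Bd_compose[OF Bd_cos])
  have I0: "Bd (\<lambda>x. In 0 x)" using Bd_compose[OF In_reg(3), of "\<lambda>x. (0, x)"] by simp
  show "Bd (\<lambda>x. gg 0 x)" unfolding gg_def
    by (rule Bd_Pair[OF Bd_vec Bd_Pair[OF Bd_vec Bd_const]])
       (simp, intro Bd_mult Bd_const p_reg, simp, intro Bd_mult Bd_const I0)
qed

lemma FF_reg:
  assumes r: "r > 0"
  shows "C1 (\<lambda>z. FF r \<epsilon> (fst z) (snd z))" "Lip (\<lambda>z. FF r \<epsilon> (fst z) (snd z))"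
proof -
  have p1: "C1 (\<lambda>z::(real^'n) \<times> 'n slow. p (snd z) i)" for i
    by (rule C1_compose_linear[OF p_reg(1) bounded_linear_snd])
  have p2: "Lip (\<lambda>z::(real^'n) \<times> 'n slow. p (snd z) i)" for i
    by (rule Lip_compose[OF p_reg(2) Lip_linear[OF bounded_linear_snd]])
  note c1 = C1_real_compose[OF C1_smallclamp[of r] C1_linear[OF lin_z(1)]]
  note c2 = Lip_compose[OF Lip_smallclamp[OF r] Lip_linear[OF lin_z(1)]]
  show "C1 (\<lambda>z. FF r \<epsilon> (fst z) (snd z))" unfolding FF_def
    by (rule C1_vec) (simp only: vec_lambda_beta,
      intro C1_cmult C1_add C1_diff C1_mult C1_real_compose[OF C1_sin] c1 Aa_reg p1 C1_linear lin_z)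
  show "Lip (\<lambda>z. FF r \<epsilon> (fst z) (snd z))" unfolding FF_def
    by (rule Lip_vec) (simp only: vec_lambda_beta,
      intro Lip_cmult Lip_add Lip_diff Lip_mult Lip_compose[OF Lip_sin] c2 Aa_reg p2 Lip_linear lin_z
        Bd_compose[OF Bd_sin])
qed

text \<open>Up to the factor \<open>1 / \<epsilon>\<close>, the sine together with the linear term
  earns \<open>c / 4\<close>. The variation of \<open>Aa\<close> costs \<open>c / 16\<close>, since
  it is multiplied by a sine of size at most \<open>2 * r\<close>; the slow drift costs another
  \<open>c / 16\<close>, since it lacks the factor \<open>1 / \<epsilon>\<close>. What is left is
  \<open>c / 8\<close>.\<close>

lemma FF_hyperbolic:
  assumes r: "r > 0" "2 * r \<le> 1" and \<epsilon>: "\<epsilon> > 0" and K: "K \<ge> 0"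
    and LA: "\<And>u v x y m. (\<And>i. \<bar>u$i - v$i\<bar> \<le> m) \<Longrightarrow> \<bar>Aa u x - Aa v y\<bar> \<le> LA * (m + norm (x - y))" "LA \<ge> 0"
    and small: "2 * r * (LA * (1 + K)) \<le> c / 16" "\<epsilon> * (lam * (2 + K)) \<le> c / 16"
    and uv: "\<And>j. \<bar>u$j - v$j\<bar> \<le> \<bar>u$i - v$i\<bar>" and xy: "norm (x - y) \<le> K * \<bar>u$i - v$i\<bar>"
  shows "sg i * ((u$i - v$i) * (FF r \<epsilon> u x $ i - FF r \<epsilon> v y $ i)) \<le> - (c / (8 * \<epsilon>)) * (u$i - v$i)\<^sup>2"
proof -
  define d where "d = u$i - v$i"
  define a b where "a = smallclamp r (u$i)" and "b = smallclamp r (v$i)"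
  have ab1: "\<bar>a\<bar> \<le> 1" "\<bar>b\<bar> \<le> 2 * r" "\<bar>b\<bar> \<le> 1"
    using smallclamp_le[OF r(1), of "u$i"] smallclamp_le[OF r(1), of "v$i"] r by (auto simp: a_def b_def)
  have ab: "0 \<le> d \<and> 0 \<le> a - b \<and> a - b \<le> d \<or> d \<le> 0 \<and> a - b \<le> 0 \<and> d \<le> a - b"
    using smallclamp_mono[of "u$i" "v$i" r] smallclamp_mono[of "v$i" "u$i" r] r(1)
    by (cases "u$i \<le> v$i") (auto simp: a_def b_def d_def)
  have LAd: "\<bar>Aa u x - Aa v y\<bar> \<le> LA * (1 + K) * \<bar>d\<bar>"
  proof -
    have "\<bar>Aa u x - Aa v y\<bar> \<le> LA * (\<bar>d\<bar> + norm (x - y))" by (rule LA) (use uv in \<open>simp add: d_def\<close>)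
    also have "\<dots> \<le> LA * (\<bar>d\<bar> + K * \<bar>d\<bar>)" using xy LA(2) by (intro mult_left_mono) (auto simp: d_def)
    finally show ?thesis by (simp add: algebra_simps)
  qed
  define X where "X = Aa u x * sin a + c / 2 * (u$i - a) - (Aa v y * sin b + c / 2 * (v$i - b))"
  have X: "X * d \<ge> (c / 4 - c / 16) * d\<^sup>2"
  proof -
    have "X * d = Aa u x * ((sin a - sin b) * d) + (Aa u x - Aa v y) * sin b * d + c / 2 * ((d - (a - b)) * d)"
      by (simp add: X_def d_def field_simps)
    moreover have "Aa u x * ((sin a - sin b) * d) \<ge> c / 2 * ((a - b) / 2 * d)"
    proof -
      have "0 \<le> (a - b) / 2 * d" "(a - b) / 2 * d \<le> (sin a - sin b) * d"
      proof -
        show "0 \<le> (a - b) / 2 * d" using ab by (auto intro: mult_nonneg_nonneg mult_nonpos_nonpos)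
        from ab show "(a - b) / 2 * d \<le> (sin a - sin b) * d"
        proof
          assume "0 \<le> d \<and> 0 \<le> a - b \<and> a - b \<le> d"
          then show ?thesis using sin_diff_ge_half[of b a] ab1 by (intro mult_right_mono) auto
        next
          assume "d \<le> 0 \<and> a - b \<le> 0 \<and> d \<le> a - b"
          then show ?thesis using sin_diff_ge_half[of a b] ab1 by (intro mult_right_mono_neg) auto
        qed
      qed
      then show ?thesis using c Aa_pos[of u x] by (intro mult_mono[OF Aa_ge]) (linarith+)
    qed
    moreover have "(Aa u x - Aa v y) * sin b * d \<ge> - (c / 16 * d\<^sup>2)"
    proof -
      have "\<bar>(Aa u x - Aa v y) * sin b * d\<bar> \<le> (LA * (1 + K) * \<bar>d\<bar>) * (2 * r) * \<bar>d\<bar>"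
        unfolding abs_mult using LAd ab1 abs_sin_x_le_abs_x[of b] LA(2) K r
        by (intro mult_mono) (auto intro: order_trans)
      also have "\<dots> = 2 * r * (LA * (1 + K)) * (\<bar>d\<bar> * \<bar>d\<bar>)" by (simp only: mult_ac)
      also have "\<dots> = 2 * r * (LA * (1 + K)) * d\<^sup>2" by (simp add: power2_eq_square)
      also have "\<dots> \<le> c / 16 * d\<^sup>2" using small(1) by (rule mult_right_mono) simp
      finally show ?thesis by linarith
    qed
    \<comment> \<open>The clamped part of \<open>d\<close> only earns \<open>c / 4\<close>, because
      sine has slope at least 1/2 there. Lowering the coefficient of the unclamped part to the same
      value lets the two parts add up to \<open>d\<close>.\<close>
    moreover have "c / 2 * ((d - (a - b)) * d) \<ge> c / 4 * ((d - (a - b)) * d)"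
    proof (rule mult_right_mono)
      show "0 \<le> (d - (a - b)) * d" using ab by (auto intro: mult_nonneg_nonneg mult_nonpos_nonpos)
    qed (use c in simp)
    moreover have "c / 2 * ((a - b) / 2 * d) + c / 4 * ((d - (a - b)) * d) = c / 4 * d\<^sup>2"
      by (simp add: power2_eq_square field_simps)
    ultimately show ?thesis by (simp add: left_diff_distrib)
  qed
  have sq: "sg i * sg i = 1" using sg_cases[of i] by auto
  have lin: "\<bar>sg i * (d * (lam * (d + (p x i - p y i))))\<bar> \<le> lam * (1 + K) * d\<^sup>2"
  proof -
    have "\<bar>d + (p x i - p y i)\<bar> \<le> \<bar>d\<bar> + K * \<bar>d\<bar>" using p_lip[of x i y] xy by (simp add: d_def)
    then have "\<bar>d\<bar> * (lam * \<bar>d + (p x i - p y i)\<bar>) \<le> \<bar>d\<bar> * (lam * (\<bar>d\<bar> + K * \<bar>d\<bar>))"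
      using lam by (intro mult_left_mono) auto
    moreover have "\<bar>sg i\<bar> = 1" using sg_cases[of i] by auto
    then have "\<bar>sg i * (d * (lam * (d + (p x i - p y i))))\<bar> = \<bar>d\<bar> * (lam * \<bar>d + (p x i - p y i)\<bar>)"
      using lam by (simp add: abs_mult)
    moreover have "\<bar>d\<bar> * (lam * (\<bar>d\<bar> + K * \<bar>d\<bar>)) = lam * (1 + K) * d\<^sup>2"
    proof -
      have "\<bar>d\<bar> * (lam * (\<bar>d\<bar> + K * \<bar>d\<bar>)) = lam * (1 + K) * (\<bar>d\<bar> * \<bar>d\<bar>)" by (simp add: algebra_simps)
      then show ?thesis by (simp add: power2_eq_square)
    qed
    ultimately show ?thesis by linarith
  qed
  have "sg i * (d * (FF r \<epsilon> u x $ i - FF r \<epsilon> v y $ i)) =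
     - (sg i * sg i) / \<epsilon> * (X * d) + sg i * (d * (lam * (d + (p x i - p y i))))"
    by (simp add: FF_def X_def d_def a_def b_def algebra_simps diff_divide_distrib add_divide_distrib)
  also have "\<dots> \<le> - 1 / \<epsilon> * ((c / 4 - c / 16) * d\<^sup>2) + lam * (1 + K) * d\<^sup>2"
    unfolding sq using X lin \<epsilon> by (intro add_mono mult_left_mono_neg) auto
  also have "lam * (1 + K) * d\<^sup>2 \<le> (c / (16 * \<epsilon>)) * d\<^sup>2"
  proof (rule mult_right_mono)
    have "\<epsilon> * (lam * (1 + K)) \<le> \<epsilon> * (lam * (2 + K))" using lam \<epsilon> by simp
    then have "\<epsilon> * (lam * (1 + K)) \<le> c / 16" using small(2) by linarith
    then show "lam * (1 + K) \<le> c / (16 * \<epsilon>)" using \<epsilon> by (simp add: field_simps)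
  qed simp
  finally have "sg i * (d * (FF r \<epsilon> u x $ i - FF r \<epsilon> v y $ i)) \<le>
      - 1 / \<epsilon> * ((c / 4 - c / 16) * d\<^sup>2) + (c / (16 * \<epsilon>)) * d\<^sup>2" by simp
  also have "\<dots> = - (c / (8 * \<epsilon>)) * d\<^sup>2" using \<epsilon> by (simp add: field_simps)
  finally show ?thesis by (simp add: d_def)
qed

lemma In_near:
  assumes u: "\<And>i. \<bar>u $ i\<bar> \<le> r"
    and x: "\<And>i. \<bar>fst x $ i\<bar> \<le> R" "\<And>i. \<bar>fst (snd x) $ i\<bar> \<le> R" "\<bar>snd (snd x)\<bar> \<le> R"
  shows "\<bar>In u x - (I (snd (snd x)) - (\<Sum>j\<in>UNIV. s j * fst (snd x) $ j))\<bar> \<le> CARD('n) * (R * r)"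
proof -
  obtain \<Omega> \<alpha> \<theta> where xe: "x = (\<Omega>, \<alpha>, \<theta>)" by (cases x) auto
  have cl: "clamp2 R (\<alpha> $ i) = \<alpha> $ i" "clamp2 R \<theta> = \<theta>" for i
    using x by (auto simp: xe clamp2_id)
  have "In u x - (I \<theta> - (\<Sum>j\<in>UNIV. s j * \<alpha> $ j)) = (\<Sum>j\<in>UNIV. s j * (\<alpha> $ j * (1 - cos (u $ j))))"
    by (simp add: In_def xe cl algebra_simps sum_subtractf)
  also have "\<bar>\<dots>\<bar> \<le> (\<Sum>j\<in>UNIV. \<bar>s j * (\<alpha> $ j * (1 - cos (u $ j)))\<bar>)" by (rule sum_abs)
  also have "\<dots> \<le> (\<Sum>j\<in>(UNIV::'n set). R * r)"
  proof (rule sum_mono)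
    fix j
    have "\<bar>1 - cos (u $ j)\<bar> \<le> r" using abs_one_minus_cos_le[of "u $ j"] u[of j] by linarith
    moreover have "\<bar>s j\<bar> = 1" using s_cases[of j] by auto
    moreover have "\<bar>\<alpha> $ j\<bar> \<le> R" using x(2) by (simp add: xe)
    ultimately show "\<bar>s j * (\<alpha> $ j * (1 - cos (u $ j)))\<bar> \<le> R * r"
      using R by (simp add: abs_mult mult_mono)
  qed
  finally show ?thesis by (simp add: xe)
qed

text \<open>Replacing the cosines by 1 changes the sum by at most \<open>c\<close>, which leaves
  enough of the margin \<open>2 * c\<close> for \<open>lowclamp\<close> to be the identity. The
  signs of sine and cosine at \<open>k i * pi\<close> are absorbed in \<open>s\<close>. The extra
  term in the fast equation is \<epsilon> times the velocity of \<open>\<Omega>\<close>.\<close>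

lemma truncated_eq_original:
  assumes r: "r > 0" "CARD('n) * (R * r) \<le> c" and u: "\<And>i. \<bar>u $ i\<bar> \<le> r"
    and x: "\<And>i. \<bar>fst x $ i\<bar> \<le> R" "\<And>i. \<bar>fst (snd x) $ i\<bar> \<le> R" "\<bar>snd (snd x)\<bar> \<le> R"
    and J: "2 * c \<le> \<sigma> * (I (snd (snd x)) - (\<Sum>j\<in>UNIV. s j * fst (snd x) $ j))"
    and w: "\<And>i. \<omega> $ i = u $ i + of_int (k i) * pi - fst x $ i" and \<epsilon>: "\<epsilon> > 0"
  shows "\<epsilon> *\<^sub>R FF r \<epsilon> u x = fast_field I \<omega> x + (\<epsilon> * lam) *\<^sub>R \<omega>"
    and "gg u x = slow_field I lam \<eta> \<omega> x"
proof -
  obtain \<Omega> \<alpha> \<theta> where xe: "x = (\<Omega>, \<alpha>, \<theta>)" by (cases x) auto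
  have cl: "clamp2 R (\<Omega> $ i) = \<Omega> $ i" "clamp2 R (\<alpha> $ i) = \<alpha> $ i" "clamp2 R \<theta> = \<theta>" for i
    using x by (auto simp: xe clamp2_id)
  have Ow: "\<Omega> $ i + \<omega> $ i = u $ i + of_int (k i) * pi" for i using w[of i] by (simp add: xe)
  have In: "In u x = I \<theta> - (\<Sum>j\<in>UNIV. \<alpha> $ j * cos (\<Omega> $ j + \<omega> $ j))"
    by (simp add: In_def xe cl Ow sin_cos_add_int_pi s_def mult.assoc mult.left_commute)
  have "\<bar>\<sigma> * In u x - \<sigma> * (I \<theta> - (\<Sum>j\<in>UNIV. s j * \<alpha> $ j))\<bar> \<le> c"
    using In_near[OF u x] r(2) \<sigma> by (auto simp: xe)
  then have "c \<le> \<sigma> * In u x" using J by (simp add: xe)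
  then have Aa: "Aa u x = \<sigma> * In u x" unfolding Aa_def by (rule lowclamp_id[OF c])
  have \<sigma>2: "\<sigma> * (\<sigma> * y) = y" for y using \<sigma> by auto
  show "\<epsilon> *\<^sub>R FF r \<epsilon> u x = fast_field I \<omega> x + (\<epsilon> * lam) *\<^sub>R \<omega>"
  proof (rule vec_eq_iff[THEN iffD2], rule allI)
    fix i
    have ci: "smallclamp r (u $ i) = u $ i" by (rule smallclamp_id[OF u r(1)])
    have "fast_field I \<omega> x $ i = - (s i * sin (u $ i)) * In u x"
      unfolding In by (simp add: fast_field_def xe Ow sin_cos_add_int_pi s_def)
    moreover have up: "u $ i + p x i = \<omega> $ i" using w[of i] by (simp add: p_def xe cl)
    have "\<epsilon> * FF r \<epsilon> u x $ i = - sg i * (Aa u x * sin (u $ i)) + \<epsilon> * lam * \<omega> $ i"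
      unfolding FF_def vec_lambda_beta ci up using \<epsilon> by (simp add: field_simps)
    moreover have "sg i * (Aa u x * sin (u $ i)) = s i * sin (u $ i) * In u x"
      unfolding Aa sg_def using \<sigma>2 by (simp add: mult_ac)
    ultimately show "(\<epsilon> *\<^sub>R FF r \<epsilon> u x) $ i = (fast_field I \<omega> x + (\<epsilon> * lam) *\<^sub>R \<omega>) $ i" by simp
  qed
  have "u $ i + p x i = \<omega> $ i" for i using w[of i] by (simp add: p_def xe cl)
  then show "gg u x = slow_field I lam \<eta> \<omega> x"
    using In by (simp add: gg_def slow_field_def xe vec_eq_iff Ow sin_cos_add_int_pi s_def mult.assoc mult.left_commute)
qed

end


section \<open>Time reversal, trapping, and the size of the invariant graph\<close>

context hyperbolic_split
begin

text \<open>All constants are symmetric under time reversal. Contracting and expanding components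
  change places, and the clock is negated so that its speed remains 1, which moves the slices to
  \<open>- b\<close> and \<open>- a\<close>.\<close>

lemma reversed:
  "hyperbolic_split (\<lambda>u x. - F u x) (\<lambda>u x. - g u x) (\<lambda>x. - clk x) (\<lambda>i. \<not> st i) B L K \<kappa> E \<beta> (- b) (- a)"
proof (rule hyperbolic_split.intro)
  show "norm (- g u x - - g v y) \<le> L * (m + norm (x - y))" if "\<And>i. \<bar>u $ i - v $ i\<bar> \<le> m" for u v x y m
    using g_lip[OF that, of x y] by (simp add: norm_minus_commute)
  show "(if \<not> st i then 1 else - 1) * ((u $ i - v $ i) * ((- F u x) $ i - (- F v y) $ i)) \<le> - \<kappa> * (u $ i - v $ i)\<^sup>2"
    if "\<And>j. \<bar>u$j - v$j\<bar> \<le> \<bar>u$i - v$i\<bar>" "norm (x - y) \<le> K * \<bar>u$i - v$i\<bar>" for u v x y i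
    using hyp[OF that] by (auto simp: algebra_simps split: if_splits)
  show "bounded_linear (\<lambda>x. - clk x)" by (rule bounded_linear_minus[OF clk_linear])
qed (use B_lip L \<kappa> ab \<beta> E K clk_g in \<open>auto simp: linear_simps[OF clk_linear]\<close>)

lemma sol_reverse:
  assumes "sol (- q) (- p) u x"
  shows "hyperbolic_split.sol (\<lambda>u x. - F u x) (\<lambda>u x. - g u x) p q (\<lambda>s. u (- s)) (\<lambda>s. x (- s))"
proof -
  interpret rv: hyperbolic_split "\<lambda>u x. - F u x" "\<lambda>u x. - g u x" "\<lambda>x. - clk x" "\<lambda>i. \<not> st i" B L K \<kappa> E \<beta> "- b" "- a"
    by (rule reversed)
  have m: "(uminus has_vector_derivative - 1) (at s within {p..q})" for s :: real
    by (auto intro!: derivative_eq_intros simp: has_vector_derivative_def)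
  have im: "uminus ` {p..q} = {- q..- p}" by simp
  show ?thesis
    unfolding rv.sol_def
  proof (intro ballI conjI)
    fix s assume "s \<in> {p..q}"
    then have "- s \<in> {- q..- p}" by simp
    then have "(u has_vector_derivative F (u (- s)) (x (- s))) (at (- s) within uminus ` {p..q})"
      "(x has_vector_derivative g (u (- s)) (x (- s))) (at (- s) within uminus ` {p..q})"
      using assms unfolding sol_def im by auto
    from vector_diff_chain_within[OF m this(1)] vector_diff_chain_within[OF m this(2)]
    show "((\<lambda>s. u (- s)) has_vector_derivative - F (u (- s)) (x (- s))) (at s within {p..q})"
      "((\<lambda>s. x (- s)) has_vector_derivative - g (u (- s)) (x (- s))) (at s within {p..q})"
      by (simp_all add: o_def)
  qed
qed

lemma sol_deriv_nth:
  assumes "sol p q u x" "s \<in> {p..q}"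
  shows "((\<lambda>s. u s $ i) has_real_derivative F (u s) (x s) $ i) (at s within {p..q})"
  using assms bounded_linear.has_vector_derivative[OF bounded_linear_vec_nth]
  unfolding sol_def has_real_derivative_iff_has_vector_derivative by blast

text \<open>The given curve solves the truncated system only while it is small (\<open>ext\<close>),
  and smallness is what has to be shown. Up to the first time a component reaches \<open>r\<close>
  it is such a solution; the joint maximum over this span is at least \<open>r\<close>, which
  \<open>inward\<close> excludes at positive times and \<open>init\<close> at time 0.\<close>

lemma trap:
  assumes all: "\<And>i. st i"
    and inward: "\<And>u x i. (\<And>j. \<bar>u$j\<bar> \<le> \<bar>u$i\<bar>) \<Longrightarrow> r \<le> \<bar>u$i\<bar> \<Longrightarrow> u$i * F u x $ i < 0"
    and cont: "continuous_on {0..T} u" and T: "0 \<le> T"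
    and ext: "\<And>T'. 0 \<le> T' \<Longrightarrow> T' \<le> T \<Longrightarrow> (\<And>s i. s \<in> {0..T'} \<Longrightarrow> \<bar>u s $ i\<bar> \<le> r) \<Longrightarrow> sol 0 T' u x"
    and init: "\<And>i. \<bar>u 0 $ i\<bar> < r"
  shows "sol 0 T u x"
proof -
  have contn: "continuous_on {0..T} (\<lambda>s. \<bar>u s $ i\<bar>)" for i
    by (intro continuous_intros cont)
  have "\<bar>u s $ i\<bar> < r" if s: "s \<in> {0..T}" for s i
  proof (rule ccontr)
    define A where "A = (\<Union>i. {s \<in> {0..T}. r \<le> \<bar>u s $ i\<bar>})"
    assume "\<not> ?thesis"
    then have "s \<in> A" using s by (auto simp: A_def not_less)
    moreover have "closed A"
      unfolding A_def by (intro closed_UN ballI continuous_on_closed_Collect_le continuous_on_const contn) auto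
    moreover have "bounded A" by (rule bounded_subset[of "{0..T}"]) (auto simp: A_def)
    ultimately obtain t where t: "t \<in> A" "\<And>s. s \<in> A \<Longrightarrow> t \<le> s"
      using compact_attains_inf[of A] compact_eq_bounded_closed by blast
    obtain i0 where i0: "r \<le> \<bar>u t $ i0\<bar>" and tT: "t \<in> {0..T}" using t(1) by (auto simp: A_def)
    have t0: "0 < t" using i0 init[of i0] tT by (cases "t = 0") auto
    have before: "\<bar>u s $ i\<bar> \<le> r" if "s \<in> {0..<t}" for s i
    proof (rule ccontr)
      assume "\<not> ?thesis"
      then have "s \<in> A" using that tT by (auto simp: A_def intro!: exI[of _ i])
      then show False using t(2)[of s] that by auto
    qed
    have "\<bar>u s $ i\<bar> \<le> r" if "s \<in> {0..t}" for s i
    proof (rule continuous_le_on_closure[of "{0..<t}" "\<lambda>s. \<bar>u s $ i\<bar>"])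
      show "continuous_on (closure {0..<t}) (\<lambda>s. \<bar>u s $ i\<bar>)"
        using t0 tT by (auto intro: continuous_on_subset[OF contn])
    qed (use before that t0 in auto)
    then have sol: "sol 0 t u x" using ext[of t] tT by auto
    have D: "((\<lambda>s. u s $ i) has_real_derivative F (u s) (x s) $ i) (at s within {0..t})" if "s \<in> {0..t}" for s i
      by (rule sol_deriv_nth[OF sol that])
    obtain i r1 where r1: "r1 \<in> {0..t}" and mx: "\<And>j s. s \<in> {0..t} \<Longrightarrow> \<bar>u s $ j\<bar> \<le> \<bar>u r1 $ i\<bar>"
      and alt: "r1 = (if st i then 0 else t) \<or> 0 \<le> (if st i then 1 else -1) * (u r1 $ i * F (u r1) (x r1) $ i)"
      by (rule global_max_sign[where y="\<lambda>i s. u s $ i" and y'="\<lambda>i s. F (u s) (x s) $ i" and st=st,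
            OF less_imp_le[OF t0] D]) (assumption, rule that)
    have big: "r \<le> \<bar>u r1 $ i\<bar>" using mx[of t i0] i0 t0 by auto
    show False
    proof (cases "r1 = 0")
      case True
      then show False using big init[of i] by simp
    next
      case False
      then have "0 \<le> u r1 $ i * F (u r1) (x r1) $ i" using alt all by auto
      moreover have "u r1 $ i * F (u r1) (x r1) $ i < 0" by (rule inward) (use mx[OF r1] big in auto)
      ultimately show False by simp
    qed
  qed
  then show ?thesis using ext[OF T order_refl] by (simp add: less_imp_le)
qed

end

text \<open>\<open>Cu * \<epsilon>\<close> bounds the graph: \<open>Qm\<close> covers the boundary
  data, and beyond \<open>8 * lam * Pm / c\<close> times \<epsilon> the rate
  \<open>c / (8 * \<epsilon>)\<close> beats the drift \<open>lam * p\<close>. \<open>Cw\<close>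
  collects the four error terms of the first order expansion, divided by the lower bound
  \<open>c / 2\<close> of \<open>Aa\<close>. The condition \<open>small\<close> keeps the graph
  within \<open>r / 2\<close>, so that initial values closer than \<open>r / 2\<close> to it lie
  where the truncation is inactive.\<close>

locale truncated_manifold =
  truncated_system I lam \<eta> k \<sigma> R c +
  boundary_manifold "truncated_system.FF I lam k \<sigma> R c r \<epsilon>" "truncated_system.gg I lam \<eta> k R"
    "\<lambda>x. snd (snd x)" "\<lambda>i. truncated_system.sg k \<sigma> i = 1" "\<lambda>x. \<epsilon> *\<^sub>R truncated_system.q I lam k \<sigma> R c x"
    L K "c / (8 * \<epsilon>)" E "\<epsilon> * Lq" "- R" R f' L0 B'
  for I :: "real \<Rightarrow> real" and lam \<eta> :: real and k :: "'n::finite \<Rightarrow> int" and \<sigma> R c :: real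
    and r \<epsilon> L K E Lq :: real
    and f' :: "(real^'n) \<times> 'n slow \<Rightarrow> ((real^'n) \<times> 'n slow) \<Rightarrow>\<^sub>L ((real^'n) \<times> 'n slow)" and L0 :: real
    and B' :: "'n slow \<Rightarrow> 'n slow \<Rightarrow>\<^sub>L (real^'n)" +
  fixes LA Am Pm Qm Gm Cu Cw :: real
  assumes \<epsilon>: "\<epsilon> > 0" and r: "r > 0" "2 * r \<le> 1" "CARD('n) * (R * r) \<le> c"
    and LA: "\<And>u v x y m. (\<And>i. \<bar>u$i - v$i\<bar> \<le> m) \<Longrightarrow> \<bar>Aa u x - Aa v y\<bar> \<le> LA * (m + norm (x - y))" "LA \<ge> 0"
    and Am: "\<And>u x. Aa u x \<le> Am" and Pm: "\<And>x i. \<bar>p x i\<bar> \<le> Pm" and Qm: "\<And>x i. \<bar>q x $ i\<bar> \<le> Qm"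
    and Lq: "\<And>x y. norm (q x - q y) \<le> Lq * norm (x - y)" "Lq \<ge> 0" and Gm: "\<And>x. norm (gg 0 x) \<le> Gm"
    and Cu_def: "Cu = max Qm (8 * lam * Pm / c)"
    and Cw_def: "Cw = 2 * (LA * Cu\<^sup>2 + Am * Cu\<^sup>2 + lam * Cu + Lq * (Gm + L)) / c"
    and small: "CARD('n) * (Cu * \<epsilon>) < r / 2"
begin

abbreviation "F \<equiv> FF r \<epsilon>"
abbreviation "clk x \<equiv> snd (snd x)"

lemma CARD_ge_1: "real CARD('n) \<ge> 1" by (simp add: Suc_le_eq)

lemma Pm_nonneg: "Pm \<ge> 0" using Pm[of undefined undefined] by (meson abs_ge_zero order_trans)

lemma Cu: "Cu \<ge> 0" "Qm \<le> Cu" "8 * lam * Pm \<le> c * Cu"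
proof -
  have "8 * lam * Pm / c \<le> Cu" by (simp add: Cu_def)
  then show "8 * lam * Pm \<le> c * Cu" using c by (simp add: divide_le_eq mult.commute)
  have "0 \<le> 8 * lam * Pm / c" using lam c Pm_nonneg by simp
  then show "Cu \<ge> 0" by (simp add: Cu_def le_max_iff_disj)
qed (simp add: Cu_def)

lemma Cu_small: "Cu * \<epsilon> < r / 2"
proof -
  have "1 * (Cu * \<epsilon>) \<le> CARD('n) * (Cu * \<epsilon>)"
    using Cu \<epsilon> by (intro mult_right_mono CARD_ge_1) auto
  then show ?thesis using small by linarith
qed

lemma Cw_nonneg: "Cw \<ge> 0"
proof -
  have "L \<ge> 0" by (rule hyperbolic_split.L[OF hyperbolic_split_axioms])
  moreover have "Gm \<ge> 0" by (rule order_trans[OF norm_ge_zero Gm])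
  moreover have "Am \<ge> 0" using Aa_pos[of 0 undefined] Am[of 0 undefined] by linarith
  ultimately show ?thesis
    unfolding Cw_def using LA(2) Cu(1) lam Lq(2) c
    by (intro divide_nonneg_pos mult_nonneg_nonneg add_nonneg_nonneg) auto
qed

text \<open>\<open>hyp\<close> is applied to \<open>u\<close> and 0 over the same slow point. Since
  0 is no equilibrium but has velocity \<open>lam * p\<close>, the sign survives only above the
  threshold built into \<open>Cu\<close>.\<close>

lemma inward:
  assumes "\<And>j. \<bar>u$j\<bar> \<le> \<bar>u$i\<bar>" "Cu * \<epsilon> < \<bar>u$i\<bar>"
  shows "(if sg i = 1 then 1 else -1) * (u$i * F u x $ i) < 0"
proof -
  have sg1: "\<bar>(if sg i = 1 then 1 else -1) * (u$i * (lam * p x i))\<bar> = \<bar>u$i\<bar> * (lam * \<bar>p x i\<bar>)"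
    using lam by (simp add: abs_mult)
  have "smallclamp r 0 = 0" using smallclamp_id[of 0 r] r by simp
  then have F0: "F 0 x $ i = lam * p x i" by (simp add: FF_def)
  have "(if sg i = 1 then 1 else -1) * ((u$i - 0$i) * (F u x $ i - F 0 x $ i)) \<le> - (c / (8 * \<epsilon>)) * (u$i - 0$i)\<^sup>2"
    by (rule hyp) (use assms(1) K_ge_E in auto)
  then have "(if sg i = 1 then 1 else -1) * (u$i * F u x $ i) \<le>
      (if sg i = 1 then 1 else -1) * (u$i * (lam * p x i)) - c / (8 * \<epsilon>) * (u$i)\<^sup>2"
    unfolding F0 by (auto simp: algebra_simps)
  also have "\<dots> \<le> \<bar>u$i\<bar> * (lam * \<bar>p x i\<bar>) - c / (8 * \<epsilon>) * (\<bar>u$i\<bar> * \<bar>u$i\<bar>)"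
    using sg1 by (simp add: power2_eq_square)
  also have "\<dots> = \<bar>u$i\<bar> * (lam * \<bar>p x i\<bar> - c / (8 * \<epsilon>) * \<bar>u$i\<bar>)" by (simp only: right_diff_distrib mult.left_commute)
  also have "\<dots> < 0"
  proof (rule mult_pos_neg)
    show "0 < \<bar>u$i\<bar>" using assms(2) Cu \<epsilon> by (meson le_less_trans mult_nonneg_nonneg less_imp_le)
    have "8 * (lam * \<bar>p x i\<bar>) \<le> c * Cu" using Cu(3) Pm[of x i] lam mult_left_mono[OF Pm[of x i], of "8 * lam"] by linarith
    then have "lam * \<bar>p x i\<bar> \<le> c / (8 * \<epsilon>) * (Cu * \<epsilon>)" using \<epsilon> by simp
    also have "\<dots> < c / (8 * \<epsilon>) * \<bar>u$i\<bar>" using assms(2) c \<epsilon> by (intro mult_strict_left_mono) auto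
    finally show "lam * \<bar>p x i\<bar> - c / (8 * \<epsilon>) * \<bar>u$i\<bar> < 0" by simp
  qed
  finally show ?thesis .
qed

lemma orbit_sol: "sol t0 t1 (\<lambda>s. fst (fl s z)) (\<lambda>s. snd (fl s z))"
  using sol_fl[of t0 t1 0 z] by simp

text \<open>The maximum principle for \<open>u\<close> itself: the data are at most
  \<open>Qm * \<epsilon>\<close>, and \<open>inward\<close> excludes a larger maximum
  elsewhere.\<close>

lemma orbit_bound:
  assumes x: "clk x \<in> {-R..R}" and t1: "t1 \<in> {-R - clk x..R - clk x}"
  shows "\<bar>fst (fl t1 (hm x, x)) $ j\<bar> \<le> Cu * \<epsilon>"
proof -
  let ?p = "-R - clk x" and ?q = "R - clk x" and ?z = "(hm x, x)"
  have pq: "?p \<le> ?q" using R by simp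
  obtain i t where t: "t \<in> {?p..?q}" and mx: "\<And>j s. s \<in> {?p..?q} \<Longrightarrow> \<bar>fst (fl s ?z) $ j\<bar> \<le> \<bar>fst (fl t ?z) $ i\<bar>"
    and alt: "t = (if sg i = 1 then ?p else ?q) \<or>
      0 \<le> (if sg i = 1 then 1 else -1) * (fst (fl t ?z) $ i * F (fst (fl t ?z)) (snd (fl t ?z)) $ i)"
    by (rule global_max_sign[where y="\<lambda>i s. fst (fl s ?z) $ i" and y'="\<lambda>i s. F (fst (fl s ?z)) (snd (fl s ?z)) $ i"
          and st="\<lambda>i. sg i = 1", OF pq sol_deriv_nth[OF orbit_sol]]) (assumption, rule that)
  have "\<bar>fst (fl t ?z) $ i\<bar> \<le> Cu * \<epsilon>"
  proof (rule ccontr)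
    assume "\<not> ?thesis"
    then have big: "Cu * \<epsilon> < \<bar>fst (fl t ?z) $ i\<bar>" by simp
    from alt show False
    proof
      assume "t = (if sg i = 1 then ?p else ?q)"
      then have "t = bt i - clk x" by (simp add: bt_def)
      then have "fst (fl t ?z) $ i = \<epsilon> * q (snd (fl t ?z)) $ i" using hm_boundary[OF x, of i] by simp
      then have "\<bar>fst (fl t ?z) $ i\<bar> = \<epsilon> * \<bar>q (snd (fl t ?z)) $ i\<bar>" using \<epsilon> by (simp add: abs_mult)
      also have "\<dots> \<le> \<epsilon> * Cu" using order_trans[OF Qm Cu(2)] \<epsilon> by (intro mult_left_mono) auto
      finally show False using big by (simp add: mult.commute)
    next
      assume "0 \<le> (if sg i = 1 then 1 else -1) * (fst (fl t ?z) $ i * F (fst (fl t ?z)) (snd (fl t ?z)) $ i)"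
      then show False using inward[of "fst (fl t ?z)" i "snd (fl t ?z)"] mx[OF t] big by auto
    qed
  qed
  then show ?thesis using mx[OF t1, of j] by linarith
qed

lemma hm_bound: "clk x \<in> {-R..R} \<Longrightarrow> \<bar>hm x $ j\<bar> \<le> Cu * \<epsilon>"
  using orbit_bound[of x 0 j] by simp

lemma gg_bound:
  assumes "\<And>i. \<bar>u $ i\<bar> \<le> 1" shows "norm (gg u x) \<le> Gm + L"
proof -
  have "norm (gg u x - gg 0 x) \<le> L * (1 + norm (x - x))" by (rule g_lip) (use assms in simp)
  then show ?thesis using Gm[of x] norm_triangle_sub[of "gg u x" "gg 0 x"] by simp
qed

text \<open>\<open>F u x - B' x (gg u x)\<close> is the velocity of
  \<open>u - \<epsilon> * q\<close> along an orbit. By the choice of \<open>q\<close> the terms of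
  order 1 cancel; what remains is \<open>- Aa 0 x * w / \<epsilon>\<close>, up to the sign
  \<open>sg i\<close>, and errors of order \<epsilon>, so the sign is definite once
  \<open>\<bar>w\<bar>\<close> exceeds \<open>Cw * \<epsilon>\<^sup>2\<close>.\<close>

lemma drift_bound:
  assumes u: "\<And>i. \<bar>u$i\<bar> \<le> Cu * \<epsilon>" and big: "Cw * \<epsilon>\<^sup>2 < \<bar>u$i - \<epsilon> * q x $ i\<bar>"
  shows "(if sg i = 1 then 1 else -1) * ((u$i - \<epsilon> * q x $ i) * (F u x $ i - B' x (gg u x) $ i)) < 0"
proof -
  define w where "w = u$i - \<epsilon> * q x $ i"
  have Cu\<epsilon>: "0 \<le> Cu * \<epsilon>" "Cu * \<epsilon> \<le> r" "Cu * \<epsilon> \<le> 1" using Cu \<epsilon> Cu_small r by auto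
  have sg: "(if sg i = 1 then 1 else -1) = sg i" "sg i * sg i = 1" "\<bar>sg i\<bar> = 1" using sg_cases[of i] by auto
  have sc: "smallclamp r (u$i) = u$i" using smallclamp_id[of "u$i" r] r u[of i] Cu\<epsilon> by auto
  have qA: "lam * p x i = sg i * (q x $ i * Aa 0 x)"
    using sg(2) Aa_pos[of 0 x] by (simp add: q_def flip: mult.assoc)
  \<comment> \<open>\<open>e1\<close> is the variation of \<open>Aa\<close> with \<open>u\<close>,
    \<open>e2\<close> the linearisation of sine, \<open>e3\<close> the part of the drift
    proportional to \<open>u\<close>, and \<open>e4\<close> the motion of
    \<open>\<epsilon> * q\<close> along the slow orbit. The first two are quadratic in \<epsilon>
    and get divided by \<epsilon>, the others are linear.\<close>
  define e1 e2 e3 e4 where "e1 = (Aa u x - Aa 0 x) * sin (u$i)" and "e2 = Aa 0 x * (sin (u$i) - u$i)"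
    and "e3 = sg i * (lam * u$i)" and "e4 = sg i * B' x (gg u x) $ i"
  have id: "sg i * (F u x $ i - B' x (gg u x) $ i) = - (Aa 0 x * w + e1 + e2) / \<epsilon> + e3 - e4"
  proof -
    have "sg i * F u x $ i = - ((sg i * sg i) / \<epsilon>) * (Aa u x * sin (u$i)) + sg i * (lam * u$i) + sg i * (lam * p x i)"
      by (simp add: FF_def sc algebra_simps)
    also have "sg i * (lam * p x i) = q x $ i * Aa 0 x" unfolding qA using sg(2) by (simp flip: mult.assoc)
    finally show ?thesis unfolding sg(2) e1_def e2_def e3_def e4_def w_def using \<epsilon> by (simp add: field_simps)
  qed
  have b1: "\<bar>e1\<bar> \<le> LA * Cu\<^sup>2 * \<epsilon>\<^sup>2"
  proof -
    have "\<bar>Aa u x - Aa 0 x\<bar> \<le> LA * (Cu * \<epsilon> + norm (x - x))" by (rule LA(1)) (use u in simp)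
    then have "\<bar>e1\<bar> \<le> (LA * (Cu * \<epsilon>)) * (Cu * \<epsilon>)" unfolding e1_def abs_mult
      using abs_sin_x_le_abs_x[of "u$i"] u[of i] LA(2) Cu\<epsilon> by (intro mult_mono) auto
    then show ?thesis by (simp add: power2_eq_square mult_ac)
  qed
  have b2: "\<bar>e2\<bar> \<le> Am * Cu\<^sup>2 * \<epsilon>\<^sup>2"
  proof -
    have "\<bar>sin (u$i) - u$i\<bar> \<le> (u$i)\<^sup>2" using abs_sin_minus_le[of "u$i"] u[of i] Cu\<epsilon> by auto
    also have "\<dots> \<le> (Cu * \<epsilon>)\<^sup>2" using u[of i] by (metis abs_le_square_iff abs_of_nonneg Cu\<epsilon>(1))
    finally have "\<bar>e2\<bar> \<le> Am * (Cu * \<epsilon>)\<^sup>2" unfolding e2_def abs_mult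
      using Am[of 0 x] Aa_pos[of 0 x] by (intro mult_mono) auto
    then show ?thesis by (simp add: power_mult_distrib mult_ac)
  qed
  have b3: "\<bar>e3\<bar> \<le> lam * Cu * \<epsilon>"
    using u[of i] lam sg(3) mult_left_mono[OF u[of i], of lam] by (simp add: e3_def abs_mult mult_ac)
  have b4: "\<bar>e4\<bar> \<le> \<epsilon> * (Lq * (Gm + L))"
  proof -
    have "norm (B' x v) \<le> (\<epsilon> * Lq) * norm v" for v
    proof (rule has_derivative_norm_le_lipschitz[OF B_der])
      fix y
      have "norm (\<epsilon> *\<^sub>R q y - \<epsilon> *\<^sub>R q x) = \<epsilon> * norm (q y - q x)"
        using \<epsilon> by (simp flip: scaleR_diff_right)
      then show "norm (\<epsilon> *\<^sub>R q y - \<epsilon> *\<^sub>R q x) \<le> \<epsilon> * Lq * norm (y - x)"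
        using mult_left_mono[OF Lq(1)[of y x], of \<epsilon>] \<epsilon> by (simp add: mult.assoc)
    qed
    from this[of "gg u x"] have "norm (B' x (gg u x)) \<le> (\<epsilon> * Lq) * norm (gg u x)" .
    also have "\<dots> \<le> (\<epsilon> * Lq) * (Gm + L)"
      using Lq(2) \<epsilon> u Cu\<epsilon> by (intro mult_left_mono gg_bound) (auto intro: order_trans)
    finally have "\<bar>B' x (gg u x) $ i\<bar> \<le> (\<epsilon> * Lq) * (Gm + L)" using component_le_norm_cart order_trans by blast
    then show ?thesis using sg(3) by (simp add: e4_def abs_mult mult_ac)
  qed
  have w0: "\<bar>w\<bar> > 0"
  proof -
    have "0 \<le> Cw * \<epsilon>\<^sup>2" using Cw_nonneg by simp
    then show ?thesis using big by (simp add: w_def)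
  qed
  have tot: "w * (- (e1 + e2) / \<epsilon> + e3 - e4) \<le> \<bar>w\<bar> * (c * Cw * \<epsilon> / 2)"
  proof -
    have "\<bar>- (e1 + e2) / \<epsilon> + e3 - e4\<bar> \<le> (\<bar>e1\<bar> + \<bar>e2\<bar>) / \<epsilon> + \<bar>e3\<bar> + \<bar>e4\<bar>"
    proof -
      have "\<bar>- (e1 + e2) / \<epsilon>\<bar> \<le> (\<bar>e1\<bar> + \<bar>e2\<bar>) / \<epsilon>"
        using \<epsilon> by (simp add: abs_divide divide_right_mono)
      then show ?thesis by linarith
    qed
    also have "\<dots> \<le> (LA * Cu\<^sup>2 * \<epsilon>\<^sup>2 + Am * Cu\<^sup>2 * \<epsilon>\<^sup>2) / \<epsilon> + lam * Cu * \<epsilon> + \<epsilon> * (Lq * (Gm + L))"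
      using b1 b2 b3 b4 \<epsilon> by (intro add_mono divide_right_mono) auto
    also have "\<dots> = c * Cw * \<epsilon> / 2"
      using \<epsilon> c by (simp add: Cw_def power2_eq_square field_simps)
    finally have "\<bar>w\<bar> * \<bar>- (e1 + e2) / \<epsilon> + e3 - e4\<bar> \<le> \<bar>w\<bar> * (c * Cw * \<epsilon> / 2)" by (intro mult_left_mono) auto
    then show ?thesis unfolding abs_mult[symmetric] by linarith
  qed
  have "sg i * (w * (F u x $ i - B' x (gg u x) $ i)) = w * (sg i * (F u x $ i - B' x (gg u x) $ i))" by simp
  also have "\<dots> = w * (- (e1 + e2) / \<epsilon> + e3 - e4) - Aa 0 x * (\<bar>w\<bar> * \<bar>w\<bar>) / \<epsilon>"
    unfolding id using \<epsilon> by (simp add: field_simps)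
  also have "\<dots> \<le> \<bar>w\<bar> * (c * Cw * \<epsilon> / 2) - c / 2 * (\<bar>w\<bar> * \<bar>w\<bar>) / \<epsilon>"
    using tot \<epsilon> Aa_ge[of 0 x] by (intro diff_mono divide_right_mono mult_right_mono) auto
  also have "\<dots> = \<bar>w\<bar> * (c / 2 * (Cw * \<epsilon>\<^sup>2 - \<bar>w\<bar>) / \<epsilon>)"
    using \<epsilon> by (simp add: field_simps power2_eq_square)
  also have "\<dots> < 0"
    using w0 c \<epsilon> big by (intro mult_pos_neg divide_neg_pos) (auto simp: w_def mult_pos_neg)
  finally show ?thesis by (simp add: sg(1) w_def)
qed

text \<open>The boundary data are \<open>\<epsilon> * q\<close> itself, so the deviation vanishes at
  the end where its maximum would be allowed, and \<open>drift_bound\<close> excludes all other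
  places.\<close>

lemma hm_approx:
  assumes x: "clk x \<in> {-R..R}" shows "\<bar>hm x $ j - \<epsilon> * q x $ j\<bar> \<le> Cw * \<epsilon>\<^sup>2"
proof -
  let ?p = "-R - clk x" and ?q = "R - clk x" and ?z = "(hm x, x)"
  define u y where "u s = fst (fl s ?z)" and "y s = snd (fl s ?z)" for s
  have pq: "?p \<le> ?q" using R by simp
  have sl: "sol ?p ?q u y" using orbit_sol[of ?p ?q ?z] by (simp add: u_def[abs_def] y_def[abs_def])
  have D: "((\<lambda>s. u s $ i - \<epsilon> * q (y s) $ i) has_real_derivative F (u s) (y s) $ i - B' (y s) (gg (u s) (y s)) $ i)
      (at s within {?p..?q})" if "s \<in> {?p..?q}" for i s
  proof -
    have "(y has_derivative (\<lambda>t. t *\<^sub>R gg (u s) (y s))) (at s within {?p..?q})"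
      using sl that unfolding sol_def has_vector_derivative_def by blast
    from has_derivative_compose[OF this B_der]
    have "((\<lambda>s. \<epsilon> *\<^sub>R q (y s)) has_vector_derivative B' (y s) (gg (u s) (y s))) (at s within {?p..?q})"
      by (simp add: has_vector_derivative_def blinfun.scaleR_right)
    from bounded_linear.has_vector_derivative[OF bounded_linear_vec_nth this, of i]
    have "((\<lambda>s. \<epsilon> * q (y s) $ i) has_real_derivative B' (y s) (gg (u s) (y s)) $ i) (at s within {?p..?q})"
      by (simp add: has_real_derivative_iff_has_vector_derivative)
    from DERIV_diff[OF sol_deriv_nth[OF sl that] this] show ?thesis .
  qed
  obtain i t where t: "t \<in> {?p..?q}"
    and mx: "\<And>j s. s \<in> {?p..?q} \<Longrightarrow> \<bar>u s $ j - \<epsilon> * q (y s) $ j\<bar> \<le> \<bar>u t $ i - \<epsilon> * q (y t) $ i\<bar>"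
    and alt: "t = (if sg i = 1 then ?p else ?q) \<or>
      0 \<le> (if sg i = 1 then 1 else -1) * ((u t $ i - \<epsilon> * q (y t) $ i) * (F (u t) (y t) $ i - B' (y t) (gg (u t) (y t)) $ i))"
    by (rule global_max_sign[where y="\<lambda>i s. u s $ i - \<epsilon> * q (y s) $ i" and
          y'="\<lambda>i s. F (u s) (y s) $ i - B' (y s) (gg (u s) (y s)) $ i" and st="\<lambda>i. sg i = 1", OF pq D]) (assumption, rule that)
  have "\<bar>u t $ i - \<epsilon> * q (y t) $ i\<bar> \<le> Cw * \<epsilon>\<^sup>2"
  proof (rule ccontr)
    assume "\<not> ?thesis"
    then have big: "Cw * \<epsilon>\<^sup>2 < \<bar>u t $ i - \<epsilon> * q (y t) $ i\<bar>" by simp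
    from alt show False
    proof
      assume "t = (if sg i = 1 then ?p else ?q)"
      then have "t = bt i - clk x" by (simp add: bt_def)
      then have z: "u t $ i - \<epsilon> * q (y t) $ i = 0" using hm_boundary[OF x, of i] by (simp add: u_def y_def)
      have "0 \<le> Cw * \<epsilon>\<^sup>2" using Cw_nonneg by simp
      then show False using big z by simp
    next
      assume "0 \<le> (if sg i = 1 then 1 else -1) * ((u t $ i - \<epsilon> * q (y t) $ i) * (F (u t) (y t) $ i - B' (y t) (gg (u t) (y t)) $ i))"
      moreover have "\<bar>u t $ j\<bar> \<le> Cu * \<epsilon>" for j unfolding u_def by (rule orbit_bound[OF x t])
      ultimately show False using drift_bound[OF _ big] by fastforce
    qed
  qed
  moreover have "0 \<in> {?p..?q}" using x by simp
  ultimately show ?thesis using mx[of 0 j] by (simp add: u_def y_def)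
qed

end


context hyperbolic_split
begin

text \<open>Trapping makes \<open>u\<close> a solution on all of \<open>{0..T}\<close>.
  \<open>vy\<close> supplies the comparison orbit on the graph; its premise
  \<open>a \<le> clk x - T\<close> ensures that, followed back from \<open>x\<close>, it does not
  pass the slice \<open>a\<close>.\<close>

lemma attraction_trapped:
  assumes all: "\<And>i. st i"
    and inward: "\<And>u x i. (\<And>j. \<bar>u$j\<bar> \<le> \<bar>u$i\<bar>) \<Longrightarrow> r \<le> \<bar>u$i\<bar> \<Longrightarrow> u$i * F u x $ i < 0"
    and cont: "continuous_on {0..T} u" and T: "0 \<le> T"
    and ext: "\<And>T'. 0 \<le> T' \<Longrightarrow> T' \<le> T \<Longrightarrow> (\<And>s i. s \<in> {0..T'} \<Longrightarrow> \<bar>u s $ i\<bar> \<le> r) \<Longrightarrow> sol 0 T' u x"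
    and init: "\<And>i. \<bar>u 0 $ i\<bar> < r"
    and h_lip: "\<And>x y i. clk x = clk y \<Longrightarrow> clk x \<in> {a..b} \<Longrightarrow> \<bar>h x $ i - h y $ i\<bar> \<le> norm (x - y) / (2 * E)"
    and vy: "\<And>x. clk x \<in> {a..b} \<Longrightarrow> a \<le> clk x - T \<Longrightarrow> \<exists>v y. sol 0 T v y \<and> y T = x \<and> (\<forall>s\<in>{0..T}. v s = h (y s))"
    and clk: "clk (x 0) \<in> {a..b}" "clk (x T) \<in> {a..b}"
  shows "norm (u T - h (x T)) \<le> 2 * CARD('n) * exp (- \<kappa> * T / 2) * norm (u 0 - h (x 0))"
proof -
  have sl: "sol 0 T u x" by (rule trap[OF all inward cont T ext init])
  have "clk (x T) = clk (x 0) + (T - 0)" by (rule sol_clk[OF sl]) (use T in auto)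
  then obtain v y where vy': "sol 0 T v y" "y T = x T" "\<And>s. s \<in> {0..T} \<Longrightarrow> v s = h (y s)"
    using vy[of "x T"] clk by auto
  have "\<bar>u T $ i - h (x T) $ i\<bar> \<le> 2 * exp (- \<kappa> * T / 2) * norm (u 0 - h (x 0))" for i
  proof (rule attraction[OF all h_lip sl vy'(1) vy'(3) T vy'(2) clk])
    show "\<bar>u 0 $ j - h (x 0) $ j\<bar> \<le> norm (u 0 - h (x 0))" for j
      using component_le_norm_cart[of "u 0 - h (x 0)" j] by simp
  qed
  then have "norm (u T - h (x T)) \<le> CARD('n) * (2 * exp (- \<kappa> * T / 2) * norm (u 0 - h (x 0)))"
    by (intro norm_vec_le_CARD) simp
  then show ?thesis by (simp add: mult_ac)
qed

end

section \<open>Back to the original variables\<close>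

context truncated_manifold
begin

text \<open>The slow points over which the truncations are inactive for small \<open>u\<close>; the
  second \<open>c\<close> is the reserve for the deviation of the cosines from 1.\<close>

definition D_ok :: "'n slow set \<Rightarrow> bool" where
  "D_ok D \<longleftrightarrow> (\<forall>x\<in>D. (\<forall>i. \<bar>fst x $ i\<bar> \<le> R) \<and> (\<forall>i. \<bar>fst (snd x) $ i\<bar> \<le> R) \<and> \<bar>snd (snd x)\<bar> \<le> R \<and>
     2 * c \<le> \<sigma> * (I (snd (snd x)) - (\<Sum>j\<in>UNIV. s j * fst (snd x) $ j)))"

definition kpi :: "real^'n" where "kpi = (\<chi> i. of_int (k i) * pi)"

definition hw :: "'n slow \<Rightarrow> real^'n" where "hw x = hm x + (kpi - fst x)"

definition shift :: "real^'n \<Rightarrow> 'n slow \<Rightarrow> real^'n" where "shift \<omega> x = \<omega> - (kpi - fst x)"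

lemma shift_hw: "shift \<omega> x - hm x = \<omega> - hw x"
  by (simp add: shift_def hw_def algebra_simps)

lemma D_ok_clk: "D_ok D \<Longrightarrow> x \<in> D \<Longrightarrow> clk x \<in> {-R..R}"
  by (auto simp: D_ok_def abs_le_iff)

lemma original_sol:
  assumes D: "D_ok D" and so: "solution_on I lam \<eta> \<epsilon> J \<omega> x" and J: "{t0..t1} \<subseteq> J"
    and x: "\<And>t. t \<in> {t0..t1} \<Longrightarrow> x t \<in> D"
    and u: "\<And>t i. t \<in> {t0..t1} \<Longrightarrow> \<bar>shift (\<omega> t) (x t) $ i\<bar> \<le> r"
  shows "sol t0 t1 (\<lambda>t. shift (\<omega> t) (x t)) x"
  unfolding sol_def
proof (intro ballI)
  fix t assume t: "t \<in> {t0..t1}"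
  let ?u = "shift (\<omega> t) (x t)"
  have xD: "(\<forall>i. \<bar>fst (x t) $ i\<bar> \<le> R) \<and> (\<forall>i. \<bar>fst (snd (x t)) $ i\<bar> \<le> R) \<and> \<bar>clk (x t)\<bar> \<le> R \<and>
     2 * c \<le> \<sigma> * (I (clk (x t)) - (\<Sum>j\<in>UNIV. s j * fst (snd (x t)) $ j))"
    by (rule bspec[OF D[unfolded D_ok_def] x[OF t]])
  have w0: "\<omega> t $ i = ?u $ i + of_int (k i) * pi - fst (x t) $ i" for i
    by (simp add: shift_def kpi_def)
  have eqs: "\<epsilon> *\<^sub>R F ?u (x t) = fast_field I (\<omega> t) (x t) + (\<epsilon> * lam) *\<^sub>R \<omega> t"
    "gg ?u (x t) = slow_field I lam \<eta> (\<omega> t) (x t)"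
    by (rule truncated_eq_original[OF r(1) r(3) u[OF t] _ _ _ _ w0 \<epsilon>]; use xD in blast)+
  obtain \<omega>' where w: "(\<omega> has_vector_derivative \<omega>') (at t within J)" "\<epsilon> *\<^sub>R \<omega>' = fast_field I (\<omega> t) (x t)"
    and xd: "(x has_vector_derivative slow_field I lam \<eta> (\<omega> t) (x t)) (at t within J)"
    using bspec[OF so[unfolded solution_on_def] subsetD[OF J t]] by blast
  have xd': "(x has_vector_derivative gg ?u (x t)) (at t within {t0..t1})"
    using has_vector_derivative_within_subset[OF xd J] by (simp add: eqs)
  have "\<epsilon> *\<^sub>R F ?u (x t) = \<epsilon> *\<^sub>R (\<omega>' + lam *\<^sub>R \<omega> t)"
    unfolding eqs w(2)[symmetric] by (simp add: scaleR_add_right)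
  then have Fe: "F ?u (x t) = \<omega>' + lam *\<^sub>R \<omega> t" using \<epsilon> by simp
  have "fst (slow_field I lam \<eta> (\<omega> t) (x t)) = lam *\<^sub>R \<omega> t" by (simp add: slow_field_def case_prod_unfold)
  then have "((\<lambda>t. fst (x t)) has_vector_derivative lam *\<^sub>R \<omega> t) (at t within {t0..t1})"
    using bounded_linear.has_vector_derivative[OF bounded_linear_fst xd'] by (simp add: eqs)
  then have "((\<lambda>t. \<omega> t - (kpi - fst (x t))) has_vector_derivative \<omega>' - (0 - lam *\<^sub>R \<omega> t)) (at t within {t0..t1})"
    by (rule has_vector_derivative_diff[OF has_vector_derivative_within_subset[OF w(1) J]
          has_vector_derivative_diff[OF has_vector_derivative_const]])
  then have "((\<lambda>t. shift (\<omega> t) (x t)) has_vector_derivative F ?u (x t)) (at t within {t0..t1})"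
    unfolding Fe by (simp add: shift_def)
  with xd' show "((\<lambda>t. shift (\<omega> t) (x t)) has_vector_derivative F ?u (x t)) (at t within {t0..t1}) \<and>
    (x has_vector_derivative gg ?u (x t)) (at t within {t0..t1})" by blast
qed

lemma solution_continuous:
  assumes "solution_on I lam \<eta> \<epsilon> J \<omega> x"
  shows "continuous_on J \<omega>" "continuous_on J x" "continuous_on J (\<lambda>t. shift (\<omega> t) (x t))"
proof -
  show c: "continuous_on J \<omega>" "continuous_on J x"
    unfolding continuous_on_eq_continuous_within
    using has_vector_derivative_continuous assms[unfolded solution_on_def] by fast+
  show "continuous_on J (\<lambda>t. shift (\<omega> t) (x t))"
    unfolding shift_def
    by (rule continuous_on_diff[OF c(1) continuous_on_diff[OF continuous_on_const continuous_on_fst[OF c(2)]]])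
qed

lemma C1_within_hw:
  assumes D: "D_ok D" shows "C1_within D hw"
proof -
  obtain h' where h': "\<And>x. clk x \<in> {-R..R} \<Longrightarrow> (hm has_derivative h' x) (at x within {x. clk x \<in> {-R..R}})"
    "\<And>v. continuous_on {x. clk x \<in> {-R..R}} (\<lambda>x. h' x v)"
    using hm_C1 by metis
  have sub: "D \<subseteq> {x. clk x \<in> {-R..R}}" using D_ok_clk[OF D] by auto
  show ?thesis unfolding C1_within_def
  proof (intro exI[of _ "\<lambda>x v. h' x v + (0 - fst v)"] conjI ballI allI)
    fix x assume x: "x \<in> D"
    have "(hm has_derivative h' x) (at x within D)"
      by (rule has_derivative_subset[OF h'(1)[OF D_ok_clk[OF D x]] sub])
    then show "(hw has_derivative (\<lambda>v. h' x v + (0 - fst v))) (at x within D)"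
      unfolding hw_def[abs_def]
      by (rule has_derivative_add[OF _ has_derivative_diff[OF has_derivative_const has_derivative_fst[OF has_derivative_ident]]])
  next
    show "continuous_on D (\<lambda>x. h' x v + (0 - fst v))" for v
      by (rule continuous_on_add[OF continuous_on_subset[OF h'(2) sub] continuous_on_const])
  qed
qed

text \<open>The times at which the solution lies on the graph are closed in \<open>J\<close> by
  continuity. They are open as well: on the graph \<open>u\<close> is smaller than \<open>r\<close>,
  so nearby the solution obeys the truncated system and \<open>hm_invariant\<close> applies.
  Connectedness of \<open>J\<close> does the rest; without it nothing would keep the solution in the
  region where both systems agree.\<close>

lemma locally_invariant_hw:
  assumes D: "D_ok D" shows "locally_invariant I lam \<eta> \<epsilon> D hw"
  unfolding locally_invariant_def
proof (intro allI impI, elim conjE)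
  fix J t0 \<omega> x
  assume J: "is_interval J" and t0: "t0 \<in> J" and so: "solution_on I lam \<eta> \<epsilon> J \<omega> x"
    and xD: "\<forall>t\<in>J. x t \<in> D" and init: "(\<omega> t0, x t0) \<in> graph_over D hw"
  let ?u = "\<lambda>t. shift (\<omega> t) (x t)"
  define S where "S = {t \<in> J. ?u t - hm (x t) = 0}"
  note cont = solution_continuous[OF so]
  have chm: "continuous_on {x. clk x \<in> {-R..R}} hm"
  proof -
    obtain h' where h': "\<And>x. clk x \<in> {-R..R} \<Longrightarrow> (hm has_derivative h' x) (at x within {x. clk x \<in> {-R..R}})"
      using hm_C1 by metis
    show ?thesis unfolding continuous_on_eq_continuous_within
      by (intro ballI has_derivative_continuous[OF h']) (rule CollectD)
  qed
  have chx: "continuous_on J (\<lambda>t. hm (x t))"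
    by (rule continuous_on_compose2[OF chm cont(2)]) (use xD D_ok_clk[OF D] in blast)
  have cl: "closedin (top_of_set J) S"
    unfolding S_def by (rule continuous_closedin_preimage_constant[OF continuous_on_diff[OF cont(3) chx]])
  have op: "openin (top_of_set J) S"
    unfolding openin_euclidean_subtopology_iff
  proof (intro conjI ballI)
    show "S \<subseteq> J" by (auto simp: S_def)
    fix t assume t: "t \<in> S"
    then have tJ: "t \<in> J" and ut: "?u t = hm (x t)" by (auto simp: S_def)
    have "norm (?u t) \<le> CARD('n) * (Cu * \<epsilon>)"
      unfolding ut using hm_bound[of "x t"] D_ok_clk[OF D] xD tJ by (intro norm_vec_le_CARD) auto
    then have "norm (?u t) < r" using small r by linarith
    then obtain d where d: "d > 0" "\<And>t'. t' \<in> J \<Longrightarrow> dist t' t < d \<Longrightarrow> dist (?u t') (?u t) < r - norm (?u t)"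
      using cont(3) tJ unfolding continuous_on_iff by (metis diff_gt_0_iff_gt)
    have "t' \<in> S" if t': "t' \<in> J" "dist t' t < d" for t'
    proof -
      let ?a = "min t t'" and ?b = "max t t'"
      have "{?a..?b} = closed_segment t t'"
        by (cases "t \<le> t'") (simp_all add: closed_segment_eq_real_ivl)
      then have sub: "{?a..?b} \<subseteq> J"
        using closed_segment_subset[OF tJ t'(1) is_interval_convex[OF J]] by simp
      have sm: "\<bar>?u v $ i\<bar> \<le> r" if "v \<in> {?a..?b}" for v i
      proof -
        have "v \<in> J" using that sub by blast
        moreover have "dist v t < d"
          using that t'(2) by (cases "t \<le> t'") (simp_all add: dist_real_def)
        ultimately have "norm (?u v) < r" using d(2)[of v] norm_triangle_sub[of "?u v" "?u t"] by (simp add: dist_norm)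
        then show ?thesis using component_le_norm_cart[of "?u v" i] by simp
      qed
      have sl: "sol ?a ?b ?u x" by (rule original_sol[OF D so sub _ sm]) (use xD sub in blast)+
      have "clk (x t) \<in> {-R..R}" "clk (x t') \<in> {-R..R}"
        using D_ok_clk[OF D] xD tJ t'(1) by blast+
      then have "?u t' = hm (x t')"
        by (intro hm_invariant[where u="?u", OF sl _ _ _ _ ut]) simp_all
      then show ?thesis using t' by (simp add: S_def)
    qed
    with d(1) show "\<exists>e>0. \<forall>x'\<in>J. dist x' t < e \<longrightarrow> x' \<in> S" by blast
  qed
  have "\<omega> t0 = hw (x t0)" using init by (auto simp: graph_over_def)
  then have "t0 \<in> S" using t0 by (simp add: S_def shift_hw)
  moreover have "connected J" using J by (simp add: is_interval_connected)
  ultimately have "S = J" using cl op unfolding connected_clopen by blast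
  show "\<forall>t\<in>J. (\<omega> t, x t) \<in> graph_over D hw"
  proof
    fix t assume "t \<in> J"
    then have "t \<in> S" using \<open>S = J\<close> by simp
    then have "\<omega> t = hw (x t)" by (simp add: S_def shift_hw)
    then show "(\<omega> t, x t) \<in> graph_over D hw" using xD \<open>t \<in> J\<close> by (auto simp: graph_over_def)
  qed
qed

text \<open>Over \<open>D\<close> no truncation acts, so \<open>\<epsilon> * q\<close> is the first
  order term of the expansion and the error of \<open>hw\<close> is that of
  \<open>hm\<close>.\<close>

lemma hw_approx:
  assumes D: "D_ok D" and x: "x \<in> D"
  shows "\<bar>hw x $ i - slow_manifold_approx I lam k \<epsilon> x i\<bar> \<le> Cw * \<epsilon>\<^sup>2"
proof -
  obtain \<Omega> \<alpha> \<theta> where xe: "x = (\<Omega>, \<alpha>, \<theta>)" by (cases x) auto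
  define Js where "Js = I \<theta> - (\<Sum>j\<in>UNIV. s j * \<alpha> $ j)"
  have xD: "\<bar>\<Omega> $ i\<bar> \<le> R" "\<bar>\<alpha> $ i\<bar> \<le> R" "\<bar>\<theta>\<bar> \<le> R" "2 * c \<le> \<sigma> * Js" for i
    using D x unfolding D_ok_def xe Js_def by auto
  have "In 0 x = Js" using xD by (simp add: In_def xe clamp2_id Js_def)
  then have A: "Aa 0 x = \<sigma> * Js" unfolding Aa_def using xD(4) c by (simp add: lowclamp_id)
  have J0: "Js \<noteq> 0" using xD(4) c by auto
  have "q x $ i = lam * (s i * \<sigma> * ((of_int (k i) * pi - \<Omega> $ i) * inverse (\<sigma> * Js)))"
    using xD by (simp add: q_def A[unfolded xe] p_def xe clamp2_id sg_def)
  also have "\<dots> = (of_int (k i) * pi - \<Omega> $ i) * (lam * s i / Js)"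
  proof -
    have "\<sigma> * inverse (\<sigma> * Js) = inverse Js" using \<sigma> by auto
    then have "lam * (s i * \<sigma> * (P * inverse (\<sigma> * Js))) = P * (lam * s i * inverse Js)" for P
      by (metis mult.assoc mult.left_commute)
    then show ?thesis unfolding divide_inverse .
  qed
  finally have q: "q x $ i = (of_int (k i) * pi - \<Omega> $ i) * (lam * s i / Js)" .
  have "slow_manifold_approx I lam k \<epsilon> x i = (of_int (k i) * pi - \<Omega> $ i) * (1 + \<epsilon> * (lam * s i / Js))"
    by (simp add: slow_manifold_approx_def xe Js_def s_def)
  also have "\<dots> = (of_int (k i) * pi - \<Omega> $ i) + \<epsilon> * q x $ i" 
    unfolding q by (simp only: distrib_left mult_1_right mult.left_commute)
  finally have "hw x $ i - slow_manifold_approx I lam k \<epsilon> x i = hm x $ i - \<epsilon> * q x $ i"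
    by (simp add: hw_def kpi_def xe)
  then show ?thesis using hm_approx[of x i] D_ok_clk[OF D x] by simp
qed

lemma shift_init:
  assumes "norm (\<omega> - hw x) < r / 2" "clk x \<in> {-R..R}" shows "\<bar>shift \<omega> x $ i\<bar> < r"
proof -
  have "\<bar>(shift \<omega> x - hm x) $ i\<bar> < r / 2"
    using assms(1) component_le_norm_cart[of "\<omega> - hw x" i] unfolding shift_hw by linarith
  then show ?thesis using hm_bound[OF assms(2), of i] Cu_small by (simp add: abs_if split: if_splits)
qed

text \<open>The decay rate in slow time is half of \<open>c / (8 * \<epsilon>)\<close>. Over the
  slow time \<open>\<epsilon> * \<tau>\<close> the \<epsilon> cancels, which leaves
  \<open>c / 16\<close> per unit of fast time.\<close>

lemma attracting_hw:
  assumes D: "D_ok D" and all: "\<And>i. sg i = 1" and \<tau>: "0 \<le> \<tau>"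
    and so: "solution_on I lam \<eta> \<epsilon> {0..\<epsilon> * \<tau>} \<omega> x" and xD: "\<And>t. t \<in> {0..\<epsilon> * \<tau>} \<Longrightarrow> x t \<in> D"
    and init: "norm (\<omega> 0 - hw (x 0)) < r / 2"
  shows "norm (\<omega> (\<epsilon> * \<tau>) - hw (x (\<epsilon> * \<tau>))) \<le> 2 * CARD('n) * exp (- (c / 16) * \<tau>) * norm (\<omega> 0 - hw (x 0))"
proof -
  define T where "T = \<epsilon> * \<tau>"
  have T: "0 \<le> T" using \<tau> \<epsilon> by (simp add: T_def)
  have clk: "clk (x t) \<in> {-R..R}" if "t \<in> {0..T}" for t using D_ok_clk[OF D xD] that by (simp add: T_def)
  have "norm (shift (\<omega> T) (x T) - hm (x T)) \<le>
      2 * CARD('n) * exp (- (c / (8 * \<epsilon>)) * T / 2) * norm (shift (\<omega> 0) (x 0) - hm (x 0))"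
  proof (rule attraction_trapped[where u="\<lambda>t. shift (\<omega> t) (x t)" and r=r])
    show "u $ i * F u x $ i < 0" if "\<And>j. \<bar>u$j\<bar> \<le> \<bar>u$i\<bar>" "r \<le> \<bar>u$i\<bar>" for u x i
      using inward[OF that(1), of x] that(2) Cu_small all r(1) by auto
    show "continuous_on {0..T} (\<lambda>t. shift (\<omega> t) (x t))" using solution_continuous[OF so] by (simp add: T_def)
    show "sol 0 T' (\<lambda>t. shift (\<omega> t) (x t)) x"
      if "0 \<le> T'" "T' \<le> T" "\<And>s i. s \<in> {0..T'} \<Longrightarrow> \<bar>shift (\<omega> s) (x s) $ i\<bar> \<le> r" for T'
      by (rule original_sol[OF D so _ _ that(3)]) (use that xD in \<open>auto simp: T_def\<close>)
    show "\<bar>shift (\<omega> 0) (x 0) $ i\<bar> < r" for i by (rule shift_init[OF init]) (use clk T in auto)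
    show "\<exists>v y. sol 0 T v y \<and> y T = x \<and> (\<forall>s\<in>{0..T}. v s = hm (y s))"
      if x: "clk x \<in> {-R..R}" "-R \<le> clk x - T" for x
    proof (intro exI conjI ballI)
      show "sol 0 T (\<lambda>s. fst (fl (s - T) (hm x, x))) (\<lambda>s. snd (fl (s - T) (hm x, x)))" by (rule sol_fl)
      show "fst (fl (s - T) (hm x, x)) = hm (snd (fl (s - T) (hm x, x)))" if "s \<in> {0..T}" for s
        by (rule hm_orbit(1)) (use x that in auto)
    qed simp
  qed (use all T clk hm_lip in auto)
  moreover have "exp (- (c / (8 * \<epsilon>)) * T / 2) = exp (- (c / 16) * \<tau>)" using \<epsilon> by (simp add: T_def)
  ultimately show ?thesis unfolding T_def[symmetric] shift_hw minus_zero by (simp only:)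
qed

lemma repelling_hw:
  assumes D: "D_ok D" and all: "\<And>i. sg i = -1" and \<tau>: "0 \<le> \<tau>"
    and so: "solution_on I lam \<eta> \<epsilon> {- (\<epsilon> * \<tau>)..0} \<omega> x" and xD: "\<And>t. t \<in> {- (\<epsilon> * \<tau>)..0} \<Longrightarrow> x t \<in> D"
    and init: "norm (\<omega> 0 - hw (x 0)) < r / 2"
  shows "norm (\<omega> (- (\<epsilon> * \<tau>)) - hw (x (- (\<epsilon> * \<tau>)))) \<le>
    2 * CARD('n) * exp (- (c / 16) * \<tau>) * norm (\<omega> 0 - hw (x 0))"
proof -
  interpret rv: hyperbolic_split "\<lambda>u x. - F u x" "\<lambda>u x. - gg u x" "\<lambda>x. - clk x" "\<lambda>i. \<not> sg i = 1"
      "\<lambda>x. \<epsilon> *\<^sub>R q x" L K "c / (8 * \<epsilon>)" E "\<epsilon> * Lq" "- R" "- (- R)"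
    by (rule reversed)
  define T where "T = \<epsilon> * \<tau>"
  have T: "0 \<le> T" using \<tau> \<epsilon> by (simp add: T_def)
  have clk: "clk (x t) \<in> {-R..R}" if "t \<in> {-T..0}" for t using D_ok_clk[OF D xD] that by (simp add: T_def)
  let ?u = "\<lambda>t. shift (\<omega> (- t)) (x (- t))"
  have "norm (?u T - hm (x (- T))) \<le>
      2 * CARD('n) * exp (- (c / (8 * \<epsilon>)) * T / 2) * norm (?u 0 - hm (x (- 0)))"
  proof (rule rv.attraction_trapped[where u="?u" and r=r and x="\<lambda>t. x (- t)"])
    show "u $ i * (- F u x) $ i < 0" if "\<And>j. \<bar>u$j\<bar> \<le> \<bar>u$i\<bar>" "r \<le> \<bar>u$i\<bar>" for u x i
      using inward[OF that(1), of x] that(2) Cu_small all[of i] r(1) by auto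
    show "continuous_on {0..T} ?u"
      by (rule continuous_on_compose2[OF solution_continuous(3)[OF so], of _ uminus])
         (auto intro!: continuous_intros simp: T_def)
    show "rv.sol 0 T' ?u (\<lambda>t. x (- t))"
      if "0 \<le> T'" "T' \<le> T" and b: "\<And>s i. s \<in> {0..T'} \<Longrightarrow> \<bar>?u s $ i\<bar> \<le> r" for T'
    proof (rule sol_reverse, rule original_sol[OF D so])
      show "\<bar>shift (\<omega> t) (x t) $ i\<bar> \<le> r" if "t \<in> {- T'..- 0}" for t i using b[of "- t" i] that by auto
    qed (use that xD in \<open>auto simp: T_def\<close>)
    show "\<bar>?u 0 $ i\<bar> < r" for i unfolding minus_zero by (rule shift_init[OF init]) (use clk T in auto)
    show "\<exists>v y. rv.sol 0 T v y \<and> y T = x \<and> (\<forall>s\<in>{0..T}. v s = hm (y s))"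
      if x: "- clk x \<in> {-R..- (- R)}" "-R \<le> - clk x - T" for x
    proof (intro exI conjI ballI)
      \<comment> \<open>The comparison orbit is the forward orbit of \<open>(hm x, x)\<close> run
        backwards; at reversed time \<open>T\<close> its flow time is 0, so it ends at
        \<open>x\<close>.\<close>
      show "rv.sol 0 T (\<lambda>s. fst (fl (- s - (- T)) (hm x, x))) (\<lambda>s. snd (fl (- s - (- T)) (hm x, x)))"
        by (rule sol_reverse, rule sol_fl)
      show "fst (fl (- s - (- T)) (hm x, x)) = hm (snd (fl (- s - (- T)) (hm x, x)))" if "s \<in> {0..T}" for s
        by (rule hm_orbit(1)) (use x that in auto)
    qed simp
    show "\<bar>hm x $ i - hm y $ i\<bar> \<le> norm (x - y) / (2 * E)"
      if "- clk x = - clk y" "- clk x \<in> {-R..- (- R)}" for x y i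
      using hm_lip[of x y i] that by auto
    show "\<not> sg i = 1" for i using all[of i] by simp
  qed (use T clk[of 0] clk[of "- T"] in auto)
  moreover have "exp (- (c / (8 * \<epsilon>)) * T / 2) = exp (- (c / 16) * \<tau>)" using \<epsilon> by (simp add: T_def)
  ultimately show ?thesis unfolding T_def[symmetric] shift_hw minus_zero by (simp only:)
qed

end


section \<open>Eigenvalues of matrices close to a reflection\<close>

context
  fixes M :: "complex^'n::finite \<Rightarrow> complex^'n"
  assumes M_add: "\<And>x y. M (x + y) = M x + M y" and M_smult: "\<And>c x. M (c *s x) = c *s M x"
begin

text \<open>The vector \<open>p(M) v\<close>. A polynomial annihilating a single vector is enough to
  find eigenvalues, and it allows one to follow that vector inside a cone.\<close>

definition papp :: "complex poly \<Rightarrow> complex^'n \<Rightarrow> complex^'n" where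
  "papp p v = (\<Sum>i\<le>degree p. coeff p i *s (M ^^ i) v)"

lemma papp_eq: "degree p \<le> n \<Longrightarrow> papp p v = (\<Sum>i\<le>n. coeff p i *s (M ^^ i) v)"
  unfolding papp_def by (rule sum.mono_neutral_left) (auto simp: coeff_eq_0)

lemma M_zero: "M 0 = 0" using M_smult[of 0 0] by simp

lemma M_sum: "M (\<Sum>i\<in>S. f i) = (\<Sum>i\<in>S. M (f i))"
  by (induction S rule: infinite_finite_induct) (auto simp: M_zero M_add)

lemma papp_add: "papp (p + q) v = papp p v + papp q v"
proof -
  let ?n = "max (degree p) (degree q)"
  have "degree (p + q) \<le> ?n" by (rule degree_add_le_max)
  then show ?thesis
    using papp_eq[of p ?n v] papp_eq[of q ?n v] papp_eq[of "p + q" ?n v]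
    by (simp add: sum.distrib vec.scale_left_distrib)
qed

lemma papp_smult: "papp (smult c p) v = c *s papp p v"
  using papp_eq[of "smult c p" "degree p" v] papp_eq[of p "degree p" v]
  by (simp add: degree_smult_le vec.scale_sum_right)

lemma papp_pCons_0: "papp (pCons 0 p) v = papp p (M v)" "papp (pCons 0 p) v = M (papp p v)"
proof -
  have "papp (pCons 0 p) v = (\<Sum>i\<le>Suc (degree p). coeff (pCons 0 p) i *s (M ^^ i) v)"
    by (rule papp_eq) (rule degree_pCons_le)
  also have "\<dots> = (\<Sum>i\<le>degree p. coeff p i *s M ((M ^^ i) v))"
    by (simp only: sum.atMost_Suc_shift coeff_pCons_0 coeff_pCons_Suc vec.scale_zero_left add_0_left
          funpow.simps o_apply)
  finally have eq: "papp (pCons 0 p) v = (\<Sum>i\<le>degree p. coeff p i *s M ((M ^^ i) v))" .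
  then show "papp (pCons 0 p) v = M (papp p v)" by (simp add: papp_def M_sum M_smult)
  show "papp (pCons 0 p) v = papp p (M v)" unfolding eq by (simp add: papp_def funpow_swap1)
qed

lemma papp_root:
  "papp ([:- z, 1:] * p) v = papp p (M v - z *s v)" "papp ([:- z, 1:] * p) v = M (papp p v) - z *s papp p v"
proof -
  have e: "[:- z, 1:] * p = smult (- z) p + pCons 0 p" by simp
  have lin: "papp p (x - y) = papp p x - papp p y" for x y
  proof -
    have "(M ^^ i) (x + c *s y) = (M ^^ i) x + c *s (M ^^ i) y" for i c
      by (induction i) (auto simp: M_add M_smult)
    from this[of _ "-1"] show ?thesis
      by (simp add: papp_def vec.scale_right_diff_distrib sum_subtractf)
  qed
  have sc: "papp p (z *s v) = z *s papp p v"
  proof -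
    have "(M ^^ i) (z *s v) = z *s (M ^^ i) v" for i by (induction i) (auto simp: M_smult)
    then show ?thesis by (simp add: papp_def vec.scale_sum_right mult.commute)
  qed
  show "papp ([:- z, 1:] * p) v = papp p (M v - z *s v)"
    unfolding e papp_add papp_smult papp_pCons_0(1) lin sc by simp
  show "papp ([:- z, 1:] * p) v = M (papp p v) - z *s papp p v"
    unfolding e papp_add papp_smult papp_pCons_0(2) by simp
qed

lemma papp_monom: "papp (monom c i) v = c *s (M ^^ i) v"
  using papp_eq[of "monom c i" i v] by (simp add: degree_monom_le if_distrib[of "\<lambda>c. c *s _"] cong: if_cong)

lemma papp_sum: "papp (\<Sum>i\<in>S. f i) v = (\<Sum>i\<in>S. papp (f i) v)"
proof (induction S rule: infinite_finite_induct)
  case (insert i S)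
  then show ?case by (simp add: papp_add)
qed (auto simp: papp_def)

text \<open>The Krylov vectors of orders 0 to \<open>n\<close>, with \<open>n\<close> the real
  dimension, either repeat or are one more than the dimension and hence dependent. Each case gives a
  polynomial; real coefficients suffice.\<close>

lemma annihilating_poly: "\<exists>p. p \<noteq> 0 \<and> papp p v = 0"
proof -
  define w where "w i = (M ^^ i) v" for i
  define n where "n = DIM(complex^'n)"
  show ?thesis
  proof (cases "inj_on w {..n}")
    case True
    then have "card (w ` {..n}) > DIM(complex^'n)" by (simp add: card_image n_def)
    then have "dependent (w ` {..n})" by (intro dependent_biggerset) auto
    then obtain u i where i: "i \<le> n" "u (w i) \<noteq> (0::real)" and sum0: "(\<Sum>x\<in>w ` {..n}. u x *\<^sub>R x) = 0"
      by (auto simp: dependent_finite)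
    define p where "p = (\<Sum>i\<le>n. monom (complex_of_real (u (w i))) i)"
    have "papp p v = (\<Sum>i\<le>n. u (w i) *\<^sub>R w i)"
    proof -
      have "complex_of_real a *s x = a *\<^sub>R x" for a and x :: "complex^'n"
        by (intro vec_eq_iff[THEN iffD2] allI, simp only: vector_smult_component vector_scaleR_component,
            simp only: scaleR_conv_of_real)
      then show ?thesis by (simp add: p_def papp_sum papp_monom w_def)
    qed
    also have "\<dots> = 0" using sum0 True by (simp add: sum.reindex)
    finally have "papp p v = 0" .
    moreover have "coeff p i \<noteq> 0" using i by (simp add: p_def coeff_sum)
    then have "p \<noteq> 0" by auto
    ultimately show ?thesis by blast
  next
    case False
    then obtain i j where ij: "i \<noteq> j" "w i = w j" by (auto simp: inj_on_def)
    have "papp (monom 1 i + monom (-1) j) v = 0"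
      using ij by (simp add: papp_add papp_monom w_def)
    moreover have "coeff (monom 1 i + monom (-1::complex) j) i \<noteq> 0" using ij by simp
    then have "monom 1 i + monom (-1::complex) j \<noteq> 0" by (metis coeff_0)
    ultimately show ?thesis by blast
  qed
qed

text \<open>A root of an annihilating polynomial of \<^term>\<open>v\<close> that is not an eigenvalue can be cancelled;
  one whose shifted operator preserves the cone \<^term>\<open>C\<close> is absorbed into \<^term>\<open>v\<close>.\<close>

lemma eigenvalue_outside_cone_preserving:
  assumes nz: "\<And>v. C v \<Longrightarrow> v \<noteq> 0"
    and pres: "\<And>z v. C v \<Longrightarrow> \<not> P z \<Longrightarrow> (\<exists>w. w \<noteq> 0 \<and> M w = z *s w) \<Longrightarrow> C (M v - z *s v)"
  shows "p \<noteq> 0 \<Longrightarrow> C v \<Longrightarrow> papp p v = 0 \<Longrightarrow> \<exists>z. P z \<and> (\<exists>w. w \<noteq> 0 \<and> M w = z *s w)"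
proof (induction "degree p" arbitrary: p v rule: less_induct)
  case less
  show ?case
  proof (cases "degree p = 0")
    case True
    then obtain a where "p = [:a:]" by (metis degree_eq_zeroE)
    then show ?thesis using less.prems nz[of v] by (auto simp: papp_def vec.scale_eq_0_iff)
  next
    case False
    then obtain z where "poly p z = 0"
      using fundamental_theorem_of_algebra[of p] by (metis constant_degree)
    then obtain q where q: "p = [:- z, 1:] * q" by (metis poly_eq_0_iff_dvd dvdE)
    have q0: "q \<noteq> 0" using q less.prems(1) by auto
    have "degree p = Suc (degree q)" unfolding q by (subst degree_mult_eq) (use q0 in auto)
    then have dq: "degree q < degree p" by simp
    show ?thesis
    proof (cases "\<exists>w. w \<noteq> 0 \<and> M w = z *s w")
      case True
      show ?thesis
      proof (cases "P z")
        case False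
        have "papp q (M v - z *s v) = 0" using less.prems(3) papp_root(1)[of z q v] q by simp
        then show ?thesis using less.hyps[OF dq q0 pres[OF less.prems(2) False True]] by blast
      qed (use True in blast)
    next
      case False
      have "M (papp q v) = z *s papp q v" using less.prems(3) papp_root(2)[of z q v] q by simp
      then have "papp q v = 0" using False by blast
      then show ?thesis using less.hyps[OF dq q0 less.prems(2)] by blast
    qed
  qed
qed

end

lemma near_reflection_row:
  fixes A :: "real^'n^'n::finite" and v :: "complex^'n"
  assumes row: "(\<Sum>j\<in>UNIV. \<bar>A $ i $ j - (if i = j then \<tau> else 0)\<bar>) \<le> \<rho>" and m: "\<And>j. norm (v $ j) \<le> m"
  shows "norm ((map_matrix complex_of_real A *v v) $ i - of_real \<tau> * v $ i) \<le> \<rho> * m"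
proof -
  have m0: "m \<ge> 0" using m norm_ge_zero order_trans by blast
  have "(map_matrix complex_of_real A *v v) $ i - of_real \<tau> * v $ i =
      (\<Sum>j\<in>UNIV. of_real (A $ i $ j) * v $ j) - (\<Sum>j\<in>UNIV. of_real (if i = j then \<tau> else 0) * v $ j)"
    by (simp add: matrix_vector_mult_def map_matrix_def if_distrib[of complex_of_real] if_distrib[of "\<lambda>x. x * _"] cong: if_cong)
  also have "\<dots> = (\<Sum>j\<in>UNIV. of_real (A $ i $ j - (if i = j then \<tau> else 0)) * v $ j)"
    unfolding sum_subtractf[symmetric] by (intro sum.cong refl) (simp add: algebra_simps)
  also have "norm \<dots> \<le> (\<Sum>j\<in>UNIV. \<bar>A $ i $ j - (if i = j then \<tau> else 0)\<bar> * m)"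
    by (rule order_trans[OF norm_sum], rule sum_mono) (simp add: norm_mult m mult_left_mono del: of_real_diff)
  also have "\<dots> = (\<Sum>j\<in>UNIV. \<bar>A $ i $ j - (if i = j then \<tau> else 0)\<bar>) * m" by (simp add: sum_distrib_right)
  also have "\<dots> \<le> \<rho> * m" by (rule mult_right_mono[OF row m0])
  finally show ?thesis .
qed

lemma max_component:
  fixes v :: "complex^'n::finite"
  obtains i where "\<And>j. norm (v $ j) \<le> norm (v $ i)"
proof -
  have "Max (range (\<lambda>j. norm (v $ j))) \<in> range (\<lambda>j. norm (v $ j))" by (intro Max_in) auto
  then obtain i where "Max (range (\<lambda>j. norm (v $ j))) = norm (v $ i)" by (rule rangeE)
  then show thesis using that[of i] Max_ge[of "range (\<lambda>j. norm (v $ j))"] by (metis finite rangeI finite_imageI)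
qed

text \<open>The eigenvector equation is read in the row of the largest component of the eigenvector,
  where the row sum bounds the remainder relative to that component.\<close>

lemma near_reflection_gershgorin:
  fixes A :: "real^'n^'n::finite"
  assumes row: "\<And>i. (\<Sum>j\<in>UNIV. \<bar>A $ i $ j - (if i = j then \<tau> i * \<mu> else 0)\<bar>) \<le> \<rho>"
    and ev: "complex_eigenvalue A z"
  obtains i where "norm (z - of_real (\<tau> i * \<mu>)) \<le> \<rho>"
proof -
  obtain v where v: "v \<noteq> 0" "map_matrix complex_of_real A *v v = z *s v" using ev unfolding complex_eigenvalue_def by blast
  obtain i where i: "\<And>j. norm (v $ j) \<le> norm (v $ i)" using max_component[of v] by metis
  have vi: "norm (v $ i) > 0"
  proof -
    obtain j where "v $ j \<noteq> 0" using v(1) by (auto simp: vec_eq_iff)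
    then have "0 < norm (v $ j)" by simp
    then show ?thesis using i[of j] by linarith
  qed
  have "norm ((z - of_real (\<tau> i * \<mu>)) * v $ i) \<le> \<rho> * norm (v $ i)"
    using near_reflection_row[OF row[of i] i] unfolding v(2) by (simp add: left_diff_distrib)
  then have "norm (z - of_real (\<tau> i * \<mu>)) \<le> \<rho>" using vi unfolding norm_mult by (simp only: mult_le_cancel_right_pos)
  then show thesis by (rule that)
qed

text \<open>The cone consists of the vectors whose largest component sits at an index with
  \<open>\<tau> = -1\<close>. An eigenvalue \<open>z\<close> with nonnegative real part lies within
  \<open>\<rho>\<close> of \<open>\<mu>\<close>, so subtracting \<open>z\<close> leaves components
  with \<open>\<tau> = 1\<close> of size at most \<open>2 * \<rho> * m\<close>, while the largest of
  the others becomes at least \<open>(2 * \<mu> - 2 * \<rho>) * m\<close>. As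
  \<open>\<rho> \<le> \<mu> / 2\<close>, the cone is preserved, and the annihilating polynomial of a
  unit vector in it forces an eigenvalue with negative real part.\<close>

lemma near_reflection_negative_eigenvalue:
  fixes A :: "real^'n^'n::finite"
  assumes row: "\<And>i. (\<Sum>j\<in>UNIV. \<bar>A $ i $ j - (if i = j then \<tau> i * \<mu> else 0)\<bar>) \<le> \<rho>"
    and \<tau>: "\<And>i. \<tau> i = 1 \<or> \<tau> i = -1" and \<mu>: "\<mu> > 0" and \<rho>: "\<rho> \<le> \<mu> / 2" and i0: "\<tau> i0 = -1"
  shows "\<exists>z. complex_eigenvalue A z \<and> Re z < 0"
proof -
  let ?M = "\<lambda>v. map_matrix complex_of_real A *v v"
  define C where "C v \<longleftrightarrow> (\<exists>i. \<tau> i = -1 \<and> v $ i \<noteq> 0 \<and> (\<forall>j. norm (v $ j) \<le> norm (v $ i)))" for v :: "complex^'n"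
  have Madd: "?M (x + y) = ?M x + ?M y" for x y by (rule matrix_vector_right_distrib)
  have Msm: "?M (c *s x) = c *s ?M x" for c x by (rule vector_scalar_commute)
  have pres: "C (?M v - z *s v)" if Cv: "C v" and z: "\<not> Re z < 0" "\<exists>w. w \<noteq> 0 \<and> ?M w = z *s w" for z v
  proof -
    have "complex_eigenvalue A z" using z(2) by (auto simp: complex_eigenvalue_def)
    then obtain l where l: "norm (z - of_real (\<tau> l * \<mu>)) \<le> \<rho>" by (rule near_reflection_gershgorin[OF row])
    have "\<tau> l = 1"
    proof (rule ccontr)
      assume "\<tau> l \<noteq> 1"
      then have "\<tau> l = -1" using \<tau> by blast
      then have "\<bar>Re z + \<mu>\<bar> \<le> \<rho>" using order_trans[OF abs_Re_le_cmod l] by simp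
      then show False using z(1) \<rho> \<mu> by linarith
    qed
    then have z\<mu>: "norm (z - of_real \<mu>) \<le> \<rho>" using l by simp
    obtain i where i: "\<tau> i = -1" "v $ i \<noteq> 0" "\<And>j. norm (v $ j) \<le> norm (v $ i)" using Cv by (auto simp: C_def)
    define m where "m = norm (v $ i)"
    have m: "m > 0" "\<And>j. norm (v $ j) \<le> m" using i by (auto simp: m_def)
    define y where "y = ?M v - z *s v"
    have rho0: "\<rho> \<ge> 0" using z\<mu> norm_ge_zero order_trans by blast
    have est: "norm (y $ j - (of_real (\<tau> j * \<mu>) - z) * v $ j) \<le> \<rho> * m" for j
    proof -
      have "y $ j - (of_real (\<tau> j * \<mu>) - z) * v $ j = ?M v $ j - of_real (\<tau> j * \<mu>) * v $ j"
        by (simp add: y_def algebra_simps)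
      then show ?thesis using near_reflection_row[OF row[of j] m(2)] by simp
    qed
    have plus: "norm (y $ j) \<le> 2 * \<rho> * m" if "\<tau> j = 1" for j
    proof -
      have "norm ((of_real (\<tau> j * \<mu>) - z) * v $ j) \<le> \<rho> * m"
        unfolding norm_mult using that z\<mu> m(2) rho0 by (intro mult_mono) (auto simp: norm_minus_commute)
      then show ?thesis using est[of j] norm_triangle_sub[of "y $ j" "(of_real (\<tau> j * \<mu>) - z) * v $ j"] by linarith
    qed
    have minus: "(2 * \<mu> - 2 * \<rho>) * m \<le> norm (y $ i)"
    proof -
      have "2 * \<mu> \<le> norm (z - of_real \<mu>) + norm (of_real (\<tau> i * \<mu>) - z)"
        using norm_triangle_ineq[of "z - of_real \<mu>" "of_real (\<tau> i * \<mu>) - z"] i(1) \<mu>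
        by (simp add: norm_minus_commute flip: of_real_add of_real_diff of_real_minus)
      then have "2 * \<mu> - \<rho> \<le> norm (of_real (\<tau> i * \<mu>) - z)" using z\<mu> by linarith
      then have "(2 * \<mu> - \<rho>) * m \<le> norm ((of_real (\<tau> i * \<mu>) - z) * v $ i)"
        unfolding norm_mult m_def by (intro mult_right_mono) auto
      then show ?thesis
        using est[of i] norm_triangle_sub[of "(of_real (\<tau> i * \<mu>) - z) * v $ i" "y $ i"]
        by (simp add: norm_minus_commute algebra_simps)
    qed
    let ?S = "{j. \<tau> j = -1}"
    have "Max ((\<lambda>j. norm (y $ j)) ` ?S) \<in> (\<lambda>j. norm (y $ j)) ` ?S" using i(1) by (intro Max_in) auto
    then obtain i' where i': "\<tau> i' = -1" "Max ((\<lambda>j. norm (y $ j)) ` ?S) = norm (y $ i')" by auto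
    have mx: "norm (y $ j) \<le> norm (y $ i')" if "\<tau> j = -1" for j
      using that unfolding i'(2)[symmetric] by (intro Max_ge) auto
    have "0 < \<mu> * m" "2 * \<rho> * m \<le> \<mu> * m" "\<mu> * m \<le> (2 * \<mu> - 2 * \<rho>) * m"
      using \<mu> m(1) \<rho> by (auto intro!: mult_right_mono)
    then have big: "0 < norm (y $ i')" "2 * \<rho> * m \<le> norm (y $ i')" using minus mx[OF i(1)] by linarith+
    show ?thesis unfolding C_def y_def[symmetric]
    proof (intro exI[of _ i'] conjI allI)
      show "norm (y $ j) \<le> norm (y $ i')" for j
        using \<tau>[of j] mx[of j] plus[of j] big(2) by auto
    qed (use i' big in auto)
  qed
  have Ce: "C (axis i0 1)"
    unfolding C_def using i0 by (intro exI[of _ i0]) (auto simp: axis_def)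
  obtain p where "p \<noteq> 0" "papp ?M p (axis i0 1) = 0" using annihilating_poly[of ?M "axis i0 1", OF Madd Msm] by blast
  from eigenvalue_outside_cone_preserving[of ?M C "\<lambda>z. Re z < 0", OF Madd Msm _ pres this(1) Ce this(2)]
  show ?thesis unfolding complex_eigenvalue_def C_def by (auto simp: vec_eq_iff)
qed

text \<open>The discs around plus and minus \<open>\<mu>\<close> have radius at most
  \<open>\<mu> / 2\<close> and so miss the imaginary axis. Positive real part follows from the
  negative case for \<open>- A\<close>.\<close>

lemma near_reflection_hyperbolic:
  fixes A :: "real^'n^'n::finite"
  assumes row: "\<And>i. (\<Sum>j\<in>UNIV. \<bar>A $ i $ j - (if i = j then \<tau> i * \<mu> else 0)\<bar>) \<le> \<rho>"
    and \<tau>: "\<And>i. \<tau> i = 1 \<or> \<tau> i = -1" and \<mu>: "\<mu> > 0" and \<rho>: "\<rho> \<le> \<mu> / 2"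
    and i0: "\<tau> i0 = -1" and i1: "\<tau> i1 = 1"
  shows "(\<forall>z. complex_eigenvalue A z \<longrightarrow> Re z \<noteq> 0) \<and> (\<exists>z. complex_eigenvalue A z \<and> Re z < 0) \<and>
    (\<exists>z. complex_eigenvalue A z \<and> Re z > 0)"
proof (intro conjI allI impI)
  fix z assume "complex_eigenvalue A z"
  then obtain l where l: "norm (z - of_real (\<tau> l * \<mu>)) \<le> \<rho>" by (rule near_reflection_gershgorin[OF row])
  then have "\<bar>Re z - \<tau> l * \<mu>\<bar> \<le> \<rho>" using order_trans[OF abs_Re_le_cmod l] by simp
  then show "Re z \<noteq> 0" using \<tau>[of l] \<rho> \<mu> by (auto simp: abs_if split: if_splits)
next
  show "\<exists>z. complex_eigenvalue A z \<and> Re z < 0"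
    by (rule near_reflection_negative_eigenvalue[OF row \<tau> \<mu> \<rho> i0])
  have "\<exists>z. complex_eigenvalue (- A) z \<and> Re z < 0"
  proof (rule near_reflection_negative_eigenvalue[where \<tau>="\<lambda>i. - \<tau> i" and \<mu>=\<mu> and \<rho>=\<rho>])
    fix i
    have "(\<Sum>j\<in>UNIV. \<bar>(- A) $ i $ j - (if i = j then - \<tau> i * \<mu> else 0)\<bar>) =
        (\<Sum>j\<in>UNIV. \<bar>A $ i $ j - (if i = j then \<tau> i * \<mu> else 0)\<bar>)"
      by (intro sum.cong refl) (auto simp: abs_if)
    then show "(\<Sum>j\<in>UNIV. \<bar>(- A) $ i $ j - (if i = j then - \<tau> i * \<mu> else 0)\<bar>) \<le> \<rho>" using row[of i] by simp
    show "- \<tau> i = 1 \<or> - \<tau> i = -1" using \<tau>[of i] by auto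
  qed (use \<mu> \<rho> i1 in auto)
  then obtain z v where z: "Re z < 0" "v \<noteq> 0" "map_matrix complex_of_real (- A) *v v = z *s v"
    by (auto simp: complex_eigenvalue_def)
  have "map_matrix complex_of_real (- A) *v v = - (map_matrix complex_of_real A *v v)"
    by (simp add: vec_eq_iff matrix_vector_mult_def map_matrix_def sum_negf)
  then have "map_matrix complex_of_real A *v v = (- z) *s v" using z(3) by (metis minus_equation_iff vec.scale_minus_left)
  then show "\<exists>z. complex_eigenvalue A z \<and> Re z > 0" using z(1,2) unfolding complex_eigenvalue_def
    by (intro exI[of _ "- z"]) auto
qed


section \<open>The Jacobian of the fast field on the graph\<close>

lemma fast_field_has_derivative:
  fixes x :: "'n::finite slow"
  assumes x: "x = (\<Omega>, \<alpha>, \<theta>)"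
  shows "((\<lambda>\<omega>. fast_field I \<omega> x) has_derivative
    (\<lambda>v. \<chi> i. - (cos (\<Omega>$i + \<omega>$i) * v$i) * (I \<theta> - (\<Sum>j\<in>UNIV. \<alpha>$j * cos (\<Omega>$j + \<omega>$j)))
       - sin (\<Omega>$i + \<omega>$i) * (\<Sum>j\<in>UNIV. \<alpha>$j * (sin (\<Omega>$j + \<omega>$j) * v$j)))) (at \<omega>)"
proof (subst has_derivative_componentwise_within, intro ballI)
  fix e :: "real^'n" assume "e \<in> Basis"
  then obtain i where e: "e = axis i 1" by (auto simp: Basis_vec_def)
  have nth: "((\<lambda>\<omega>::real^'n. \<Omega>$j + \<omega>$j) has_derivative (\<lambda>v. v$j)) (at \<omega>)" for j
    using has_derivative_add[OF has_derivative_const bounded_linear_imp_has_derivative[OF bounded_linear_vec_nth], of "\<Omega>$j" j]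
    by simp
  have sn: "((\<lambda>\<omega>::real^'n. sin (\<Omega>$j + \<omega>$j)) has_derivative (\<lambda>v. v$j * cos (\<Omega>$j + \<omega>$j))) (at \<omega>)" for j
    using has_derivative_sin[OF nth] by simp
  have cs: "((\<lambda>\<omega>::real^'n. cos (\<Omega>$j + \<omega>$j)) has_derivative (\<lambda>v. v$j * - sin (\<Omega>$j + \<omega>$j))) (at \<omega>)" for j
    using has_derivative_cos[OF nth] by simp
  have "((\<lambda>\<omega>::real^'n. I \<theta> - (\<Sum>j\<in>UNIV. \<alpha>$j * cos (\<Omega>$j + \<omega>$j))) has_derivative
      (\<lambda>v. 0 - (\<Sum>j\<in>UNIV. \<alpha>$j * (v$j * - sin (\<Omega>$j + \<omega>$j))))) (at \<omega>)"
    by (intro has_derivative_diff has_derivative_const has_derivative_sum has_derivative_mult_right cs)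
  from has_derivative_mult[OF has_derivative_minus[OF sn[of i]] this]
  have "((\<lambda>\<omega>::real^'n. - sin (\<Omega>$i + \<omega>$i) * (I \<theta> - (\<Sum>j\<in>UNIV. \<alpha>$j * cos (\<Omega>$j + \<omega>$j)))) has_derivative
      (\<lambda>v. - (cos (\<Omega>$i + \<omega>$i) * v$i) * (I \<theta> - (\<Sum>j\<in>UNIV. \<alpha>$j * cos (\<Omega>$j + \<omega>$j)))
       - sin (\<Omega>$i + \<omega>$i) * (\<Sum>j\<in>UNIV. \<alpha>$j * (sin (\<Omega>$j + \<omega>$j) * v$j)))) (at \<omega>)"
    by (rule has_derivative_eq_rhs) (simp add: fun_eq_iff sum_negf mult_ac)
  then show "((\<lambda>\<omega>. fast_field I \<omega> x \<bullet> e) has_derivative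
     (\<lambda>v. (\<chi> i. - (cos (\<Omega>$i + \<omega>$i) * v$i) * (I \<theta> - (\<Sum>j\<in>UNIV. \<alpha>$j * cos (\<Omega>$j + \<omega>$j)))
       - sin (\<Omega>$i + \<omega>$i) * (\<Sum>j\<in>UNIV. \<alpha>$j * (sin (\<Omega>$j + \<omega>$j) * v$j))) \<bullet> e)) (at \<omega>)"
    by (simp add: e inner_axis fast_field_def x)
qed

lemma fast_field_jacobian:
  fixes x :: "'n::finite slow"
  assumes x: "x = (\<Omega>, \<alpha>, \<theta>)"
  shows "jacobian (\<lambda>\<omega>. fast_field I \<omega> x) (at \<omega>) $ i $ j =
    (if i = j then - (cos (\<Omega>$i + \<omega>$i) * (I \<theta> - (\<Sum>j\<in>UNIV. \<alpha>$j * cos (\<Omega>$j + \<omega>$j)))) else 0)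
    - sin (\<Omega>$i + \<omega>$i) * (\<alpha>$j * sin (\<Omega>$j + \<omega>$j))"
  unfolding jacobian_def frechet_derivative_at[OF fast_field_has_derivative[OF x], symmetric]
  by (simp add: matrix_def axis_def if_distrib[of "\<lambda>y. _ * y"] cong: if_cong)

context truncated_manifold
begin

text \<open>At \<open>u = 0\<close> the Jacobian is diagonal with entries
  \<open>- sg i * (\<sigma> * Js)\<close>. For small \<open>u\<close> a row sum of deviations is at
  most \<open>Mi * r\<close> from the cosine of the diagonal entry, plus
  \<open>CARD('n) * (R * r)\<close> from the cosines inside the sum, plus the same amount from the
  products of sines. By \<open>sm\<close> the total is at most \<open>c\<close>, and
  \<open>\<sigma> * Js\<close> is at least \<open>2 * c\<close>.\<close>

lemma saddle_type_hw:
  assumes D: "D_ok D" and Mi: "\<And>u x. \<bar>In u x\<bar> \<le> Mi" and sm: "Mi * r + 2 * (CARD('n) * (R * r)) \<le> c"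
    and i0: "sg i0 = 1" and i1: "sg i1 \<noteq> 1"
  shows "saddle_type I D hw"
  unfolding saddle_type_def Let_def
proof
  fix x assume xD: "x \<in> D"
  obtain \<Omega> \<alpha> \<theta> where xe: "x = (\<Omega>, \<alpha>, \<theta>)" by (cases x) auto
  let ?A = "jacobian (\<lambda>\<omega>. fast_field I \<omega> x) (at (hw x))"
  define Js where "Js = I \<theta> - (\<Sum>j\<in>UNIV. s j * \<alpha> $ j)"
  have x': "\<And>i. \<bar>fst x $ i\<bar> \<le> R" "\<And>i. \<bar>fst (snd x) $ i\<bar> \<le> R" "\<bar>clk x\<bar> \<le> R" and J: "2 * c \<le> \<sigma> * Js"
    using D xD unfolding D_ok_def xe Js_def by auto
  define u where "u = hm x"
  have u: "\<bar>u $ i\<bar> \<le> r" for i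
    using hm_bound[OF D_ok_clk[OF D xD], of i] Cu_small r(1) by (simp add: u_def)
  have y: "\<Omega> $ i + hw x $ i = u $ i + of_int (k i) * pi" for i by (simp add: hw_def kpi_def u_def xe)
  have cl: "clamp2 R (\<alpha> $ i) = \<alpha> $ i" "clamp2 R \<theta> = \<theta>" for i using x' by (auto simp: xe clamp2_id)
  have In: "I \<theta> - (\<Sum>j\<in>UNIV. \<alpha>$j * cos (\<Omega>$j + hw x$j)) = In u x"
    by (simp add: In_def xe cl y[unfolded xe] sin_cos_add_int_pi s_def mult.left_commute)
  have InJ: "\<bar>In u x - Js\<bar> \<le> CARD('n) * (R * r)" using In_near[OF u x'] by (simp add: Js_def xe)
  have s1: "\<bar>s i\<bar> = 1" for i using s_cases[of i] by auto
  have "(\<Sum>j\<in>UNIV. \<bar>?A $ i $ j - (if i = j then - sg i * (\<sigma> * Js) else 0)\<bar>) \<le> c" for i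
  proof -
    have e: "\<bar>?A $ i $ j - (if i = j then - sg i * (\<sigma> * Js) else 0)\<bar> \<le>
        (if i = j then Mi * r + CARD('n) * (R * r) else 0) + R * r" for j
    proof -
      have off: "\<bar>sin (\<Omega>$i + hw x$i) * (\<alpha>$j * sin (\<Omega>$j + hw x$j))\<bar> \<le> r * (R * 1)"
        unfolding abs_mult
      proof (intro mult_mono)
        have "\<bar>sin (\<Omega>$i + hw x$i)\<bar> = \<bar>sin (u$i)\<bar>"
          unfolding y sin_cos_add_int_pi abs_mult using s1[of i] by (simp add: s_def)
        then show "\<bar>sin (\<Omega>$i + hw x$i)\<bar> \<le> r" using abs_sin_x_le_abs_x[of "u$i"] u[of i] by linarith
        show "\<bar>\<alpha>$j\<bar> \<le> R" using x'(2) by (simp add: xe)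
      qed (use R r in auto)
      have di: "\<bar>- (cos (\<Omega>$i + hw x$i) * In u x) + sg i * (\<sigma> * Js)\<bar> \<le> Mi * r + CARD('n) * (R * r)"
      proof -
        have "sg i * (\<sigma> * Js) = s i * Js" using \<sigma> by (auto simp: sg_def)
        then have "- (cos (\<Omega>$i + hw x$i) * In u x) + sg i * (\<sigma> * Js) = s i * ((1 - cos (u$i)) * In u x - (In u x - Js))"
          unfolding y sin_cos_add_int_pi s_def[symmetric] by (simp add: algebra_simps)
        then have "\<bar>- (cos (\<Omega>$i + hw x$i) * In u x) + sg i * (\<sigma> * Js)\<bar> = \<bar>(1 - cos (u$i)) * In u x - (In u x - Js)\<bar>"
          using s1 by (simp add: abs_mult)
        also have "\<dots> \<le> \<bar>1 - cos (u$i)\<bar> * \<bar>In u x\<bar> + \<bar>In u x - Js\<bar>"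
          unfolding abs_mult[symmetric] by (rule abs_triangle_ineq4)
        also have "\<dots> \<le> r * Mi + CARD('n) * (R * r)"
          using abs_one_minus_cos_le[of "u$i"] u[of i] Mi[of u x] InJ r(1) by (intro add_mono mult_mono) auto
        finally show ?thesis by (simp add: mult.commute)
      qed
      show ?thesis
        unfolding fast_field_jacobian[OF xe] In using off di by (auto simp: mult.commute abs_if split: if_splits)
    qed
    have "(\<Sum>j\<in>UNIV. \<bar>?A $ i $ j - (if i = j then - sg i * (\<sigma> * Js) else 0)\<bar>) \<le>
        (\<Sum>j\<in>UNIV. (if i = j then Mi * r + CARD('n) * (R * r) else 0) + R * r)"
      by (rule sum_mono) (rule e)
    also have "\<dots> = Mi * r + 2 * (CARD('n) * (R * r))" by (simp add: sum.distrib)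
    finally show ?thesis using sm by linarith
  qed
  then show "(\<forall>z. complex_eigenvalue ?A z \<longrightarrow> Re z \<noteq> 0) \<and> (\<exists>z. complex_eigenvalue ?A z \<and> Re z < 0) \<and>
      (\<exists>z. complex_eigenvalue ?A z \<and> 0 < Re z)"
  proof (rule near_reflection_hyperbolic)
    show "- sg i = 1 \<or> - sg i = -1" for i using sg_cases[of i] by auto
    show "- sg i0 = -1" "- sg i1 = 1" using i0 i1 sg_cases[of i1] by auto
    show "0 < \<sigma> * Js" "c \<le> \<sigma> * Js / 2" using J c by auto
  qed
qed

end

section \<open>Choice of the constants before \<epsilon>\<close>

lemma Bd_nth: "Bd f \<Longrightarrow> \<exists>M\<ge>0. \<forall>x i. \<bar>f x $ i\<bar> \<le> M" for f :: "'a::real_normed_vector \<Rightarrow> real^'n"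
  unfolding Bd_def by (meson component_le_norm_cart order_trans)

text \<open>Only \<open>FF\<close> involves \<open>r\<close> and \<epsilon>, so the choice is not
  circular: \<open>L\<close>, \<open>LA\<close> and the sup bounds come from the truncation,
  \<open>E\<close> and \<open>K\<close> from \<open>L\<close> and \<open>R\<close>, then
  \<open>r\<close> from \<open>K\<close>, and \<open>\<epsilon>0\<close> last. Only
  \<open>f'\<close>, \<open>L0\<close> and \<open>B'\<close> are chosen after \<epsilon>, which
  makes the stability and error constants uniform.\<close>

lemma (in truncated_system) truncated_manifold_exists:
  obtains r L K E Lq LA Am Pm Qm Gm Cu Cw \<epsilon>0 Mi where "\<epsilon>0 > 0"
    "\<And>\<epsilon>. 0 < \<epsilon> \<Longrightarrow> \<epsilon> < \<epsilon>0 \<Longrightarrow>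
      \<exists>f' L0 B'. truncated_manifold I lam \<eta> k \<sigma> R c r \<epsilon> L K E Lq f' L0 B' LA Am Pm Qm Gm Cu Cw"
    "\<And>u x. \<bar>In u x\<bar> \<le> Mi" "Mi * r + 2 * (CARD('n) * (R * r)) \<le> c" "r > 0"
proof -
  obtain L where L: "L > 0"
    "\<And>u v x y m. (\<And>i. \<bar>u$i - v$i\<bar> \<le> m) \<Longrightarrow> norm (gg u x - gg v y) \<le> L * (m + norm (x - y))"
    using Lip_sup_bound[OF gg_reg(2)] by (metis fst_conv snd_conv)
  obtain LA where LA: "LA > 0"
    "\<And>u v x y m. (\<And>i. \<bar>u$i - v$i\<bar> \<le> m) \<Longrightarrow> norm (Aa u x - Aa v y) \<le> LA * (m + norm (x - y))"
    using Lip_sup_bound[OF Aa_reg(2)] by (metis fst_conv snd_conv)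
  obtain Mi where Mi: "Mi \<ge> 0" "\<And>u x. \<bar>In u x\<bar> \<le> Mi"
    using In_reg(3) unfolding Bd_def by (metis fst_conv snd_conv real_norm_def)
  obtain Am where Am: "\<And>u x. Aa u x \<le> Am"
    using Aa_reg(3) unfolding Bd_def by (metis fst_conv snd_conv real_norm_def abs_le_D1)
  have "Bd (\<lambda>x. \<chi> i. p x i)" by (rule Bd_vec) (simp add: p_reg)
  from Bd_nth[OF this] obtain Pm where Pm: "Pm \<ge> 0" "\<And>x i. \<bar>p x i\<bar> \<le> Pm" by auto
  obtain Qm where Qm: "Qm \<ge> 0" "\<And>x i. \<bar>q x $ i\<bar> \<le> Qm" using Bd_nth[OF q_reg(3)] by blast
  obtain Lq where Lq: "Lq \<ge> 0" "\<And>x y. norm (q x - q y) \<le> Lq * norm (x - y)" using q_reg(2) unfolding Lip_def by blast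
  obtain Gm where Gm: "\<And>x. norm (gg 0 x) \<le> Gm" using gg_reg(3) unfolding Bd_def by blast
  define E where "E = exp ((2*L+1) * (R - - R) / 2) * (1 + L)"
  define K where "K = E * (1 + 2 * E)"
  have E: "E > 0" and K: "K > 0" using L by (auto simp: E_def K_def intro!: mult_pos_pos add_pos_pos)
  define N where "N = real CARD('n)"
  have N: "N \<ge> 1" by (simp add: N_def Suc_le_eq)
  \<comment> \<open>\<open>1/2\<close> puts the clamped argument where sine has slope at least 1/2,
    the second entry makes the variation of \<open>Aa\<close> harmless in
    \<open>FF_hyperbolic\<close>, and the third bounds the distance of the Jacobian from a multiple
    of a reflection. The \<open>+ 1\<close> keeps the denominator positive.\<close>
  define r where "r = min (1/2) (min (c / 16 / (2 * (LA * (1 + K)))) (c / (Mi + 2 * (N * R) + 1)))"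
  have den: "Mi + 2 * (N * R) + 1 > 0" using Mi N R by (intro add_nonneg_pos add_nonneg_nonneg) auto
  have r: "r > 0" unfolding r_def using c LA K den by auto
  have r1: "2 * r \<le> 1" by (simp add: r_def)
  have r2: "2 * r * (LA * (1 + K)) \<le> c / 16"
  proof -
    have "r \<le> c / 16 / (2 * (LA * (1 + K)))" by (simp add: r_def)
    then show ?thesis using LA K by (simp add: le_divide_eq mult_ac)
  qed
  have r3: "Mi * r + 2 * (N * (R * r)) \<le> c"
  proof -
    have "r \<le> c / (Mi + 2 * (N * R) + 1)" by (simp add: r_def)
    then have "r * (Mi + 2 * (N * R) + 1) \<le> c" using den by (simp add: le_divide_eq)
    then show ?thesis using r by (simp add: algebra_simps)
  qed
  have r4: "N * (R * r) \<le> c"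
  proof -
    have "0 \<le> Mi * r" "0 \<le> N * (R * r)" using Mi N R r by auto
    then show ?thesis using r3 by linarith
  qed
  define Cu where "Cu = max Qm (8 * lam * Pm / c)"
  define Cw where "Cw = 2 * (LA * Cu\<^sup>2 + Am * Cu\<^sup>2 + lam * Cu + Lq * (Gm + L)) / c"
  have Cu: "Cu \<ge> 0" using Qm by (simp add: Cu_def)
  \<comment> \<open>In order: the slow drift is small against the rate, the boundary data satisfy
    \<open>\<beta> * K \<le> 1/4\<close> with \<open>\<beta> = \<epsilon> * Lq\<close>, and the
    graph stays within \<open>r / 2\<close>.\<close>
  define \<epsilon>0 where "\<epsilon>0 = min (c / 16 / (lam * (2 + K))) (min (1 / (4 * (Lq * K + 1))) (r / 2 / (N * Cu + 1)))"
  have d1: "Lq * K + 1 > 0" "N * Cu + 1 > 0" using Lq K N Cu by (auto intro!: add_nonneg_pos mult_nonneg_nonneg)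
  have \<epsilon>0: "\<epsilon>0 > 0" unfolding \<epsilon>0_def using c lam K d1 r by auto
  show thesis
  proof (rule that[OF \<epsilon>0])
    fix \<epsilon> assume \<epsilon>: "0 < \<epsilon>" "\<epsilon> < \<epsilon>0"
    have e1: "\<epsilon> * (lam * (2 + K)) \<le> c / 16"
    proof -
      have "\<epsilon> \<le> c / 16 / (lam * (2 + K))" using \<epsilon> by (simp add: \<epsilon>0_def)
      then show ?thesis using lam K by (simp add: le_divide_eq)
    qed
    have e2: "\<epsilon> * Lq * K \<le> 1/4"
    proof -
      have "\<epsilon> \<le> 1 / (4 * (Lq * K + 1))" using \<epsilon> by (simp add: \<epsilon>0_def)
      then have "\<epsilon> * (4 * (Lq * K + 1)) \<le> 1" using d1 by (simp add: le_divide_eq)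
      then show ?thesis using \<epsilon> by (simp add: algebra_simps)
    qed
    have e3: "N * (Cu * \<epsilon>) < r / 2"
    proof -
      have "\<epsilon> < r / 2 / (N * Cu + 1)" using \<epsilon> by (simp add: \<epsilon>0_def)
      then have "\<epsilon> * (N * Cu + 1) < r / 2" unfolding pos_less_divide_eq[OF d1(2)] .
      then show ?thesis using \<epsilon> by (simp add: algebra_simps)
    qed
    let ?f = "\<lambda>z. (FF r \<epsilon> (fst z) (snd z), gg (fst z) (snd z))"
    have "C1 ?f" by (intro C1_Pair FF_reg gg_reg r)
    then obtain f' where f': "\<And>z. (?f has_derivative blinfun_apply (f' z)) (at z)" "continuous_on UNIV f'"
      by (rule C1_blinfun) (rule that)
    have "Lip ?f" by (intro Lip_Pair FF_reg gg_reg r)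
    then obtain L0 where L0: "L0 \<ge> 0" "\<And>z w. norm (?f z - ?f w) \<le> L0 * norm (z - w)" unfolding Lip_def by blast
    have L0': "norm (?f z - ?f w) \<le> (L0 + 1) * norm (z - w)" for z w
      using L0(2)[of z w] by (rule order_trans) (auto intro: mult_right_mono)
    have "C1 (\<lambda>x. \<epsilon> *\<^sub>R q x)" by (rule C1_linear_compose[OF bounded_linear_scaleR_right q_reg(1)])
    then obtain B' where B': "\<And>x. ((\<lambda>x. \<epsilon> *\<^sub>R q x) has_derivative blinfun_apply (B' x)) (at x)" "continuous_on UNIV B'"
      by (rule C1_blinfun) (rule that)
    have hs: "hyperbolic_split (FF r \<epsilon>) gg (\<lambda>x. snd (snd x)) (\<lambda>i. sg i = 1) (\<lambda>x. \<epsilon> *\<^sub>R q x) L K (c / (8 * \<epsilon>)) E (\<epsilon> * Lq) (- R) R"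
    proof (rule hyperbolic_split.intro)
      show "(if sg i = 1 then 1 else - 1) * ((u $ i - v $ i) * (FF r \<epsilon> u x $ i - FF r \<epsilon> v y $ i)) \<le> - (c / (8 * \<epsilon>)) * (u $ i - v $ i)\<^sup>2"
        if "\<And>j. \<bar>u $ j - v $ j\<bar> \<le> \<bar>u $ i - v $ i\<bar>" "norm (x - y) \<le> K * \<bar>u $ i - v $ i\<bar>" for u v x y i
      proof -
        have "(if sg i = 1 then 1 else - 1) = sg i" using sg_cases[of i] by auto
        then show ?thesis
          using FF_hyperbolic[OF r r1 \<epsilon>(1) less_imp_le[OF K] _ less_imp_le[OF LA(1)] r2 e1 that] LA(2) by simp
      qed
      show "\<bar>(\<epsilon> *\<^sub>R q x) $ i - (\<epsilon> *\<^sub>R q y) $ i\<bar> \<le> \<epsilon> * Lq * norm (x - y)" for x y i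
      proof -
        have "\<bar>(q x - q y) $ i\<bar> \<le> Lq * norm (x - y)" using component_le_norm_cart[of "q x - q y" i] Lq(2)[of x y] by linarith
        then have "\<epsilon> * \<bar>q x $ i - q y $ i\<bar> \<le> \<epsilon> * (Lq * norm (x - y))" using \<epsilon> by (intro mult_left_mono) auto
        moreover have "\<bar>(\<epsilon> *\<^sub>R q x) $ i - (\<epsilon> *\<^sub>R q y) $ i\<bar> = \<epsilon> * \<bar>q x $ i - q y $ i\<bar>"
          using \<epsilon> by (simp add: abs_mult flip: right_diff_distrib)
        ultimately show ?thesis by simp
      qed
      show "bounded_linear (\<lambda>x::'n slow. snd (snd x))"
        by (rule bounded_linear_compose[OF bounded_linear_snd bounded_linear_snd])
      show "snd (snd (gg u x)) = 1" for u x by (simp add: gg_def)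
    qed (use L c \<epsilon> R Lq e2 in \<open>auto simp: E_def K_def\<close>)
    have cf: "c1_flow ?f f' (L0 + 1)"
      by (rule c1_flow.intro) (use L0' L0(1) f' in auto)
    have bm: "boundary_manifold (FF r \<epsilon>) gg (\<lambda>x. snd (snd x)) (\<lambda>i. sg i = 1) (\<lambda>x. \<epsilon> *\<^sub>R q x) L K (c / (8 * \<epsilon>)) E (\<epsilon> * Lq) (- R) R f' (L0 + 1) B'"
      by (rule boundary_manifold.intro[OF hs cf boundary_manifold_axioms.intro[OF B']])
    have "truncated_manifold I lam \<eta> k \<sigma> R c r \<epsilon> L K E Lq f' (L0 + 1) B' LA Am Pm Qm Gm Cu Cw"
      by (rule truncated_manifold.intro[OF truncated_system_axioms bm], rule truncated_manifold_axioms.intro)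
         (use \<epsilon> r r1 r4 LA Am Pm Qm Lq Gm e3 in \<open>auto simp: N_def Cu_def Cw_def\<close>)
    then show "\<exists>f' L0 B'. truncated_manifold I lam \<eta> k \<sigma> R c r \<epsilon> L K E Lq f' L0 B' LA Am Pm Qm Gm Cu Cw" by blast
  qed (use Mi r3 r in \<open>auto simp: N_def\<close>)
qed


section \<open>Assembly over a single domain\<close>

lemma smooth_on_imp_C1: "smooth_on UNIV I \<Longrightarrow> C1 I"
proof -
  assume "smooth_on UNIV I"
  then have "Ck_on (Suc 0) UNIV I" unfolding smooth_on_def by blast
  then show "C1 I"
    by (intro C1I[where f'="\<lambda>x. frechet_derivative I (at x)"]) (auto simp: frechet_derivative_works)
qed

lemma C1_within_continuous_on: "C1_within D h \<Longrightarrow> continuous_on D h"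
  unfolding C1_within_def continuous_on_eq_continuous_within by (meson has_derivative_continuous)

lemma graph_over_topology:
  assumes h: "continuous_on D h" and D: "compact D" "simply_connected D"
  shows "compact (graph_over D h)" "simply_connected (graph_over D h)"
proof -
  have c: "continuous_on D (\<lambda>x. (h x, x))" by (intro continuous_on_Pair h continuous_on_id)
  show "compact (graph_over D h)" unfolding graph_over_def by (rule compact_continuous_image[OF c D(1)])
  have "homeomorphism D (graph_over D h) (\<lambda>x. (h x, x)) snd"
    unfolding homeomorphism_def graph_over_def
    by (auto intro: c continuous_on_snd continuous_on_id simp: image_image)
  then have "D homeomorphic graph_over D h" unfolding homeomorphic_def by blast
  then show "simply_connected (graph_over D h)" using homeomorphic_simply_connected_eq D(2) by blast
qed

lemma slow_invariant_familyI:
  assumes D: "compact D" "simply_connected D"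
    and h: "\<And>\<epsilon>. 0 < \<epsilon> \<Longrightarrow> \<epsilon> < \<epsilon>0 \<Longrightarrow> C1_within D (h \<epsilon>) \<and> locally_invariant I lam \<eta> \<epsilon> D (h \<epsilon>)"
    and ap: "\<And>i. \<exists>C. \<forall>\<^sub>F \<epsilon> in at_right 0. \<forall>x\<in>D. \<bar>h \<epsilon> x $ i - slow_manifold_approx I lam k \<epsilon> x i\<bar> \<le> C * \<epsilon>\<^sup>2"
  shows "slow_invariant_family I lam \<eta> k D \<epsilon>0 h"
  unfolding slow_invariant_family_def
proof (intro conjI allI impI)
  fix \<epsilon> assume "0 < \<epsilon> \<and> \<epsilon> < \<epsilon>0"
  then have "C1_within D (h \<epsilon>)" "locally_invariant I lam \<eta> \<epsilon> D (h \<epsilon>)" using h by auto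
  then show "C1_within D (h \<epsilon>)" "locally_invariant I lam \<eta> \<epsilon> D (h \<epsilon>)"
    "compact (graph_over D (h \<epsilon>))" "simply_connected (graph_over D (h \<epsilon>))"
    using graph_over_topology[OF C1_within_continuous_on D] by auto
qed (rule ap)

text \<open>Multiplying by \<open>(-1) powi k i\<close> reduces the two stability inequalities for
  all components to the sign of one function of \<open>x\<close>; on connected \<open>D\<close> the
  classification becomes a statement about \<open>sg\<close>.\<close>

lemma stability_margin:
  fixes I :: "real \<Rightarrow> real" and \<alpha> :: "real^'n::finite"
  shows "(-1) powi k i * I \<theta> - (\<Sum>j\<in>UNIV - {i}. \<alpha>$j * (-1) powi (k j + k i)) - \<alpha>$i =
    (-1) powi k i * (I \<theta> - (\<Sum>j\<in>UNIV. (-1) powi k j * \<alpha>$j))"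
proof -
  have p: "(-1::real) powi (k j + k i) = (-1) powi k i * (-1) powi k j" for j
    by (simp add: power_int_add mult.commute)
  have ii: "(-1::real) powi k i * (-1) powi k i = 1" using powi_minus_one_cases[of "k i"] by auto
  have "(-1) powi k i * (\<Sum>j\<in>UNIV. (-1) powi k j * \<alpha>$j) = (\<Sum>j\<in>UNIV. \<alpha>$j * (-1) powi (k j + k i))"
    unfolding sum_distrib_left p by (intro sum.cong refl) simp
  also have "\<dots> = \<alpha>$i * ((-1) powi k i * (-1) powi k i) + (\<Sum>j\<in>UNIV - {i}. \<alpha>$j * (-1) powi (k j + k i))"
    by (subst sum.remove[of UNIV i]) (auto simp: p)
  finally show ?thesis unfolding ii by (simp add: right_diff_distrib)
qed

theorem slow_manifold_over_domain:
  fixes k :: "'n::finite \<Rightarrow> int" and D :: "'n slow set"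
  assumes smooth: "smooth_on UNIV I" and lam: "lam > 0" and adm: "admissible_domain I k D"
  shows "\<exists>\<epsilon>0>0. \<exists>h :: real \<Rightarrow> 'n slow \<Rightarrow> real^'n.
     slow_invariant_family I lam \<eta> k D \<epsilon>0 h \<and>
     (attracting_condition I k D \<longrightarrow> attracting I lam \<eta> D \<epsilon>0 h) \<and>
     (repelling_condition I k D \<longrightarrow> repelling I lam \<eta> D \<epsilon>0 h) \<and>
     (\<not> attracting_condition I k D \<and> \<not> repelling_condition I k D \<longrightarrow>
        (\<forall>\<epsilon>. 0 < \<epsilon> \<and> \<epsilon> < \<epsilon>0 \<longrightarrow> saddle_type I D (h \<epsilon>)))"
proof (cases "D = {}")
  \<comment> \<open>The sign \<open>\<sigma>\<close> and the minimum below need a point of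
    \<open>D\<close>. Over the empty set both stability conditions hold and every claim is
    vacuous.\<close>
  case True
  show ?thesis
    unfolding True
    by (rule exI[of _ 1], simp, rule exI[of _ "\<lambda>_ _. 0"])
       (auto simp: slow_invariant_family_def C1_within_def locally_invariant_def graph_over_def attracting_def
          repelling_def attracting_condition_def saddle_type_def intro!: exI[of _ "1::real"])
next
  case False
  have D: "compact D" "simply_connected D" using adm by (auto simp: admissible_domain_def)
  have C1I: "C1 I" by (rule smooth_on_imp_C1[OF smooth])
  define J :: "'n slow \<Rightarrow> real" where
    "J x = I (snd (snd x)) - (\<Sum>j\<in>UNIV. (-1) powi k j * fst (snd x) $ j)" for x
  have J0: "J x \<noteq> 0" if "x \<in> D" for x using adm that by (auto simp: admissible_domain_def J_def)
  have J_cont: "continuous_on S J" for S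
    unfolding J_def by (intro continuous_intros continuous_on_compose2[OF C1_continuous[OF C1I, of UNIV]]) auto
  obtain x0 where x0: "x0 \<in> D" using False by blast
  define \<sigma> :: real where "\<sigma> = sgn (J x0)"
  have \<sigma>: "\<sigma> = 1 \<or> \<sigma> = -1" using J0[OF x0] by (auto simp: \<sigma>_def sgn_if)
  have pos: "\<sigma> * J x > 0" if x: "x \<in> D" for x
  proof (rule ccontr)
    assume neg: "\<not> ?thesis"
    have "connected (J ` D)"
      by (intro connected_continuous_image J_cont simply_connected_imp_connected D)
    then have iv: "is_interval (J ` D)" by (simp add: is_interval_connected_1)
    have "J x0 \<in> J ` D" "J x \<in> J ` D" using x x0 by auto
    moreover have "J x0 \<le> 0 \<and> 0 \<le> J x \<or> J x \<le> 0 \<and> 0 \<le> J x0"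
      using neg by (auto simp: \<sigma>_def sgn_if split: if_splits)
    ultimately have "0 \<in> J ` D" using iv unfolding is_interval_1 by blast
    then show False using J0 by auto
  qed
  obtain x1 where x1: "x1 \<in> D" "\<And>x. x \<in> D \<Longrightarrow> \<sigma> * J x1 \<le> \<sigma> * J x"
    using continuous_attains_inf[OF D(1) False continuous_on_mult[OF continuous_on_const J_cont], of \<sigma>] by blast
  \<comment> \<open>Half of the minimum of the absolute value of \<open>J\<close> over
    \<open>D\<close>, so that \<open>D_ok\<close> holds with its margin
    \<open>2 * c\<close>.\<close>
  define c where "c = \<sigma> * J x1 / 2"
  have c: "c > 0" using pos[OF x1(1)] by (simp add: c_def)
  obtain R where R: "R > 0" "\<And>x. x \<in> D \<Longrightarrow> norm x \<le> R"
    using compact_imp_bounded[OF D(1)] unfolding bounded_pos by blast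
  have comp: "\<bar>fst x $ i\<bar> \<le> R" "\<bar>fst (snd x) $ i\<bar> \<le> R" "\<bar>snd (snd x)\<bar> \<le> R" if "x \<in> D" for x i
  proof -
    have f: "norm (fst x) \<le> R" "norm (snd x) \<le> R"
      using R(2)[OF that] norm_fst_le[of "fst x" "snd x"] norm_snd_le[of "snd x" "fst x"] by auto
    then have g: "norm (fst (snd x)) \<le> R" "norm (snd (snd x)) \<le> R"
      using norm_fst_le[of "fst (snd x)" "snd (snd x)"] norm_snd_le[of "snd (snd x)" "fst (snd x)"] by auto
    show "\<bar>fst x $ i\<bar> \<le> R" "\<bar>fst (snd x) $ i\<bar> \<le> R" "\<bar>snd (snd x)\<bar> \<le> R"
      using f g component_le_norm_cart[of "fst x" i] component_le_norm_cart[of "fst (snd x)" i] by auto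
  qed
  interpret ts: truncated_system I lam \<eta> k \<sigma> R c
    by standard (use C1I lam \<sigma> R c in auto)
  obtain r L K E Lq LA Am Pm Qm Gm Cu Cw \<epsilon>0 Mi where e0: "\<epsilon>0 > 0"
    and tm: "\<And>\<epsilon>. 0 < \<epsilon> \<Longrightarrow> \<epsilon> < \<epsilon>0 \<Longrightarrow>
      \<exists>f' L0 B'. truncated_manifold I lam \<eta> k \<sigma> R c r \<epsilon> L K E Lq f' L0 B' LA Am Pm Qm Gm Cu Cw"
    and Mi: "\<And>u x. \<bar>ts.In u x\<bar> \<le> Mi" "Mi * r + 2 * (CARD('n) * (R * r)) \<le> c" and r: "r > 0"
    using ts.truncated_manifold_exists by metis
  have sgJ: "(-1) powi k i * J x > 0 \<longleftrightarrow> ts.sg i = 1" "(-1) powi k i * J x < 0 \<longleftrightarrow> ts.sg i = -1" if "x \<in> D" for x i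
    using pos[OF that] \<sigma> ts.s_cases[of i] by (auto simp: ts.sg_def ts.s_def)
  have att: "attracting_condition I k D \<longleftrightarrow> (\<forall>i. ts.sg i = 1)"
  proof -
    have "attracting_condition I k D \<longleftrightarrow> (\<forall>x\<in>D. \<forall>i. (-1) powi k i * J x > 0)"
      unfolding attracting_condition_def J_def stability_margin[symmetric] by (auto split: prod.splits)
    then show ?thesis using sgJ(1) x0 by blast
  qed
  have rep: "repelling_condition I k D \<longleftrightarrow> (\<forall>i. ts.sg i = -1)"
  proof -
    have "repelling_condition I k D \<longleftrightarrow> (\<forall>x\<in>D. \<forall>i. (-1) powi k i * J x < 0)"
      unfolding repelling_condition_def J_def stability_margin[symmetric] by (auto split: prod.splits)
    then show ?thesis using sgJ(2) x0 by blast
  qed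
  let ?N = "real (2 * CARD('n))"
  \<comment> \<open>Everything that concerns a single \<epsilon>, with \<open>r\<close>,
    \<open>c\<close> and \<open>Cw\<close> fixed in advance. The function \<open>h\<close> may then
    be chosen separately for each \<epsilon> and the constants still serve all of them.\<close>
  define P where "P \<epsilon> h \<longleftrightarrow> C1_within D h \<and> locally_invariant I lam \<eta> \<epsilon> D h \<and>
     (\<forall>x\<in>D. \<forall>i. \<bar>h x $ i - slow_manifold_approx I lam k \<epsilon> x i\<bar> \<le> Cw * \<epsilon>\<^sup>2) \<and>
     ((\<forall>i. ts.sg i = 1) \<longrightarrow> (\<forall>\<tau> \<omega> x. 0 \<le> \<tau> \<and> solution_on I lam \<eta> \<epsilon> {0..\<epsilon> * \<tau>} \<omega> x \<and> (\<forall>t\<in>{0..\<epsilon> * \<tau>}. x t \<in> D) \<and>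
        norm (\<omega> 0 - h (x 0)) < r / 2 \<longrightarrow>
        norm (\<omega> (\<epsilon> * \<tau>) - h (x (\<epsilon> * \<tau>))) \<le> ?N * exp (- (c / 16) * \<tau>) * norm (\<omega> 0 - h (x 0)))) \<and>
     ((\<forall>i. ts.sg i = -1) \<longrightarrow> (\<forall>\<tau> \<omega> x. 0 \<le> \<tau> \<and> solution_on I lam \<eta> \<epsilon> {- (\<epsilon> * \<tau>)..0} \<omega> x \<and> (\<forall>t\<in>{- (\<epsilon> * \<tau>)..0}. x t \<in> D) \<and>
        norm (\<omega> 0 - h (x 0)) < r / 2 \<longrightarrow>
        norm (\<omega> (- (\<epsilon> * \<tau>)) - h (x (- (\<epsilon> * \<tau>)))) \<le> ?N * exp (- (c / 16) * \<tau>) * norm (\<omega> 0 - h (x 0)))) \<and>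
     ((\<exists>i. ts.sg i = 1) \<and> (\<exists>i. ts.sg i \<noteq> 1) \<longrightarrow> saddle_type I D h)"
    for \<epsilon> and h :: "'n slow \<Rightarrow> real^'n"
  have "\<exists>h. P \<epsilon> h" if \<epsilon>: "0 < \<epsilon>" "\<epsilon> < \<epsilon>0" for \<epsilon>
  proof -
    obtain f' L0 B' where "truncated_manifold I lam \<eta> k \<sigma> R c r \<epsilon> L K E Lq f' L0 B' LA Am Pm Qm Gm Cu Cw"
      using tm[OF \<epsilon>] by blast
    then interpret truncated_manifold I lam \<eta> k \<sigma> R c r \<epsilon> L K E Lq f' L0 B' LA Am Pm Qm Gm Cu Cw .
    have ok: "D_ok D"
      unfolding D_ok_def
    proof (intro ballI conjI allI)
      fix x assume x: "x \<in> D"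
      show "2 * c \<le> \<sigma> * (I (snd (snd x)) - (\<Sum>j\<in>UNIV. ts.s j * fst (snd x) $ j))"
        using x1(2)[OF x] by (simp add: c_def J_def ts.s_def)
    qed (use comp in auto)
    have "P \<epsilon> hw"
      unfolding P_def
    proof (intro conjI impI ballI allI)
      show "C1_within D hw" by (rule C1_within_hw[OF ok])
      show "locally_invariant I lam \<eta> \<epsilon> D hw" by (rule locally_invariant_hw[OF ok])
    next
      fix x i assume "x \<in> D"
      then show "\<bar>hw x $ i - slow_manifold_approx I lam k \<epsilon> x i\<bar> \<le> Cw * \<epsilon>\<^sup>2" by (rule hw_approx[OF ok])
    next
      fix \<tau> \<omega> x
      assume "\<forall>i. ts.sg i = 1" "0 \<le> \<tau> \<and> solution_on I lam \<eta> \<epsilon> {0..\<epsilon> * \<tau>} \<omega> x \<and> (\<forall>t\<in>{0..\<epsilon> * \<tau>}. x t \<in> D) \<and> norm (\<omega> 0 - hw (x 0)) < r / 2"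
      then show "norm (\<omega> (\<epsilon> * \<tau>) - hw (x (\<epsilon> * \<tau>))) \<le> ?N * exp (- (c / 16) * \<tau>) * norm (\<omega> 0 - hw (x 0))"
        using attracting_hw[OF ok, of \<tau> \<omega> x] by blast
    next
      fix \<tau> \<omega> x
      assume "\<forall>i. ts.sg i = -1" "0 \<le> \<tau> \<and> solution_on I lam \<eta> \<epsilon> {- (\<epsilon> * \<tau>)..0} \<omega> x \<and> (\<forall>t\<in>{- (\<epsilon> * \<tau>)..0}. x t \<in> D) \<and> norm (\<omega> 0 - hw (x 0)) < r / 2"
      then show "norm (\<omega> (- (\<epsilon> * \<tau>)) - hw (x (- (\<epsilon> * \<tau>)))) \<le> ?N * exp (- (c / 16) * \<tau>) * norm (\<omega> 0 - hw (x 0))"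
        using repelling_hw[OF ok, of \<tau> \<omega> x] by blast
    next
      assume "(\<exists>i. ts.sg i = 1) \<and> (\<exists>i. ts.sg i \<noteq> 1)"
      then show "saddle_type I D hw" using saddle_type_hw[OF ok Mi] by blast
    qed
    then show ?thesis by blast
  qed
  then obtain h where h: "\<And>\<epsilon>. 0 < \<epsilon> \<Longrightarrow> \<epsilon> < \<epsilon>0 \<Longrightarrow> P \<epsilon> (h \<epsilon>)" by metis
  have "slow_invariant_family I lam \<eta> k D \<epsilon>0 h"
  proof (rule slow_invariant_familyI[OF D])
    show "C1_within D (h \<epsilon>) \<and> locally_invariant I lam \<eta> \<epsilon> D (h \<epsilon>)" if "0 < \<epsilon>" "\<epsilon> < \<epsilon>0" for \<epsilon>
      using h[OF that] by (simp add: P_def)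
    fix i
    show "\<exists>C. \<forall>\<^sub>F \<epsilon> in at_right 0. \<forall>x\<in>D. \<bar>h \<epsilon> x $ i - slow_manifold_approx I lam k \<epsilon> x i\<bar> \<le> C * \<epsilon>\<^sup>2"
      unfolding eventually_at_right_field using h e0 unfolding P_def
      by (intro exI[of _ Cw] exI[of _ \<epsilon>0]) auto
  qed
  moreover have "attracting I lam \<eta> D \<epsilon>0 h" if "attracting_condition I k D"
    unfolding attracting_def
  proof (rule exI[of _ ?N], rule conjI, simp, rule exI[of _ "c / 16"], rule conjI, use c in simp,
      rule exI[of _ "r / 2"], rule conjI, use r in simp, intro allI impI, elim conjE)
    fix \<epsilon> \<tau> \<omega> x
    assume "0 < \<epsilon>" "\<epsilon> < \<epsilon>0" "0 \<le> \<tau>" "solution_on I lam \<eta> \<epsilon> {0..\<epsilon> * \<tau>} \<omega> x" "\<forall>t\<in>{0..\<epsilon> * \<tau>}. x t \<in> D"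
      "norm (\<omega> 0 - h \<epsilon> (x 0)) < r / 2"
    then show "norm (\<omega> (\<epsilon> * \<tau>) - h \<epsilon> (x (\<epsilon> * \<tau>))) \<le> ?N * exp (- (c / 16) * \<tau>) * norm (\<omega> 0 - h \<epsilon> (x 0))"
      using h[of \<epsilon>] that unfolding P_def att by blast
  qed
  moreover have "repelling I lam \<eta> D \<epsilon>0 h" if "repelling_condition I k D"
    unfolding repelling_def
  proof (rule exI[of _ ?N], rule conjI, simp, rule exI[of _ "c / 16"], rule conjI, use c in simp,
      rule exI[of _ "r / 2"], rule conjI, use r in simp, intro allI impI, elim conjE)
    fix \<epsilon> \<tau> \<omega> x
    assume "0 < \<epsilon>" "\<epsilon> < \<epsilon>0" "0 \<le> \<tau>" "solution_on I lam \<eta> \<epsilon> {- (\<epsilon> * \<tau>)..0} \<omega> x" "\<forall>t\<in>{- (\<epsilon> * \<tau>)..0}. x t \<in> D"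
      "norm (\<omega> 0 - h \<epsilon> (x 0)) < r / 2"
    then show "norm (\<omega> (- (\<epsilon> * \<tau>)) - h \<epsilon> (x (- (\<epsilon> * \<tau>)))) \<le> ?N * exp (- (c / 16) * \<tau>) * norm (\<omega> 0 - h \<epsilon> (x 0))"
      using h[of \<epsilon>] that unfolding P_def rep by blast
  qed
  moreover have "saddle_type I D (h \<epsilon>)"
    if nn: "\<not> attracting_condition I k D \<and> \<not> repelling_condition I k D" and \<epsilon>: "0 < \<epsilon>" "\<epsilon> < \<epsilon>0" for \<epsilon>
  proof -
    have "\<exists>i. ts.sg i \<noteq> 1" "\<exists>i. ts.sg i = 1" using nn ts.sg_cases unfolding att rep by blast+
    then show ?thesis using h[OF \<epsilon>] unfolding P_def by blast
  qed
  ultimately show ?thesis using e0 by blast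
qed


section \<open>Balls as submanifolds with boundary\<close>

lemma has_frechet_derivative_at: "(f has_derivative f') (at x) \<Longrightarrow> frechet_derivative f (at x) = f'"
  by (rule frechet_derivative_at[symmetric])

text \<open>On an open set functions that agree have the same derivatives, which lets explicit
  derivatives replace \<open>frechet_derivative\<close> in the recursive definition.\<close>

lemma Ck_on_cong:
  assumes "open S" shows "(\<And>x. x \<in> S \<Longrightarrow> f x = g x) \<Longrightarrow> Ck_on n S f \<Longrightarrow> Ck_on n S g"
proof (induction n arbitrary: f g)
  case 0
  from continuous_on_eq[OF 0(2)[unfolded Ck_on.simps] 0(1)] show ?case by simp
next
  case (Suc n)
  have d: "(g has_derivative frechet_derivative f (at x)) (at x)" if "x \<in> S" for x
  proof (rule has_derivative_transform_within_open[OF _ assms that Suc.prems(1)])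
    show "(f has_derivative frechet_derivative f (at x)) (at x)"
      using Suc.prems(2) that by (simp add: frechet_derivative_works[symmetric])
  qed
  have "Ck_on n S (\<lambda>x. frechet_derivative g (at x) v)" for v
  proof (rule Suc.IH)
    show "frechet_derivative f (at x) v = frechet_derivative g (at x) v" if "x \<in> S" for x
      using has_frechet_derivative_at[OF d[OF that]] by simp
    show "Ck_on n S (\<lambda>x. frechet_derivative f (at x) v)" using Suc.prems by simp
  qed
  moreover have "g differentiable (at x)" if "x \<in> S" for x using d[OF that] by (rule differentiableI)
  ultimately show ?case by simp
qed

lemma Ck_on_SucI:
  assumes "open S" "\<And>x. x \<in> S \<Longrightarrow> (f has_derivative f' x) (at x)" "\<And>v. Ck_on n S (\<lambda>x. f' x v)"
  shows "Ck_on (Suc n) S f"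
proof -
  have "Ck_on n S (\<lambda>x. frechet_derivative f (at x) v)" for v
    by (rule Ck_on_cong[OF assms(1) _ assms(3)[of v]]) (simp add: has_frechet_derivative_at[OF assms(2)])
  moreover have "f differentiable (at x)" if "x \<in> S" for x using assms(2)[OF that] by (rule differentiableI)
  ultimately show ?thesis by simp
qed

lemma Ck_on_Suc_imp: "Ck_on (Suc n) S f \<Longrightarrow> Ck_on n S f"
proof (induction n arbitrary: f)
  case 0
  then show ?case by (auto intro!: continuous_at_imp_continuous_on differentiable_imp_continuous_within)
next
  case (Suc n)
  then show ?case by simp
qed

lemma Ck_on_derivative:
  assumes "Ck_on (Suc n) S f"
  shows "x \<in> S \<Longrightarrow> (f has_derivative frechet_derivative f (at x)) (at x)" "Ck_on n S (\<lambda>x. frechet_derivative f (at x) v)"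
  using assms by (simp_all add: frechet_derivative_works[symmetric])

lemma Ck_on_const: "open S \<Longrightarrow> Ck_on n S (\<lambda>_. c)"
proof (induction n arbitrary: c)
  case (Suc n)
  then show ?case by (intro Ck_on_SucI[where f'="\<lambda>_ _. 0"]) auto
qed simp

lemma Ck_on_id: "open S \<Longrightarrow> Ck_on n S (\<lambda>x. x)"
proof (cases n)
  case (Suc m)
  assume "open S"
  then show ?thesis unfolding Suc by (intro Ck_on_SucI[where f'="\<lambda>_ v. v"]) (auto intro: Ck_on_const)
qed simp

lemma Ck_on_add: "open S \<Longrightarrow> Ck_on n S f \<Longrightarrow> Ck_on n S g \<Longrightarrow> Ck_on n S (\<lambda>x. f x + g x)"
proof (induction n arbitrary: f g)
  case (Suc n)
  show ?case
  proof (rule Ck_on_SucI[OF Suc.prems(1)])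
    show "((\<lambda>x. f x + g x) has_derivative (\<lambda>v. frechet_derivative f (at x) v + frechet_derivative g (at x) v)) (at x)"
      if "x \<in> S" for x
      by (rule has_derivative_add[OF Ck_on_derivative(1)[OF Suc.prems(2) that] Ck_on_derivative(1)[OF Suc.prems(3) that]])
    show "Ck_on n S (\<lambda>x. frechet_derivative f (at x) v + frechet_derivative g (at x) v)" for v
      by (rule Suc.IH[OF Suc.prems(1) Ck_on_derivative(2)[OF Suc.prems(2)] Ck_on_derivative(2)[OF Suc.prems(3)]])
  qed
qed (simp add: continuous_on_add)

text \<open>One product rule for multiplication, scaling and inner products. The product rule pairs
  a derivative with an undifferentiated factor, so the latter has to be lowered by one order
  first.\<close>

lemma Ck_on_bilinear:
  assumes "bounded_bilinear b" and S: "open S"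
  shows "Ck_on n S f \<Longrightarrow> Ck_on n S g \<Longrightarrow> Ck_on n S (\<lambda>x. b (f x) (g x))"
proof (induction n arbitrary: f g)
  case 0
  then show ?case using bounded_bilinear.continuous_on[OF assms(1), of S f g] by simp
next
  case (Suc n)
  note f = Ck_on_Suc_imp[OF Suc.prems(1)] Ck_on_derivative(2)[OF Suc.prems(1)]
  note g = Ck_on_Suc_imp[OF Suc.prems(2)] Ck_on_derivative(2)[OF Suc.prems(2)]
  show ?case
  proof (rule Ck_on_SucI[OF S])
    show "((\<lambda>x. b (f x) (g x)) has_derivative
        (\<lambda>v. b (f x) (frechet_derivative g (at x) v) + b (frechet_derivative f (at x) v) (g x))) (at x)"
      if "x \<in> S" for x
      by (rule bounded_bilinear.FDERIV[OF assms(1) Ck_on_derivative(1)[OF Suc.prems(1) that] Ck_on_derivative(1)[OF Suc.prems(2) that]])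
    show "Ck_on n S (\<lambda>x. b (f x) (frechet_derivative g (at x) v) + b (frechet_derivative f (at x) v) (g x))" for v
      by (rule Ck_on_add[OF S Suc.IH[OF f(1) g(2)] Suc.IH[OF f(2) g(1)]])
  qed
qed

lemma Ck_on_inverse:
  fixes f :: "'a::real_normed_vector \<Rightarrow> real"
  assumes S: "open S" and nz: "\<And>x. x \<in> S \<Longrightarrow> f x \<noteq> 0"
  shows "Ck_on n S f \<Longrightarrow> Ck_on n S (\<lambda>x. inverse (f x))"
proof (induction n)
  case 0
  then show ?case using nz by (auto intro: continuous_on_inverse)
next
  case (Suc n)
  have i: "Ck_on n S (\<lambda>x. inverse (f x))" by (rule Suc.IH[OF Ck_on_Suc_imp[OF Suc.prems]])
  note mult = Ck_on_bilinear[OF bounded_bilinear_mult S]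
  show ?case
  proof (rule Ck_on_SucI[OF S])
    show "((\<lambda>x. inverse (f x)) has_derivative (\<lambda>v. - (inverse (f x) * frechet_derivative f (at x) v * inverse (f x)))) (at x)"
      if "x \<in> S" for x
      by (rule Deriv.has_derivative_inverse[OF nz[OF that] Ck_on_derivative(1)[OF Suc.prems that]])
    have "Ck_on n S (\<lambda>x. - 1 * (inverse (f x) * frechet_derivative f (at x) v * inverse (f x)))" for v
      by (rule mult[OF Ck_on_const[OF S] mult[OF mult[OF i Ck_on_derivative(2)[OF Suc.prems]] i]])
    then show "Ck_on n S (\<lambda>x. - (inverse (f x) * frechet_derivative f (at x) v * inverse (f x)))" for v by simp
  qed
qed

text \<open>Inversion in the unit sphere. With \<open>inverse 0 = 0\<close> it fixes the origin and
  is an involution of the whole space, so the chart and its inverse are mutually inverse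
  everywhere.\<close>

definition inversion :: "'a::real_inner \<Rightarrow> 'a" where "inversion z = inverse (z \<bullet> z) *\<^sub>R z"

lemma inversion_inner: "inversion z \<bullet> inversion z = inverse (z \<bullet> z)"
  by (cases "z = 0") (auto simp: inversion_def field_simps)

lemma inversion_invol [simp]: "inversion (inversion z) = z"
proof (cases "z = 0")
  case False
  then show ?thesis unfolding inversion_def[of "inversion z"] inversion_inner by (simp add: inversion_def)
qed (simp add: inversion_def)

lemma inversion_eq_0 [simp]: "inversion z = 0 \<longleftrightarrow> z = 0"
  by (auto simp: inversion_def)

lemma Ck_on_inversion:
  fixes f :: "'a::euclidean_space \<Rightarrow> 'a"
  assumes "open S" "Ck_on n S f" "\<And>x. x \<in> S \<Longrightarrow> f x \<noteq> 0"
  shows "Ck_on n S (\<lambda>x. inversion (f x))"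
  unfolding inversion_def
  by (rule Ck_on_bilinear[OF bounded_bilinear_scaleR assms(1)
        Ck_on_inverse[OF assms(1) _ Ck_on_bilinear[OF bounded_bilinear_inner assms(1,2,2)]] assms(2)])
     (simp add: assms(3))

text \<open>An inversion centred at a boundary point maps the ball minus that point onto a half space.
  The sign \<open>sgm\<close> selects one of two antipodal centres, so that the two charts cover the ball.\<close>

lemma cball_inversion_chart:
  fixes ct b :: "'a::euclidean_space"
  assumes r: "r > 0" and b: "b \<in> Basis" and sgn: "sgm = 1 \<or> sgm = (-1::real)" and p: "p \<noteq> ct - (sgm * r) *\<^sub>R b"
  shows "\<exists>U V (\<phi> :: 'a \<Rightarrow> 'a) \<psi>. open U \<and> open V \<and> p \<in> U \<and> homeomorphism U V \<phi> \<psi> \<and>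
    smooth_on U \<phi> \<and> smooth_on V \<psi> \<and> \<phi> ` (U \<inter> cball ct r) = V \<inter> {y. 0 \<le> y \<bullet> b}"
proof -
  \<comment> \<open>The sphere passes through \<open>q\<close>, so inversion centred at
    \<open>q\<close> sends it to a hyperplane at distance \<open>1 / (2 * r)\<close>, and
    \<open>e\<close> moves this hyperplane through the origin. \<open>V\<close> omits
    \<open>- e\<close>, which only \<open>q\<close> itself would reach.\<close>
  define q where "q = ct - (sgm * r) *\<^sub>R b"
  define e where "e = (1 / (2 * r)) *\<^sub>R b"
  define U where "U = UNIV - {q}"
  define V where "V = UNIV - {- e}"
  define \<phi> where "\<phi> y = sgm *\<^sub>R inversion (y - q) - e" for y
  define \<psi> where "\<psi> y = q + inversion (sgm *\<^sub>R (y + e))" for y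
  have s0: "sgm *\<^sub>R z = 0 \<longleftrightarrow> z = 0" for z :: 'a using sgn by auto
  have bb: "b \<bullet> b = 1" using b by simp
  have sq: "sgm * sgm = 1" using sgn by auto
  have o: "open U" "open V" by (auto simp: U_def V_def open_delete)
  have \<psi>\<phi>: "\<psi> (\<phi> y) = y" for y by (simp add: \<psi>_def \<phi>_def sq)
  have \<phi>\<psi>: "\<phi> (\<psi> y) = y" for y by (simp add: \<psi>_def \<phi>_def sq)
  have \<phi>V: "\<phi> y \<in> V" if "y \<in> U" for y using that s0 by (auto simp: U_def V_def \<phi>_def)
  have \<psi>U: "\<psi> y \<in> U" if "y \<in> V" for y using that s0[of "y + e"] by (auto simp: U_def V_def \<psi>_def eq_neg_iff_add_eq_0)
  have sm\<phi>: "Ck_on n U \<phi>" for n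
  proof -
    have "Ck_on n U (\<lambda>y. sgm *\<^sub>R inversion (y + - q) + - e)"
      by (rule Ck_on_add[OF o(1) Ck_on_bilinear[OF bounded_bilinear_scaleR o(1) Ck_on_const[OF o(1)]
              Ck_on_inversion[OF o(1) Ck_on_add[OF o(1) Ck_on_id[OF o(1)] Ck_on_const[OF o(1)]]]] Ck_on_const[OF o(1)]])
         (simp add: U_def)
    then show ?thesis by (simp add: \<phi>_def[abs_def])
  qed
  have sm\<psi>: "Ck_on n V \<psi>" for n
    unfolding \<psi>_def[abs_def]
    by (rule Ck_on_add[OF o(2) Ck_on_const[OF o(2)] Ck_on_inversion[OF o(2)
            Ck_on_bilinear[OF bounded_bilinear_scaleR o(2) Ck_on_const[OF o(2)]
              Ck_on_add[OF o(2) Ck_on_id[OF o(2)] Ck_on_const[OF o(2)]]]]])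
       (use sgn in \<open>auto simp: V_def eq_neg_iff_add_eq_0\<close>)
  \<comment> \<open>Expanding the squared distance to the centre and dividing by
    \<open>z \<bullet> z\<close> turns the quadratic ball inequality into a linear one for the
    inverted point.\<close>
  have half: "y \<in> cball ct r \<longleftrightarrow> 0 \<le> \<phi> y \<bullet> b" if y: "y \<in> U" for y
  proof -
    define z where "z = y - q"
    have z: "z \<noteq> 0" using y by (simp add: U_def z_def)
    then have zz: "z \<bullet> z > 0" by simp
    have "y \<in> cball ct r \<longleftrightarrow> (norm (y - ct))\<^sup>2 \<le> r\<^sup>2"
      using r by (simp add: dist_norm norm_minus_commute power2_le_iff_abs_le)
    also have "y - ct = z - (sgm * r) *\<^sub>R b" by (simp add: z_def q_def)
    also have "(norm (z - (sgm * r) *\<^sub>R b))\<^sup>2 = z \<bullet> z - 2 * (sgm * r) * (z \<bullet> b) + (sgm * sgm) * r\<^sup>2 * (b \<bullet> b)"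
      unfolding power2_norm_eq_inner by (simp add: inner_diff_left inner_diff_right inner_commute power2_eq_square algebra_simps)
    also have "\<dots> \<le> r\<^sup>2 \<longleftrightarrow> z \<bullet> z \<le> 2 * r * (sgm * (z \<bullet> b))" unfolding sq bb by (simp add: mult_ac)
    also have "\<dots> \<longleftrightarrow> 1 / (2 * r) \<le> sgm * (z \<bullet> b) / (z \<bullet> z)"
    proof -
      have r2: "2 * r > 0" using r by simp
      show ?thesis
        unfolding pos_le_divide_eq[OF zz] times_divide_eq_left mult_1 pos_divide_le_eq[OF r2]
        by (simp only: mult.commute)
    qed
    also have "\<dots> \<longleftrightarrow> 0 \<le> \<phi> y \<bullet> b"
    proof -
      have "\<phi> y \<bullet> b = sgm * (inverse (z \<bullet> z) * (z \<bullet> b)) - 1 / (2 * r)"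
        unfolding \<phi>_def z_def[symmetric] inversion_def e_def by (simp add: inner_diff_left bb)
      also have "sgm * (inverse (z \<bullet> z) * (z \<bullet> b)) = sgm * (z \<bullet> b) / (z \<bullet> z)"
        unfolding divide_inverse by simp
      finally show ?thesis by linarith
    qed
    finally show ?thesis .
  qed
  have hom: "homeomorphism U V \<phi> \<psi>"
    unfolding homeomorphism_def
  proof (intro conjI ballI)
    show "\<phi> ` U = V"
    proof (intro equalityI subsetI)
      show "y \<in> \<phi> ` U" if "y \<in> V" for y using \<psi>U[OF that] \<phi>\<psi>[of y] by (metis imageI)
    qed (use \<phi>V in blast)
    show "\<psi> ` V = U"
    proof (intro equalityI subsetI)
      show "y \<in> \<psi> ` V" if "y \<in> U" for y using \<phi>V[OF that] \<psi>\<phi>[of y] by (metis imageI)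
    qed (use \<psi>U in blast)
    show "continuous_on U \<phi>" "continuous_on V \<psi>" using sm\<phi>[of 0] sm\<psi>[of 0] by auto
  qed (rule \<psi>\<phi>, rule \<phi>\<psi>)
  have "\<phi> ` (U \<inter> cball ct r) = V \<inter> {y. 0 \<le> y \<bullet> b}"
  proof (intro equalityI subsetI)
    fix w assume "w \<in> V \<inter> {y. 0 \<le> y \<bullet> b}"
    then have "w = \<phi> (\<psi> w)" "\<psi> w \<in> U" "0 \<le> \<phi> (\<psi> w) \<bullet> b" using \<phi>\<psi>[of w] \<psi>U by auto
    then show "w \<in> \<phi> ` (U \<inter> cball ct r)" using half by blast
  qed (use half \<phi>V in auto)
  moreover have "p \<in> U" using p by (simp add: U_def q_def)
  ultimately show ?thesis using o hom sm\<phi> sm\<psi> unfolding smooth_on_def by blast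
qed

lemma full_dim_submanifold_cball:
  fixes ct :: "'a::euclidean_space"
  assumes r: "r > 0" shows "full_dim_submanifold_with_boundary (cball ct r)"
  unfolding full_dim_submanifold_with_boundary_def
proof
  fix p :: 'a
  obtain b :: 'a where b: "b \<in> Basis" using nonempty_Basis by blast
  obtain sgm :: real where s: "sgm = 1 \<or> sgm = -1" "p \<noteq> ct - (sgm * r) *\<^sub>R b"
  proof (cases "p = ct - (1 * r) *\<^sub>R b")
    case True
    have "p \<noteq> ct - (-1 * r) *\<^sub>R b"
    proof
      assume "p = ct - (-1 * r) *\<^sub>R b"
      then have "(ct - (1 * r) *\<^sub>R b) \<bullet> b = (ct - (-1 * r) *\<^sub>R b) \<bullet> b" using True by metis
      then show False using r b by (simp add: inner_diff_left inner_add_left)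
    qed
    then show thesis using that[of "-1"] by simp
  qed (use that[of 1] in simp)
  show "\<exists>U V (\<phi> :: 'a \<Rightarrow> 'a) \<psi>. \<exists>b\<in>Basis. open U \<and> open V \<and> p \<in> U \<and> homeomorphism U V \<phi> \<psi> \<and>
        smooth_on U \<phi> \<and> smooth_on V \<psi> \<and> \<phi> ` (U \<inter> cball ct r) = V \<inter> {y. 0 \<le> y \<bullet> b}"
    using cball_inversion_chart[OF r b s] b by blast
qed


section \<open>Translation by full periods\<close>

definition period_shift :: "('n::finite \<Rightarrow> int) \<Rightarrow> 'n slow" where
  "period_shift m = (\<chi> i. 2 * pi * of_int (m i), 0, 0)"

lemma sin_cos_minus_period:
  "sin (y - 2 * pi * of_int m + w) = sin (y + w)" "cos (y - 2 * pi * of_int m + w) = cos (y + w)"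
proof -
  have e: "y - 2 * pi * of_int m + w = (y + w) + of_int (- 2 * m) * pi" by simp
  have "(-1::real) powi (- 2 * m) = 1" by simp
  then show "sin (y - 2 * pi * of_int m + w) = sin (y + w)" "cos (y - 2 * pi * of_int m + w) = cos (y + w)"
    unfolding e sin_cos_add_int_pi by simp_all
qed

lemma fields_period_shift:
  "fast_field I \<omega> (x - period_shift m) = fast_field I \<omega> x"
  "slow_field I lam \<eta> \<omega> (x - period_shift m) = slow_field I lam \<eta> \<omega> x"
proof -
  obtain \<Omega> \<alpha> \<theta> where x: "x = (\<Omega>, \<alpha>, \<theta>)" by (cases x)
  have s: "x - period_shift m = (\<Omega> - (\<chi> i. 2 * pi * of_int (m i)), \<alpha>, \<theta>)"
    by (simp add: x period_shift_def)
  show "fast_field I \<omega> (x - period_shift m) = fast_field I \<omega> x"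
    "slow_field I lam \<eta> \<omega> (x - period_shift m) = slow_field I lam \<eta> \<omega> x"
    unfolding s unfolding x fast_field_def slow_field_def case_prod_conv vector_minus_component vec_lambda_beta
      sin_cos_minus_period by (rule refl)+
qed

text \<open>Both fields are invariant under \<open>period_shift\<close>. Raising \<open>k\<close> by
  \<open>2 * m\<close> changes neither the signs \<open>(-1) powi k i\<close> nor, at the shifted
  point, the difference \<open>k i * pi - \<Omega>$i\<close>, so graph, expansion and range of
  \<epsilon> carry over unchanged.\<close>

lemma slow_invariant_family_translate:
  fixes k m :: "'n::finite \<Rightarrow> int"
  assumes fam: "slow_invariant_family I lam \<eta> k D \<epsilon>1 h" and D: "compact D" "simply_connected D"
  shows "slow_invariant_family I lam \<eta> (\<lambda>i. k i + 2 * m i) ((\<lambda>x. x + period_shift m) ` D) \<epsilon>1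
    (\<lambda>\<epsilon> x. h \<epsilon> (x - period_shift m))"
proof -
  let ?w = "period_shift m"
  let ?D = "(\<lambda>x. x + ?w) ` D"
  have mem: "x \<in> ?D \<longleftrightarrow> x - ?w \<in> D" for x by (force simp: image_iff)
  have im: "(\<lambda>x. x - ?w) ` ?D = D" by (simp add: image_image)
  have cw: "continuous_on S (\<lambda>x. x - ?w)" "continuous_on S (\<lambda>x. x + ?w)" for S by (intro continuous_intros)+
  have "homeomorphism D ?D (\<lambda>x. x + ?w) (\<lambda>x. x - ?w)"
    unfolding homeomorphism_def by (auto simp: cw image_image)
  then have sc: "simply_connected ?D" using D(2) homeomorphic_simply_connected_eq unfolding homeomorphic_def by blast
  have cp: "compact ?D" by (rule compact_continuous_image[OF cw(2) D(1)])
  show ?thesis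
  proof (rule slow_invariant_familyI[OF cp sc])
    fix \<epsilon> assume \<epsilon>: "0 < \<epsilon>" "\<epsilon> < \<epsilon>1"
    have h: "C1_within D (h \<epsilon>)" "locally_invariant I lam \<eta> \<epsilon> D (h \<epsilon>)"
      using fam \<epsilon> by (auto simp: slow_invariant_family_def)
    have "C1_within ?D (\<lambda>x. h \<epsilon> (x - ?w))"
    proof -
      obtain f' where f': "\<And>x. x \<in> D \<Longrightarrow> (h \<epsilon> has_derivative f' x) (at x within D)"
        "\<And>v. continuous_on D (\<lambda>x. f' x v)" using h(1) unfolding C1_within_def by blast
      show ?thesis unfolding C1_within_def
      proof (intro exI[of _ "\<lambda>x v. f' (x - ?w) v"] conjI ballI allI)
        fix x assume x: "x \<in> ?D"
        have "((\<lambda>x. x - ?w) has_derivative (\<lambda>v. v)) (at x within ?D)"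
          by (auto intro!: derivative_eq_intros)
        moreover have "(h \<epsilon> has_derivative f' (x - ?w)) (at (x - ?w) within (\<lambda>x. x - ?w) ` ?D)"
          unfolding im by (rule f'(1)) (use x mem in blast)
        ultimately show "((\<lambda>x. h \<epsilon> (x - ?w)) has_derivative (\<lambda>v. f' (x - ?w) v)) (at x within ?D)"
          by (rule has_derivative_in_compose)
      next
        show "continuous_on ?D (\<lambda>x. f' (x - ?w) v)" for v
          by (rule continuous_on_compose2[OF f'(2) cw(1)]) (simp add: im)
      qed
    qed
    moreover have "locally_invariant I lam \<eta> \<epsilon> ?D (\<lambda>x. h \<epsilon> (x - ?w))"
      unfolding locally_invariant_def
    proof (intro allI impI, elim conjE)
      fix J t0 \<omega> x
      assume J: "is_interval J" "t0 \<in> J" and so: "solution_on I lam \<eta> \<epsilon> J \<omega> x"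
        and xD: "\<forall>t\<in>J. x t \<in> ?D" and init: "(\<omega> t0, x t0) \<in> graph_over ?D (\<lambda>x. h \<epsilon> (x - ?w))"
      have gr: "(\<omega>', x') \<in> graph_over ?D (\<lambda>x. h \<epsilon> (x - ?w)) \<longleftrightarrow> (\<omega>', x' - ?w) \<in> graph_over D (h \<epsilon>)" for \<omega>' x'
        unfolding graph_over_def using mem[of x'] by (auto simp: image_iff)
      have "solution_on I lam \<eta> \<epsilon> J \<omega> (\<lambda>t. x t - ?w)"
        unfolding solution_on_def fields_period_shift
      proof
        fix t assume "t \<in> J"
        then have s: "\<exists>\<omega>'. (\<omega> has_vector_derivative \<omega>') (at t within J) \<and> \<epsilon> *\<^sub>R \<omega>' = fast_field I (\<omega> t) (x t)"
          and xd: "(x has_vector_derivative slow_field I lam \<eta> (\<omega> t) (x t)) (at t within J)"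
          using so unfolding solution_on_def by blast+
        have "((\<lambda>t. x t - ?w) has_vector_derivative slow_field I lam \<eta> (\<omega> t) (x t)) (at t within J)"
          using has_vector_derivative_diff[OF xd has_vector_derivative_const] by simp
        with s show "(\<exists>\<omega>'. (\<omega> has_vector_derivative \<omega>') (at t within J) \<and> \<epsilon> *\<^sub>R \<omega>' = fast_field I (\<omega> t) (x t)) \<and>
          ((\<lambda>t. x t - ?w) has_vector_derivative slow_field I lam \<eta> (\<omega> t) (x t)) (at t within J)" by blast
      qed
      moreover have "\<forall>t\<in>J. x t - ?w \<in> D" using xD mem by blast
      moreover have "(\<omega> t0, x t0 - ?w) \<in> graph_over D (h \<epsilon>)" using init gr by blast
      ultimately have "\<forall>t\<in>J. (\<omega> t, x t - ?w) \<in> graph_over D (h \<epsilon>)"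
        using h(2)[unfolded locally_invariant_def, rule_format, of J t0 \<omega> "\<lambda>t. x t - ?w"] J by blast
      then show "\<forall>t\<in>J. (\<omega> t, x t) \<in> graph_over ?D (\<lambda>x. h \<epsilon> (x - ?w))" using gr by blast
    qed
    ultimately show "C1_within ?D (\<lambda>x. h \<epsilon> (x - ?w)) \<and> locally_invariant I lam \<eta> \<epsilon> ?D (\<lambda>x. h \<epsilon> (x - ?w))" by blast
  next
    fix i
    have pw: "(-1::real) powi (k j + 2 * m j) = (-1) powi k j" for j by (simp add: power_int_add power_int_mult)
    have "slow_manifold_approx I lam (\<lambda>i. k i + 2 * m i) \<epsilon> x i = slow_manifold_approx I lam k \<epsilon> (x - ?w) i" for \<epsilon> x
      unfolding slow_manifold_approx_def pw by (cases x) (simp add: period_shift_def algebra_simps)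
    moreover obtain C where "\<forall>\<^sub>F \<epsilon> in at_right 0. \<forall>x\<in>D. \<bar>h \<epsilon> x $ i - slow_manifold_approx I lam k \<epsilon> x i\<bar> \<le> C * \<epsilon>\<^sup>2"
      using fam unfolding slow_invariant_family_def by blast
    then have "\<forall>\<^sub>F \<epsilon> in at_right 0. \<forall>x\<in>?D. \<bar>h \<epsilon> (x - ?w) $ i - slow_manifold_approx I lam k \<epsilon> (x - ?w) i\<bar> \<le> C * \<epsilon>\<^sup>2"
      by (rule eventually_mono) (use mem in blast)
    ultimately show "\<exists>C. \<forall>\<^sub>F \<epsilon> in at_right 0. \<forall>x\<in>?D. \<bar>h \<epsilon> (x - ?w) $ i - slow_manifold_approx I lam (\<lambda>i. k i + 2 * m i) \<epsilon> x i\<bar> \<le> C * \<epsilon>\<^sup>2"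
      by auto
  qed
qed

lemma slow_invariant_family_mono:
  "slow_invariant_family I lam \<eta> k D \<epsilon>0 h \<Longrightarrow> \<epsilon>1 \<le> \<epsilon>0 \<Longrightarrow> slow_invariant_family I lam \<eta> k D \<epsilon>1 h"
  unfolding slow_invariant_family_def by auto

lemma infinitely_many_slow_manifolds:
  assumes smooth: "smooth_on UNIV I" and lam: "lam > 0"
  shows "\<exists>\<epsilon>1>0. \<exists>(D :: ('n::finite \<Rightarrow> int) \<Rightarrow> 'n slow set) h.
        (\<forall>k. D k \<noteq> {} \<and> admissible_domain I k (D k) \<and>
             slow_invariant_family I lam \<eta> k (D k) \<epsilon>1 (h k)) \<and>
        (\<forall>\<epsilon>. 0 < \<epsilon> \<and> \<epsilon> < \<epsilon>1 \<longrightarrow> infinite (range (\<lambda>k. graph_over (D k) (h k \<epsilon>))))"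
proof -
  have "continuous_on UNIV I" by (rule C1_continuous[OF smooth_on_imp_C1[OF smooth]])
  then obtain \<delta> where \<delta>: "\<delta> > 0" "\<And>\<theta>. dist \<theta> 0 < \<delta> \<Longrightarrow> dist (I \<theta>) (I 0) < 1/2"
    unfolding continuous_on_iff by (metis UNIV_I half_gt_zero zero_less_one)
  define N where "N = real CARD('n)"
  have N: "N \<ge> 1" by (simp add: N_def Suc_le_eq)
  \<comment> \<open>With \<open>\<alpha>$j = (-1) powi k j * \<beta>\<close> the signs cancel in the
    sum, which becomes \<open>I 0 - 1\<close>. The centre of every ball thus has the difference 1
    that must stay away from 0.\<close>
  define \<beta> where "\<beta> = (I 0 - 1) / N"
  \<comment> \<open>Within this radius the variations of \<open>I\<close> and of the sum are each
    below 1/2, so the difference cannot vanish.\<close>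
  define \<rho> where "\<rho> = min (\<delta> / 2) (1 / (4 * N))"
  have \<rho>: "\<rho> > 0" "\<rho> < \<delta>" "N * \<rho> < 1/2"
  proof -
    show "\<rho> > 0" "\<rho> < \<delta>" using \<delta> N by (auto simp: \<rho>_def)
    have "\<rho> \<le> 1 / (4 * N)" by (simp add: \<rho>_def)
    then have "N * \<rho> \<le> 1/4" using N by (simp add: field_simps)
    then show "N * \<rho> < 1/2" by linarith
  qed
  \<comment> \<open>\<open>k i div 2\<close> moves the centre by full periods, while
    \<open>\<alpha>\<close> depends only on the parity of \<open>k i\<close>; this makes
    \<open>D k\<close> a translate of the domain of \<open>k i mod 2\<close>.\<close>
  define ct :: "('n \<Rightarrow> int) \<Rightarrow> 'n slow" where
    "ct k = (\<chi> i. 2 * pi * of_int (k i div 2), \<chi> i. (-1) powi k i * \<beta>, 0)" for k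
  define D where "D k = cball (ct k) \<rho>" for k
  have adm: "admissible_domain I k (D k)" for k
    unfolding admissible_domain_def
  proof (intro conjI ballI)
    show "compact (D k)" "simply_connected (D k)"
      by (auto simp: D_def convex_imp_simply_connected)
    show "full_dim_submanifold_with_boundary (D k)" unfolding D_def by (rule full_dim_submanifold_cball[OF \<rho>(1)])
    fix x assume x: "x \<in> D k"
    obtain \<Omega> \<alpha> \<theta> where xe: "x = (\<Omega>, \<alpha>, \<theta>)" by (cases x) auto
    have nx: "norm (x - ct k) \<le> \<rho>" using x by (simp add: D_def dist_norm norm_minus_commute)
    define z where "z = x - ct k"
    have le: "norm (fst w) \<le> norm w" for w :: "(real^'n) \<times> real" by (cases w) (simp add: norm_fst_le)
    have le': "norm (snd w) \<le> norm w" for w :: "(real^'n) \<times> real" by (cases w) (simp only: snd_conv norm_snd_le)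
    have "norm (snd z) \<le> norm z" by (cases z) (simp only: snd_conv norm_snd_le)
    then have ns: "norm (snd z) \<le> \<rho>" using nx by (simp add: z_def)
    have "snd z = (\<alpha> - (\<chi> i. (-1) powi k i * \<beta>), \<theta>)" by (simp add: z_def xe ct_def)
    then have \<theta>: "\<bar>\<theta>\<bar> \<le> \<rho>" and na: "norm (\<alpha> - (\<chi> i. (-1) powi k i * \<beta>)) \<le> \<rho>"
      using order_trans[OF le ns] order_trans[OF le' ns] by simp_all
    have \<alpha>: "\<bar>\<alpha>$j - (-1) powi k j * \<beta>\<bar> \<le> \<rho>" for j
      using na component_le_norm_cart[of "\<alpha> - (\<chi> i. (-1) powi k i * \<beta>)" j] by simp
    have sq: "(-1::real) powi k j * (-1) powi k j = 1" "\<bar>(-1::real) powi k j\<bar> = 1" for j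
      using powi_minus_one_cases[of "k j"] by auto
    have "(\<Sum>j\<in>UNIV. (-1) powi k j * \<alpha>$j) - N * \<beta> = (\<Sum>j\<in>UNIV. (-1) powi k j * (\<alpha>$j - (-1) powi k j * \<beta>))"
      by (simp add: right_diff_distrib sum_subtractf N_def sq(1) flip: mult.assoc)
    also have "\<bar>\<dots>\<bar> \<le> (\<Sum>j\<in>UNIV. \<bar>(-1) powi k j * (\<alpha>$j - (-1) powi k j * \<beta>)\<bar>)" by (rule sum_abs)
    also have "\<dots> \<le> (\<Sum>j\<in>(UNIV::'n set). \<rho>)" by (rule sum_mono) (simp only: abs_mult sq(2) mult_1_left \<alpha>)
    also have "\<dots> < 1/2" using \<rho>(3) by (simp add: N_def)
    finally have "\<bar>(\<Sum>j\<in>UNIV. (-1) powi k j * \<alpha>$j) - (I 0 - 1)\<bar> < 1/2" using N by (simp add: \<beta>_def)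
    moreover have "\<bar>I \<theta> - I 0\<bar> < 1/2" using \<delta>(2)[of \<theta>] \<theta> \<rho>(2) by (simp add: dist_real_def)
    ultimately have "I \<theta> \<noteq> (\<Sum>j\<in>UNIV. (-1) powi k j * \<alpha>$j)" by (simp add: abs_if split: if_splits)
    then show "case x of (\<Omega>, \<alpha>, \<theta>) \<Rightarrow> I \<theta> \<noteq> (\<Sum>j\<in>UNIV. (-1) powi k j * \<alpha>$j)" by (simp add: xe)
  qed
  have "\<forall>k. \<exists>e h. e > 0 \<and> slow_invariant_family I lam \<eta> k (D k) e h"
    using slow_manifold_over_domain[OF smooth lam adm] by blast
  then obtain e0 h0 where e0: "\<And>k. e0 k > 0" and h0: "\<And>k. slow_invariant_family I lam \<eta> k (D k) (e0 k) (h0 k)"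
    by metis
  \<comment> \<open>The functions with values 0 and 1, written in the form in which their finiteness
    is available.\<close>
  let ?S = "{k :: 'n \<Rightarrow> int. \<forall>i. (i \<in> UNIV \<longrightarrow> k i \<in> {0, 1}) \<and> (i \<notin> UNIV \<longrightarrow> k i = 0)}"
  have fin: "finite ?S" by (rule finite_set_of_finite_funs) auto
  have mod_S: "(\<lambda>i. k i mod 2) \<in> ?S" for k :: "'n \<Rightarrow> int"
    by auto
  define \<epsilon>1 where "\<epsilon>1 = Min (e0 ` ?S)"
  have \<epsilon>1: "\<epsilon>1 > 0" "\<And>k. k \<in> ?S \<Longrightarrow> \<epsilon>1 \<le> e0 k"
  proof -
    have "e0 (\<lambda>i. undefined mod 2) \<in> e0 ` ?S" by (rule imageI[OF mod_S])
    then have "e0 ` ?S \<noteq> {}" by (metis emptyE)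
    then have "Min (e0 ` ?S) \<in> e0 ` ?S" by (rule Min_in[OF finite_imageI[OF fin]])
    then obtain k where "Min (e0 ` ?S) = e0 k" by (rule imageE)
    then show "\<epsilon>1 > 0" unfolding \<epsilon>1_def by (simp only: e0)
    show "\<epsilon>1 \<le> e0 k" if "k \<in> ?S" for k
      unfolding \<epsilon>1_def by (rule Min_le[OF finite_imageI[OF fin] imageI[OF that]])
  qed
  define h where "h k \<epsilon> x = h0 (\<lambda>i. k i mod 2) \<epsilon> (x - period_shift (\<lambda>i. k i div 2))" for k \<epsilon> x
  have fam: "slow_invariant_family I lam \<eta> k (D k) \<epsilon>1 (h k)" for k
  proof -
    let ?k = "\<lambda>i. k i mod 2" and ?m = "\<lambda>i. k i div 2"
    have pw: "(-1::real) powi (k i mod 2) = (-1) powi k i" for i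
      by (cases "even (k i)") (simp_all add: mod_2_eq_odd)
    have "ct k = period_shift ?m + ct ?k"
      by (simp add: ct_def period_shift_def pw vec_eq_iff)
    then have Dk: "D k = (\<lambda>x. x + period_shift ?m) ` D ?k"
      unfolding D_def by (simp only: cball_translation[symmetric] add.commute[of _ "period_shift ?m"])
    have kk: "(\<lambda>i. ?k i + 2 * ?m i) = k" by (rule ext) simp
    have "slow_invariant_family I lam \<eta> (\<lambda>i. ?k i + 2 * ?m i) ((\<lambda>x. x + period_shift ?m) ` D ?k) \<epsilon>1
        (\<lambda>\<epsilon> x. h0 ?k \<epsilon> (x - period_shift ?m))"
    proof (rule slow_invariant_family_translate[OF slow_invariant_family_mono[OF h0 \<epsilon>1(2)[OF mod_S]]])
      show "compact (D ?k)" "simply_connected (D ?k)" using adm[of ?k] unfolding admissible_domain_def by blast+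
    qed
    then show ?thesis unfolding kk Dk h_def[abs_def] .
  qed
  have inf: "infinite (range (\<lambda>k. graph_over (D k) (h k \<epsilon>)))" for \<epsilon>
  proof
    let ?g = "\<lambda>k. graph_over (D k) (h k \<epsilon>)"
    assume fin: "finite (range ?g)"
    \<comment> \<open>The slow projection of a graph is its domain, and for constant even
      \<open>k\<close> the centres are distinct, so this subfamily already consists of pairwise
      different graphs.\<close>
    have "inj (\<lambda>m::int. ?g (\<lambda>_. 2 * m))"
    proof (rule injI)
      fix m m' :: int assume eq: "?g (\<lambda>_. 2 * m) = ?g (\<lambda>_. 2 * m')"
      have "snd ` ?g k = D k" for k by (simp add: graph_over_def image_image)
      then have "D (\<lambda>_. 2 * m) = D (\<lambda>_. 2 * m')" using eq by metis
      then have "ct (\<lambda>_. 2 * m) = ct (\<lambda>_. 2 * m')" using \<rho>(1) by (auto simp: D_def cball_eq_cball_iff)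
      then show "m = m'" by (simp add: ct_def vec_eq_iff)
    qed
    moreover have "finite (range (\<lambda>m::int. ?g (\<lambda>_. 2 * m)))" by (rule finite_subset[OF _ fin]) blast
    ultimately show False using finite_imageD[of "\<lambda>m::int. ?g (\<lambda>_. 2 * m)" UNIV] infinite_UNIV_int by blast
  qed
  have "D k \<noteq> {}" for k using \<rho>(1) by (simp add: D_def)
  then have "\<forall>k. D k \<noteq> {} \<and> admissible_domain I k (D k) \<and> slow_invariant_family I lam \<eta> k (D k) \<epsilon>1 (h k)"
    using adm fam by blast
  with inf show ?thesis by (intro exI[of _ \<epsilon>1] conjI \<epsilon>1(1) exI[of _ D] exI[of _ h] allI impI) blast+
qed

theorem theorem3:
  fixes I :: "real \<Rightarrow> real" and lam \<eta> :: real
  assumes "smooth_on UNIV I" and "lam > 0" and "\<eta> > 0"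
  shows
    "(\<exists>\<epsilon>1>0. \<exists>(D :: ('n::finite \<Rightarrow> int) \<Rightarrow> 'n slow set) h.
        (\<forall>k. D k \<noteq> {} \<and> admissible_domain I k (D k) \<and>
             slow_invariant_family I lam \<eta> k (D k) \<epsilon>1 (h k)) \<and>
        (\<forall>\<epsilon>. 0 < \<epsilon> \<and> \<epsilon> < \<epsilon>1 \<longrightarrow> infinite (range (\<lambda>k. graph_over (D k) (h k \<epsilon>)))))
     \<and>
     (\<forall>(k :: 'n \<Rightarrow> int) (D :: 'n slow set). admissible_domain I k D \<longrightarrow>
        (\<exists>\<epsilon>0>0. \<exists>h :: real \<Rightarrow> 'n slow \<Rightarrow> real^'n.
           slow_invariant_family I lam \<eta> k D \<epsilon>0 h \<and>
           (attracting_condition I k D \<longrightarrow> attracting I lam \<eta> D \<epsilon>0 h) \<and>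
           (repelling_condition I k D \<longrightarrow> repelling I lam \<eta> D \<epsilon>0 h) \<and>
           (\<not> attracting_condition I k D \<and> \<not> repelling_condition I k D \<longrightarrow>
              (\<forall>\<epsilon>. 0 < \<epsilon> \<and> \<epsilon> < \<epsilon>0 \<longrightarrow> saddle_type I D (h \<epsilon>)))))"
  by (intro conjI allI impI infinitely_many_slow_manifolds[OF assms(1,2)] slow_manifold_over_domain[OF assms(1,2)])

end
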